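(* Let $X$ be a connected and locally relatively 1-connected topological space. Then for any group $G$ there is an isomorphism of pointed sets $$H^1(X;G_X)\xrightarrow{\ \sim\ }\mathrm{Hom}(\pi_1(X),G)/G.$$
   Context: A topological space $X$ is locally relatively 1-connected if each point $x\in X$ has a fundamental system of arcwise connected neighborhoods $U$ such that each loop $\gamma$ in $U$ is homotopic in $X$ to a constant path. $G$ is a not necessarily commutative group, $G_X$ the constant sheaf of groups on $X$ with stalk $G$, and $H^1(X;G_X)$ the pointed set of isomorphism classes of (right) $G_X$-torsors on $X$. $\pi_1(X)$ is the fundamental group at a fixed base point; $\mathrm{Hom}$ denotes group homomorphisms, and $G$ acts on the left on $\mathrm{Hom}(\pi_1(X),G)$ by conjugation, $g\cdot\varphi=\mathrm{ad}(g)\circ\varphi$ with $\mathrm{ad}(g)(h)=ghg^{-1}$. *)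

theory Defs
  imports "HOL-Analysis.Analysis" "HOL-Algebra.Group_Action"
begin

section \<open>Paths, the fundamental group, local relative 1-connectedness\<close>

text \<open>
  The library's \<open>homotopic_paths\<close> and \<open>+++\<close> are restricted to the type class of topological
  spaces; the following are the same notions for an abstract topology. Homotopies of paths
  keep the end points fixed.
\<close>

definition path_homotopic :: "'x topology \<Rightarrow> (real \<Rightarrow> 'x) \<Rightarrow> (real \<Rightarrow> 'x) \<Rightarrow> bool" where
  "path_homotopic X p q \<longleftrightarrow>
     homotopic_with (\<lambda>r. r 0 = p 0 \<and> r 1 = p 1) (top_of_set {0..1}) X p q"

definition path_join :: "(real \<Rightarrow> 'x) \<Rightarrow> (real \<Rightarrow> 'x) \<Rightarrow> real \<Rightarrow> 'x" where
  "path_join p q = (\<lambda>t. if t \<le> 1/2 then p (2 * t) else q (2 * t - 1))"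

definition loops_at :: "'x topology \<Rightarrow> 'x \<Rightarrow> (real \<Rightarrow> 'x) set" where
  "loops_at X a = {p. pathin X p \<and> p 0 = a \<and> p 1 = a}"

definition loop_homotopy :: "'x topology \<Rightarrow> 'x \<Rightarrow> ((real \<Rightarrow> 'x) \<times> (real \<Rightarrow> 'x)) set" where
  "loop_homotopy X a = {(p, q). p \<in> loops_at X a \<and> q \<in> loops_at X a \<and> path_homotopic X p q}"

text \<open>The product of two classes: \<open>path_join\<close> respects homotopy, so the union is over equal classes.\<close>

definition pi1 :: "'x topology \<Rightarrow> 'x \<Rightarrow> (real \<Rightarrow> 'x) set monoid" where
  "pi1 X a =
     \<lparr>carrier = loops_at X a // loop_homotopy X a,
      mult = (\<lambda>A B. \<Union>p\<in>A. \<Union>q\<in>B. loop_homotopy X a `` {path_join p q}),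
      one = loop_homotopy X a `` {\<lambda>t. a}\<rparr>"

definition locally_relatively_1_connected :: "'x topology \<Rightarrow> bool" where
  "locally_relatively_1_connected X \<longleftrightarrow>
     neighbourhood_base_of
       (\<lambda>U. path_connectedin X U \<and>
            (\<forall>\<gamma>. pathin (subtopology X U) \<gamma> \<and> \<gamma> 0 = \<gamma> 1 \<longrightarrow> path_homotopic X \<gamma> (\<lambda>t. \<gamma> 0))) X"


section \<open>Sheaves of sets and of groups\<close>

text \<open>
  Only the values at open subsets are relevant: all axioms and all notions of morphism below
  are relativized to open sets. \<open>restr F U V\<close> is the restriction from \<open>U\<close> to \<open>V \<subseteq> U\<close>.
\<close>

record ('x, 's) presheaf =
  sections :: "'x set \<Rightarrow> 's set"
  restr :: "'x set \<Rightarrow> 'x set \<Rightarrow> 's \<Rightarrow> 's"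

definition is_presheaf :: "'x topology \<Rightarrow> ('x, 's, 'm) presheaf_scheme \<Rightarrow> bool" where
  "is_presheaf X F \<longleftrightarrow>
     (\<forall>U V. openin X U \<and> openin X V \<and> V \<subseteq> U \<longrightarrow> restr F U V \<in> sections F U \<rightarrow> sections F V) \<and>
     (\<forall>U. openin X U \<longrightarrow> (\<forall>s\<in>sections F U. restr F U U s = s)) \<and>
     (\<forall>U V W. openin X U \<and> openin X V \<and> openin X W \<and> W \<subseteq> V \<and> V \<subseteq> U \<longrightarrow>
        (\<forall>s\<in>sections F U. restr F V W (restr F U V s) = restr F U W s))"

text \<open>
  The covering family is indexed by its own members. The empty family is included and forces
  the sections over the empty set to be a singleton.
\<close>

definition is_sheaf :: "'x topology \<Rightarrow> ('x, 's, 'm) presheaf_scheme \<Rightarrow> bool" where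
  "is_sheaf X F \<longleftrightarrow> is_presheaf X F \<and>
     (\<forall>\<U> s. (\<forall>V\<in>\<U>. openin X V) \<and> (\<forall>V\<in>\<U>. s V \<in> sections F V) \<and>
        (\<forall>V\<in>\<U>. \<forall>W\<in>\<U>. restr F V (V \<inter> W) (s V) = restr F W (V \<inter> W) (s W)) \<longrightarrow>
        (\<exists>!t. t \<in> sections F (\<Union>\<U>) \<and> (\<forall>V\<in>\<U>. restr F (\<Union>\<U>) V t = s V)))"

record ('x, 'a) group_presheaf =
  gsections :: "'x set \<Rightarrow> 'a monoid"
  grestr :: "'x set \<Rightarrow> 'x set \<Rightarrow> 'a \<Rightarrow> 'a"

definition underlying_presheaf :: "('x, 'a) group_presheaf \<Rightarrow> ('x, 'a) presheaf" where
  "underlying_presheaf A = \<lparr>sections = (\<lambda>U. carrier (gsections A U)), restr = grestr A\<rparr>"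

definition is_group_sheaf :: "'x topology \<Rightarrow> ('x, 'a) group_presheaf \<Rightarrow> bool" where
  "is_group_sheaf X A \<longleftrightarrow> is_sheaf X (underlying_presheaf A) \<and>
     (\<forall>U. openin X U \<longrightarrow> group (gsections A U)) \<and>
     (\<forall>U V. openin X U \<and> openin X V \<and> V \<subseteq> U \<longrightarrow>
        grestr A U V \<in> hom (gsections A U) (gsections A V))"

text \<open>
  The sections of the constant sheaf over \<open>U\<close> are the locally constant maps from \<open>U\<close> to \<open>G\<close>,
  i.e. the continuous maps to \<open>G\<close> with the discrete topology. They are made \<open>undefined\<close> outside
  \<open>U\<close> so that equality of sections is equality on \<open>U\<close>.
\<close>

definition constant_sheaf ::
  "'x topology \<Rightarrow> ('g, 'm) monoid_scheme \<Rightarrow> ('x, 'x \<Rightarrow> 'g) group_presheaf" where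
  "constant_sheaf X G =
     \<lparr>gsections = (\<lambda>U.
        \<lparr>carrier = {f \<in> extensional U.
             continuous_map (subtopology X U) (discrete_topology (carrier G)) f},
         mult = (\<lambda>f g. \<lambda>x\<in>U. f x \<otimes>\<^bsub>G\<^esub> g x),
         one = (\<lambda>x\<in>U. \<one>\<^bsub>G\<^esub>)\<rparr>),
      grestr = (\<lambda>U V f. restrict f V)\<rparr>"


section \<open>Torsors\<close>

record ('x, 's, 'a) presheaf_with_action = "('x, 's) presheaf" +
  action :: "'x set \<Rightarrow> 's \<Rightarrow> 'a \<Rightarrow> 's"

definition is_torsor ::
  "'x topology \<Rightarrow> ('x, 'a) group_presheaf \<Rightarrow> ('x, 's, 'a) presheaf_with_action \<Rightarrow> bool" where
  "is_torsor X A P \<longleftrightarrow> is_sheaf X P \<and>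
     (\<forall>U. openin X U \<longrightarrow>
        (\<forall>s\<in>sections P U. \<forall>g\<in>carrier (gsections A U). action P U s g \<in> sections P U) \<and>
        (\<forall>s\<in>sections P U. action P U s \<one>\<^bsub>gsections A U\<^esub> = s) \<and>
        (\<forall>s\<in>sections P U. \<forall>g\<in>carrier (gsections A U). \<forall>h\<in>carrier (gsections A U).
           action P U (action P U s g) h = action P U s (g \<otimes>\<^bsub>gsections A U\<^esub> h))) \<and>
     (\<forall>U V. openin X U \<and> openin X V \<and> V \<subseteq> U \<longrightarrow>
        (\<forall>s\<in>sections P U. \<forall>g\<in>carrier (gsections A U).
           restr P U V (action P U s g) = action P V (restr P U V s) (grestr A U V g))) \<and>
     (\<forall>x\<in>topspace X. \<exists>U. openin X U \<and> x \<in> U \<and> sections P U \<noteq> {}) \<and>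
     (\<forall>U. openin X U \<longrightarrow> (\<forall>s\<in>sections P U. \<forall>t\<in>sections P U.
        \<exists>!g. g \<in> carrier (gsections A U) \<and> action P U s g = t))"

definition torsors_isomorphic ::
  "'x topology \<Rightarrow> ('x, 'a) group_presheaf \<Rightarrow>
   ('x, 's, 'a) presheaf_with_action \<Rightarrow> ('x, 't, 'a) presheaf_with_action \<Rightarrow> bool" where
  "torsors_isomorphic X A P Q \<longleftrightarrow> (\<exists>\<phi>.
     (\<forall>U. openin X U \<longrightarrow> bij_betw (\<phi> U) (sections P U) (sections Q U)) \<and>
     (\<forall>U V. openin X U \<and> openin X V \<and> V \<subseteq> U \<longrightarrow>
        (\<forall>s\<in>sections P U. \<phi> V (restr P U V s) = restr Q U V (\<phi> U s))) \<and>
     (\<forall>U. openin X U \<longrightarrow> (\<forall>s\<in>sections P U. \<forall>g\<in>carrier (gsections A U).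
        \<phi> U (action P U s g) = action Q U (\<phi> U s) g)))"

definition trivial_torsor ::
  "('x, 'a) group_presheaf \<Rightarrow> ('x, 'a, 'a) presheaf_with_action" where
  "trivial_torsor A =
     \<lparr>sections = (\<lambda>U. carrier (gsections A U)), restr = grestr A,
      action = (\<lambda>U s g. s \<otimes>\<^bsub>gsections A U\<^esub> g)\<rparr>"

definition torsor_isomorphism_rel ::
  "'x topology \<Rightarrow> ('x, 'a) group_presheaf \<Rightarrow>
   (('x, 's, 'a) presheaf_with_action \<times> ('x, 's, 'a) presheaf_with_action) set" where
  "torsor_isomorphism_rel X A =
     {(P, Q). is_torsor X A P \<and> is_torsor X A Q \<and> torsors_isomorphic X A P Q}"

text \<open>
  A quotient has to be taken in one type of sections. For torsors under the constant sheaf,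
  \<open>'x \<Rightarrow> 'g\<close> suffices: by \<open>torsor_has_representative\<close> below, every torsor, with sections in
  any type whatsoever, is isomorphic to one with sections in that type.
\<close>

definition H1_const ::
  "'x topology \<Rightarrow> ('g, 'm) monoid_scheme \<Rightarrow> ('x, 'x \<Rightarrow> 'g, 'x \<Rightarrow> 'g) presheaf_with_action set set" where
  "H1_const X G =
     {P. is_torsor X (constant_sheaf X G) P} // torsor_isomorphism_rel X (constant_sheaf X G)"

definition H1_const_point ::
  "'x topology \<Rightarrow> ('g, 'm) monoid_scheme \<Rightarrow> ('x, 'x \<Rightarrow> 'g, 'x \<Rightarrow> 'g) presheaf_with_action set" where
  "H1_const_point X G =
     torsor_isomorphism_rel X (constant_sheaf X G) `` {trivial_torsor (constant_sheaf X G)}"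


section \<open>Homomorphisms up to conjugation\<close>

text \<open>
  \<open>hom\<close> does not constrain the values outside the carrier; intersecting with \<open>extensional\<close>
  makes each homomorphism a single element.
\<close>

definition Hom :: "('p, 'm) monoid_scheme \<Rightarrow> ('g, 'n) monoid_scheme \<Rightarrow> ('p \<Rightarrow> 'g) set" where
  "Hom K G = hom K G \<inter> extensional (carrier K)"

definition conj_action ::
  "('p, 'm) monoid_scheme \<Rightarrow> ('g, 'n) monoid_scheme \<Rightarrow> 'g \<Rightarrow> ('p \<Rightarrow> 'g) \<Rightarrow> 'p \<Rightarrow> 'g" where
  "conj_action K G g \<phi> = (\<lambda>c\<in>carrier K. g \<otimes>\<^bsub>G\<^esub> \<phi> c \<otimes>\<^bsub>G\<^esub> inv\<^bsub>G\<^esub> g)"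

definition Hom_mod_conj ::
  "('p, 'm) monoid_scheme \<Rightarrow> ('g, 'n) monoid_scheme \<Rightarrow> ('p \<Rightarrow> 'g) set set" where
  "Hom_mod_conj K G = orbits G (Hom K G) (conj_action K G)"

definition Hom_mod_conj_point ::
  "('p, 'm) monoid_scheme \<Rightarrow> ('g, 'n) monoid_scheme \<Rightarrow> ('p \<Rightarrow> 'g) set" where
  "Hom_mod_conj_point K G = orbit G (conj_action K G) (\<lambda>c\<in>carrier K. \<one>\<^bsub>G\<^esub>)"


section \<open>Basic facts; every torsor has a representative in the chosen type\<close>
lemma is_presheafD:
  assumes "is_presheaf X F" "openin X U" "openin X V" "V \<subseteq> U" "s \<in> sections F U"
  shows "restr F U V s \<in> sections F V"
    and "restr F U U s = s"
    and "openin X W \<Longrightarrow> W \<subseteq> V \<Longrightarrow> restr F V W (restr F U V s) = restr F U W s"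
proof -
  note P = assms(1)[unfolded is_presheaf_def]
  show "restr F U V s \<in> sections F V"
    using P[THEN conjunct1, rule_format, of U V] assms(2-5) by blast
  show "restr F U U s = s"
    by (rule P[THEN conjunct2, THEN conjunct1, rule_format, OF assms(2,5)])
  show "restr F V W (restr F U V s) = restr F U W s" if "openin X W" "W \<subseteq> V"
    by (rule P[THEN conjunct2, THEN conjunct2, rule_format, OF _ assms(5)]) (intro conjI assms that)
qed

lemma is_sheafD_glue:
  assumes "is_sheaf X F"
    and "\<And>V. V \<in> \<U> \<Longrightarrow> openin X V"
    and "\<And>V. V \<in> \<U> \<Longrightarrow> s V \<in> sections F V"
    and "\<And>V W. V \<in> \<U> \<Longrightarrow> W \<in> \<U> \<Longrightarrow> restr F V (V \<inter> W) (s V) = restr F W (V \<inter> W) (s W)"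
  shows "\<exists>!t. t \<in> sections F (\<Union>\<U>) \<and> (\<forall>V\<in>\<U>. restr F (\<Union>\<U>) V t = s V)"
proof -
  have "\<forall>\<U> s. (\<forall>V\<in>\<U>. openin X V) \<and> (\<forall>V\<in>\<U>. s V \<in> sections F V) \<and>
        (\<forall>V\<in>\<U>. \<forall>W\<in>\<U>. restr F V (V \<inter> W) (s V) = restr F W (V \<inter> W) (s W)) \<longrightarrow>
        (\<exists>!t. t \<in> sections F (\<Union>\<U>) \<and> (\<forall>V\<in>\<U>. restr F (\<Union>\<U>) V t = s V))"
    using assms(1) unfolding is_sheaf_def by (elim conjE)
  then show ?thesis
    by (elim allE[of _ \<U>] allE[of _ s] impE) (intro conjI ballI assms(2-4); assumption)
qed

lemma is_sheafD_separated:
  assumes F: "is_sheaf X F" and op: "\<And>V. V \<in> \<U> \<Longrightarrow> openin X V"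
    and s: "s \<in> sections F (\<Union>\<U>)" and t: "t \<in> sections F (\<Union>\<U>)"
    and eq: "\<And>V. V \<in> \<U> \<Longrightarrow> restr F (\<Union>\<U>) V s = restr F (\<Union>\<U>) V t"
  shows "s = t"
proof -
  have P: "is_presheaf X F" using F by (simp add: is_sheaf_def)
  have opU: "openin X (\<Union>\<U>)" using op by blast
  define r where "r V = restr F (\<Union>\<U>) V s" for V
  have 1: "\<forall>V\<in>\<U>. openin X V" using op by blast
  have 2: "\<forall>V\<in>\<U>. r V \<in> sections F V"
    unfolding r_def using is_presheafD(1)[OF P opU op _ s] by blast
  have 3: "\<forall>V\<in>\<U>. \<forall>W\<in>\<U>. restr F V (V \<inter> W) (r V) = restr F W (V \<inter> W) (r W)"
  proof (intro ballI)
    fix V W assume VW: "V \<in> \<U>" "W \<in> \<U>"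
    then have "openin X V" "openin X W" "openin X (V \<inter> W)" "V \<subseteq> \<Union>\<U>" "W \<subseteq> \<Union>\<U>"
      using op by auto
    then show "restr F V (V \<inter> W) (r V) = restr F W (V \<inter> W) (r W)"
      unfolding r_def using is_presheafD(3)[OF P opU _ _ s] by simp
  qed
  have ex1: "\<exists>!u. u \<in> sections F (\<Union>\<U>) \<and> (\<forall>V\<in>\<U>. restr F (\<Union>\<U>) V u = r V)"
    by (rule is_sheafD_glue[OF F op]) (use 2 3 in auto)
  have rs: "\<forall>V\<in>\<U>. restr F (\<Union>\<U>) V s = r V" and rt: "\<forall>V\<in>\<U>. restr F (\<Union>\<U>) V t = r V"
    using eq by (auto simp: r_def)
  show ?thesis
    using the1_equality[OF ex1 conjI[OF s rs]] the1_equality[OF ex1 conjI[OF t rt]] by (rule trans[OF sym])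
qed

lemma is_torsorD:
  assumes "is_torsor X A P"
  shows "is_sheaf X P" and "is_presheaf X P"
    and "\<And>U s g. openin X U \<Longrightarrow> s \<in> sections P U \<Longrightarrow> g \<in> carrier (gsections A U) \<Longrightarrow>
           action P U s g \<in> sections P U"
    and "\<And>U s. openin X U \<Longrightarrow> s \<in> sections P U \<Longrightarrow> action P U s \<one>\<^bsub>gsections A U\<^esub> = s"
    and "\<And>U s g h. openin X U \<Longrightarrow> s \<in> sections P U \<Longrightarrow> g \<in> carrier (gsections A U) \<Longrightarrow>
           h \<in> carrier (gsections A U) \<Longrightarrow>
           action P U (action P U s g) h = action P U s (g \<otimes>\<^bsub>gsections A U\<^esub> h)"
    and "\<And>U V s g. openin X U \<Longrightarrow> openin X V \<Longrightarrow> V \<subseteq> U \<Longrightarrow> s \<in> sections P U \<Longrightarrow>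
           g \<in> carrier (gsections A U) \<Longrightarrow>
           restr P U V (action P U s g) = action P V (restr P U V s) (grestr A U V g)"
    and "\<And>x. x \<in> topspace X \<Longrightarrow> \<exists>U. openin X U \<and> x \<in> U \<and> sections P U \<noteq> {}"
    and "\<And>U s t. openin X U \<Longrightarrow> s \<in> sections P U \<Longrightarrow> t \<in> sections P U \<Longrightarrow>
           \<exists>!g. g \<in> carrier (gsections A U) \<and> action P U s g = t"
proof -
  note T = assms[unfolded is_torsor_def]
  note c1 = T[THEN conjunct1] and r1 = T[THEN conjunct2]
  note c2 = r1[THEN conjunct1] and r2 = r1[THEN conjunct2]
  note c3 = r2[THEN conjunct1] and r3 = r2[THEN conjunct2]
  show "is_sheaf X P" by (rule c1)
  show "is_presheaf X P" using c1 unfolding is_sheaf_def by (rule conjunct1)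
  fix U s assume U: "openin X U" and s: "s \<in> sections P U"
  note c2U = c2[rule_format, OF U]
  show "action P U s \<one>\<^bsub>gsections A U\<^esub> = s"
    using c2U[THEN conjunct2, THEN conjunct1] s by (rule bspec)
  fix g assume g: "g \<in> carrier (gsections A U)"
  show "action P U s g \<in> sections P U"
    by (rule c2U[THEN conjunct1, rule_format, OF s g])
  show "restr P U V (action P U s g) = action P V (restr P U V s) (grestr A U V g)"
    if "openin X V" "V \<subseteq> U" for V
    by (rule c3[rule_format]) (intro conjI U s g that)+
  fix h assume "h \<in> carrier (gsections A U)"
  then show "action P U (action P U s g) h = action P U s (g \<otimes>\<^bsub>gsections A U\<^esub> h)"
    by (rule c2U[THEN conjunct2, THEN conjunct2, rule_format, OF s g])
next
  note T = assms[unfolded is_torsor_def, THEN conjunct2, THEN conjunct2, THEN conjunct2]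
  show "\<exists>U. openin X U \<and> x \<in> U \<and> sections P U \<noteq> {}" if "x \<in> topspace X" for x
    using T[THEN conjunct1] that by (rule bspec)
  show "\<exists>!g. g \<in> carrier (gsections A U) \<and> action P U s g = t"
    if "openin X U" "s \<in> sections P U" "t \<in> sections P U" for U s t
    by (rule T[THEN conjunct2, rule_format, OF that])
qed

lemma torsors_isomorphic_refl: "torsors_isomorphic X A P P"
  unfolding torsors_isomorphic_def by (rule exI[of _ "\<lambda>U s. s"]) (simp add: bij_betw_def)

lemma transport_torsor:
  fixes P :: "('x, 's, 'a) presheaf_with_action" and \<theta> :: "'x set \<Rightarrow> 's \<Rightarrow> 't"
  assumes P: "is_torsor X A P" and gA: "is_group_sheaf X A"
    and inj: "\<And>U. openin X U \<Longrightarrow> inj_on (\<theta> U) (sections P U)"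
  shows "\<exists>Q :: ('x, 't, 'a) presheaf_with_action. is_torsor X A Q \<and> torsors_isomorphic X A P Q"
proof -
  define \<eta> where "\<eta> U = inv_into (sections P U) (\<theta> U)" for U
  define Q :: "('x, 't, 'a) presheaf_with_action" where "Q = \<lparr>sections = (\<lambda>U. \<theta> U ` sections P U), 
      restr = (\<lambda>U V q. \<theta> V (restr P U V (\<eta> U q))),
      action = (\<lambda>U q g. \<theta> U (action P U (\<eta> U q) g))\<rparr>"
  have sh: "is_sheaf X P" and pre: "is_presheaf X P"
    by (rule is_torsorD[OF P])+
  have \<eta>\<theta>: "\<eta> U (\<theta> U s) = s" if "openin X U" "s \<in> sections P U" for U s
    using inj that by (simp add: \<eta>_def)
  have \<theta>eq: "\<theta> U s = \<theta> U t \<longleftrightarrow> s = t" if "openin X U" "s \<in> sections P U" "t \<in> sections P U" for U s t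
    using inj that by (auto simp: inj_on_def)
  have secQ: "sections Q U = \<theta> U ` sections P U" for U by (simp add: Q_def)
  have resQ: "restr Q U V (\<theta> U s) = \<theta> V (restr P U V s)" if "openin X U" "s \<in> sections P U" for U V s
    using that by (simp add: Q_def \<eta>\<theta>)
  have actQ: "action Q U (\<theta> U s) g = \<theta> U (action P U s g)" if "openin X U" "s \<in> sections P U" for U s g
    using that by (simp add: Q_def \<eta>\<theta>)
  have resP: "restr P U V s \<in> sections P V" if "openin X U" "openin X V" "V \<subseteq> U" "s \<in> sections P U" for U V s
    using is_presheafD(1)[OF pre that] .
  have actP: "action P U s g \<in> sections P U" if "openin X U" "s \<in> sections P U" "g \<in> carrier (gsections A U)" for U s g
    using is_torsorD(3)[OF P that] .
  have preQ: "is_presheaf X Q"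
    unfolding is_presheaf_def
  proof (intro conjI allI impI ballI)
    fix U V assume "openin X U \<and> openin X V \<and> V \<subseteq> U"
    then show "restr Q U V \<in> sections Q U \<rightarrow> sections Q V"
      using resP[of U V] by (auto simp: secQ resQ)
  next
    fix U s assume "openin X U" "s \<in> sections Q U"
    then show "restr Q U U s = s"
      using is_presheafD(2)[OF pre, of U U] by (auto simp: secQ resQ)
  next
    fix U V W s
    assume "openin X U \<and> openin X V \<and> openin X W \<and> W \<subseteq> V \<and> V \<subseteq> U" "s \<in> sections Q U"
    then show "restr Q V W (restr Q U V s) = restr Q U W s"
      using is_presheafD(3)[OF pre, of U V _ W] resP[of U V] by (auto simp: secQ resQ)
  qed
  have shQ: "is_sheaf X Q"
    unfolding is_sheaf_def
  proof (intro conjI preQ allI impI)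
    fix \<U> q
    assume H: "(\<forall>V\<in>\<U>. openin X V) \<and> (\<forall>V\<in>\<U>. q V \<in> sections Q V) \<and>
        (\<forall>V\<in>\<U>. \<forall>W\<in>\<U>. restr Q V (V \<inter> W) (q V) = restr Q W (V \<inter> W) (q W))"
    define s where "s V = \<eta> V (q V)" for V
    have op: "openin X V" if "V \<in> \<U>" for V using H that by blast
    have opU: "openin X (\<Union>\<U>)" using op by blast
    have s: "s V \<in> sections P V" and q: "q V = \<theta> V (s V)" if "V \<in> \<U>" for V
    proof -
      have "q V \<in> \<theta> V ` sections P V" using H that by (auto simp: secQ)
      then show "s V \<in> sections P V" "q V = \<theta> V (s V)"
        unfolding s_def \<eta>_def by (simp_all add: inv_into_into f_inv_into_f)
    qed
    have "restr P V (V \<inter> W) (s V) = restr P W (V \<inter> W) (s W)" if VW: "V \<in> \<U>" "W \<in> \<U>" for V W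
    proof -
      have "restr Q V (V \<inter> W) (q V) = restr Q W (V \<inter> W) (q W)" using H VW by blast
      then show ?thesis
        using VW by (simp add: q resQ op s openin_Int \<theta>eq resP)
    qed
    then have "\<exists>!t. t \<in> sections P (\<Union>\<U>) \<and> (\<forall>V\<in>\<U>. restr P (\<Union>\<U>) V t = s V)"
      by (intro is_sheafD_glue[OF sh] op s)
    then obtain t where t: "t \<in> sections P (\<Union>\<U>)" "\<And>V. V \<in> \<U> \<Longrightarrow> restr P (\<Union>\<U>) V t = s V"
      and uniq: "\<And>u. u \<in> sections P (\<Union>\<U>) \<Longrightarrow> \<forall>V\<in>\<U>. restr P (\<Union>\<U>) V u = s V \<Longrightarrow> u = t"
      by blast
    show "\<exists>!t. t \<in> sections Q (\<Union>\<U>) \<and> (\<forall>V\<in>\<U>. restr Q (\<Union>\<U>) V t = q V)"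
    proof (rule ex1I[of _ "\<theta> (\<Union>\<U>) t"])
      show "\<theta> (\<Union>\<U>) t \<in> sections Q (\<Union>\<U>) \<and> (\<forall>V\<in>\<U>. restr Q (\<Union>\<U>) V (\<theta> (\<Union>\<U>) t) = q V)"
        using t by (simp add: secQ resQ opU q)
    next
      fix r assume r: "r \<in> sections Q (\<Union>\<U>) \<and> (\<forall>V\<in>\<U>. restr Q (\<Union>\<U>) V r = q V)"
      then obtain u where u: "u \<in> sections P (\<Union>\<U>)" "r = \<theta> (\<Union>\<U>) u" by (auto simp: secQ)
      have "restr P (\<Union>\<U>) V u = s V" if "V \<in> \<U>" for V
      proof -
        have "\<theta> V (restr P (\<Union>\<U>) V u) = \<theta> V (s V)"
          using r that u by (simp add: resQ opU q)
        moreover have "restr P (\<Union>\<U>) V u \<in> sections P V"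
          using resP[OF opU op[OF that] _ u(1)] that by blast
        ultimately show ?thesis using \<theta>eq op that s by blast
      qed
      then show "r = \<theta> (\<Union>\<U>) t" using uniq u by blast
    qed
  qed
  have "is_torsor X A Q"
    unfolding is_torsor_def
  proof (intro conjI shQ allI impI)
    fix U assume U: "openin X U"
    interpret group "gsections A U" using gA U by (auto simp: is_group_sheaf_def)
    show "\<forall>s\<in>sections Q U. \<forall>g\<in>carrier (gsections A U). action Q U s g \<in> sections Q U"
      using actP U by (auto simp: secQ actQ)
    show "\<forall>s\<in>sections Q U. action Q U s \<one>\<^bsub>gsections A U\<^esub> = s"
      using is_torsorD(4)[OF P U] U by (auto simp: secQ actQ)
    show "\<forall>s\<in>sections Q U. \<forall>g\<in>carrier (gsections A U). \<forall>h\<in>carrier (gsections A U).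
           action Q U (action Q U s g) h = action Q U s (g \<otimes>\<^bsub>gsections A U\<^esub> h)"
      using is_torsorD(5)[OF P U] U actP by (auto simp: secQ actQ)
    show "\<forall>s\<in>sections Q U. \<forall>t\<in>sections Q U. \<exists>!g. g \<in> carrier (gsections A U) \<and> action Q U s g = t"
    proof (intro ballI)
      fix s t assume "s \<in> sections Q U" "t \<in> sections Q U"
      then obtain s' t' where st: "s' \<in> sections P U" "t' \<in> sections P U" "s = \<theta> U s'" "t = \<theta> U t'"
        by (auto simp: secQ)
      have "\<exists>!g. g \<in> carrier (gsections A U) \<and> action P U s' g = t'"
        using is_torsorD(8)[OF P U st(1,2)] .
      moreover have "action Q U s g = t \<longleftrightarrow> action P U s' g = t'" if "g \<in> carrier (gsections A U)" for g
        using st U that actP by (simp add: actQ \<theta>eq)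
      ultimately show "\<exists>!g. g \<in> carrier (gsections A U) \<and> action Q U s g = t" by blast
    qed
  next
    fix U V assume UV: "openin X U \<and> openin X V \<and> V \<subseteq> U"
    show "\<forall>s\<in>sections Q U. \<forall>g\<in>carrier (gsections A U).
           restr Q U V (action Q U s g) = action Q V (restr Q U V s) (grestr A U V g)"
      using is_torsorD(6)[OF P, of U V] UV actP resP[of U V] by (auto simp: secQ actQ resQ)
  next
    show "\<forall>x\<in>topspace X. \<exists>U. openin X U \<and> x \<in> U \<and> sections Q U \<noteq> {}"
      using is_torsorD(7)[OF P] by (simp add: secQ)
  qed
  moreover have "torsors_isomorphic X A P Q"
    unfolding torsors_isomorphic_def
    by (rule exI[of _ \<theta>]) (use inj in \<open>auto simp: bij_betw_def secQ resQ actQ\<close>)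
  ultimately show ?thesis by blast
qed

lemma constant_sheaf_simps [simp]:
  "carrier (gsections (constant_sheaf X G) U) =
     {f \<in> extensional U. continuous_map (subtopology X U) (discrete_topology (carrier G)) f}"
  "f \<otimes>\<^bsub>gsections (constant_sheaf X G) U\<^esub> g = (\<lambda>x\<in>U. f x \<otimes>\<^bsub>G\<^esub> g x)"
  "\<one>\<^bsub>gsections (constant_sheaf X G) U\<^esub> = (\<lambda>x\<in>U. \<one>\<^bsub>G\<^esub>)"
  "grestr (constant_sheaf X G) U V f = restrict f V"
  by (simp_all add: constant_sheaf_def)

lemma continuous_map_discrete_iff:
  assumes "openin X U"
  shows "continuous_map (subtopology X U) (discrete_topology C) f \<longleftrightarrow>
    (\<forall>x\<in>U. f x \<in> C \<and> (\<exists>W. openin X W \<and> x \<in> W \<and> W \<subseteq> U \<and> (\<forall>y\<in>W. f y = f x)))"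
    (is "?L \<longleftrightarrow> ?R")
proof -
  have US: "U \<subseteq> topspace X" using assms openin_subset by blast
  then have tU: "topspace (subtopology X U) = U" by auto
  show ?thesis
  proof
    assume L: ?L
    show ?R
    proof
      fix x assume x: "x \<in> U"
      have fx: "f x \<in> C" using L x tU by (force simp: continuous_map_def)
      have "openin (subtopology X U) {y \<in> topspace (subtopology X U). f y \<in> {f x}}"
        by (rule openin_continuous_map_preimage[OF L]) (use fx in simp)
      then have "openin X {y \<in> U. f y = f x}"
        unfolding tU using assms by (simp add: openin_open_subtopology)
      then show "f x \<in> C \<and> (\<exists>W. openin X W \<and> x \<in> W \<and> W \<subseteq> U \<and> (\<forall>y\<in>W. f y = f x))"
        using fx x by (intro conjI exI[of _ "{y \<in> U. f y = f x}"]) auto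
    qed
  next
    assume R: ?R
    show ?L
      unfolding continuous_map_def tU
    proof (intro conjI allI impI)
      show "f \<in> U \<rightarrow> topspace (discrete_topology C)" using R by auto
      fix D assume "openin (discrete_topology C) D"
      have "openin X {x \<in> U. f x \<in> D}"
      proof (subst openin_subopen, safe)
        fix x assume "x \<in> U" "f x \<in> D"
        then obtain W where W: "openin X W" "x \<in> W" "W \<subseteq> U" "\<forall>y\<in>W. f y = f x" using R by blast
        have "W \<subseteq> {x \<in> U. f x \<in> D}"
        proof
          fix y assume y: "y \<in> W"
          have "f y \<in> D" by (subst bspec[OF W(4) y]) fact
          then show "y \<in> {x \<in> U. f x \<in> D}" using y W(3) by blast
        qed
        then show "\<exists>T. openin X T \<and> x \<in> T \<and> T \<subseteq> {x \<in> U. f x \<in> D}"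
          using W(1,2) by (intro exI[of _ W] conjI)
      qed
      then show "openin (subtopology X U) {x \<in> U. f x \<in> D}"
        using assms by (simp add: openin_open_subtopology)
    qed
  qed
qed

lemma constant_sheaf_carrier:
  assumes "openin X U"
  shows "f \<in> carrier (gsections (constant_sheaf X G) U) \<longleftrightarrow>
    f \<in> extensional U \<and>
    (\<forall>x\<in>U. f x \<in> carrier G \<and> (\<exists>W. openin X W \<and> x \<in> W \<and> W \<subseteq> U \<and> (\<forall>y\<in>W. f y = f x)))"
  unfolding constant_sheaf_simps mem_Collect_eq continuous_map_discrete_iff[OF assms] by (rule refl)

lemma is_group_sheaf_constant_sheaf:
  assumes "group G"
  shows "is_group_sheaf X (constant_sheaf X G)"
proof -
  interpret group G by fact
  let ?A = "constant_sheaf X G"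
  let ?C = "\<lambda>U. carrier (gsections ?A U)"
  note cc = constant_sheaf_carrier[where G = G]
  have rst: "restrict f V \<in> ?C V" if "openin X U" "openin X V" "V \<subseteq> U" "f \<in> ?C U" for U V f
    unfolding cc[OF that(2)]
  proof (intro conjI ballI)
    fix x assume x: "x \<in> V"
    then have f: "f x \<in> carrier G" "\<exists>W. openin X W \<and> x \<in> W \<and> W \<subseteq> U \<and> (\<forall>y\<in>W. f y = f x)"
      using that(3,4) unfolding cc[OF that(1)] by blast+
    show "restrict f V x \<in> carrier G" using f x by simp
    from f(2) obtain W where W: "openin X W" "x \<in> W" "W \<subseteq> U" "\<forall>y\<in>W. f y = f x" by blast
    show "\<exists>W. openin X W \<and> x \<in> W \<and> W \<subseteq> V \<and> (\<forall>y\<in>W. restrict f V y = restrict f V x)"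
    proof (intro exI[of _ "W \<inter> V"] conjI ballI)
      fix y assume y: "y \<in> W \<inter> V"
      then have "f y = f x" using W(4) by blast
      then show "restrict f V y = restrict f V x" using x y by simp
    qed (use W(1,2) x that(2) in auto)
  qed simp
  have gr: "group (gsections ?A U)" if U: "openin X U" for U
  proof (rule groupI)
    fix f g assume fg: "f \<in> ?C U" "g \<in> ?C U"
    show "f \<otimes>\<^bsub>gsections ?A U\<^esub> g \<in> ?C U"
      unfolding cc[OF U] constant_sheaf_simps(2)
    proof (intro conjI ballI)
      fix x assume x: "x \<in> U"
      obtain W where W: "openin X W" "x \<in> W" "W \<subseteq> U" "\<forall>y\<in>W. f y = f x"
        using fg(1) x unfolding cc[OF U] by blast
      obtain W' where W': "openin X W'" "x \<in> W'" "W' \<subseteq> U" "\<forall>y\<in>W'. g y = g x"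
        using fg(2) x unfolding cc[OF U] by blast
      show "(\<lambda>x\<in>U. f x \<otimes>\<^bsub>G\<^esub> g x) x \<in> carrier G" using fg x unfolding cc[OF U] by simp
      show "\<exists>W. openin X W \<and> x \<in> W \<and> W \<subseteq> U \<and>
              (\<forall>y\<in>W. (\<lambda>x\<in>U. f x \<otimes>\<^bsub>G\<^esub> g x) y = (\<lambda>x\<in>U. f x \<otimes>\<^bsub>G\<^esub> g x) x)"
      proof (intro exI[of _ "W \<inter> W'"] conjI ballI)
        fix y assume y: "y \<in> W \<inter> W'"
        then have "f y = f x" "g y = g x" using W(4) W'(4) by blast+
        then show "(\<lambda>x\<in>U. f x \<otimes>\<^bsub>G\<^esub> g x) y = (\<lambda>x\<in>U. f x \<otimes>\<^bsub>G\<^esub> g x) x" using x y W(3) by auto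
      qed (use W(1-3) W'(1-3) in auto)
    qed simp
    show "\<exists>h\<in>?C U. h \<otimes>\<^bsub>gsections ?A U\<^esub> f = \<one>\<^bsub>gsections ?A U\<^esub>"
    proof (rule bexI[of _ "\<lambda>x\<in>U. inv\<^bsub>G\<^esub> f x"])
      show "(\<lambda>x\<in>U. inv\<^bsub>G\<^esub> f x) \<otimes>\<^bsub>gsections ?A U\<^esub> f = \<one>\<^bsub>gsections ?A U\<^esub>"
        using fg(1) unfolding cc[OF U] by (auto simp: fun_eq_iff)
      show "(\<lambda>x\<in>U. inv\<^bsub>G\<^esub> f x) \<in> ?C U"
        unfolding cc[OF U]
      proof (intro conjI ballI)
        fix x assume x: "x \<in> U"
        obtain W where W: "openin X W" "x \<in> W" "W \<subseteq> U" "\<forall>y\<in>W. f y = f x"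
          using fg(1) x unfolding cc[OF U] by blast
        show "(\<lambda>x\<in>U. inv\<^bsub>G\<^esub> f x) x \<in> carrier G" using fg x unfolding cc[OF U] by simp
        show "\<exists>W. openin X W \<and> x \<in> W \<and> W \<subseteq> U \<and>
              (\<forall>y\<in>W. (\<lambda>x\<in>U. inv\<^bsub>G\<^esub> f x) y = (\<lambda>x\<in>U. inv\<^bsub>G\<^esub> f x) x)"
        proof (intro exI[of _ W] conjI ballI)
          fix y assume y: "y \<in> W"
          then have "f y = f x" using W(4) by blast
          then show "(\<lambda>x\<in>U. inv\<^bsub>G\<^esub> f x) y = (\<lambda>x\<in>U. inv\<^bsub>G\<^esub> f x) x" using x y W(3) by auto
        qed (use W(1-3) in auto)
      qed simp
    qed
    fix h assume h: "h \<in> ?C U"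
    show "f \<otimes>\<^bsub>gsections ?A U\<^esub> g \<otimes>\<^bsub>gsections ?A U\<^esub> h =
          f \<otimes>\<^bsub>gsections ?A U\<^esub> (g \<otimes>\<^bsub>gsections ?A U\<^esub> h)"
      using fg h unfolding cc[OF U] by (auto simp: fun_eq_iff m_assoc)
  next
    show "\<one>\<^bsub>gsections ?A U\<^esub> \<in> ?C U"
      unfolding constant_sheaf_simps by simp
    fix f assume f: "f \<in> ?C U"
    show "\<one>\<^bsub>gsections ?A U\<^esub> \<otimes>\<^bsub>gsections ?A U\<^esub> f = f"
      using f unfolding cc[OF U] by (auto simp: fun_eq_iff extensional_def)
  qed
  have pre: "is_presheaf X (underlying_presheaf ?A)"
    unfolding is_presheaf_def
  proof (intro conjI allI impI ballI)
    fix U V assume "openin X U \<and> openin X V \<and> V \<subseteq> U"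
    then show "restr (underlying_presheaf ?A) U V
        \<in> sections (underlying_presheaf ?A) U \<rightarrow> sections (underlying_presheaf ?A) V"
      using rst[of U V] by (simp add: underlying_presheaf_def del: constant_sheaf_simps(1))
  qed (auto simp: underlying_presheaf_def extensional_restrict Int_absorb1)
  have sh: "is_sheaf X (underlying_presheaf ?A)"
    unfolding is_sheaf_def
  proof (intro conjI pre allI impI)
    fix \<U> s
    assume H: "(\<forall>V\<in>\<U>. openin X V) \<and> (\<forall>V\<in>\<U>. s V \<in> sections (underlying_presheaf ?A) V) \<and>
        (\<forall>V\<in>\<U>. \<forall>W\<in>\<U>. restr (underlying_presheaf ?A) V (V \<inter> W) (s V) =
                         restr (underlying_presheaf ?A) W (V \<inter> W) (s W))"
    have op: "openin X V" and sV: "s V \<in> ?C V" if "V \<in> \<U>" for V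
      using H that by (auto simp: underlying_presheaf_def)
    have opU: "openin X (\<Union>\<U>)" using op by blast
    have agree: "s V x = s W x" if "V \<in> \<U>" "W \<in> \<U>" "x \<in> V" "x \<in> W" for V W x
    proof -
      have "restrict (s V) (V \<inter> W) = restrict (s W) (V \<inter> W)"
        using H[THEN conjunct2, THEN conjunct2, rule_format, OF that(1,2)]
        by (simp add: underlying_presheaf_def)
      then show ?thesis using that(3,4) by (metis IntI restrict_apply')
    qed
    define t where "t = (\<lambda>x\<in>\<Union>\<U>. s (SOME V. V \<in> \<U> \<and> x \<in> V) x)"
    have t: "t x = s V x" if "V \<in> \<U>" "x \<in> V" for V x
    proof -
      define V' where "V' = (SOME V. V \<in> \<U> \<and> x \<in> V)"
      have V': "V' \<in> \<U> \<and> x \<in> V'"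
        unfolding V'_def by (rule someI[of _ V]) (use that in auto)
      have "t x = s V' x" using that by (auto simp: t_def V'_def)
      also have "\<dots> = s V x" using agree[of V' V x] V' that by blast
      finally show ?thesis .
    qed
    have tC: "t \<in> ?C (\<Union>\<U>)"
      unfolding cc[OF opU]
    proof (intro conjI ballI)
      show "t \<in> extensional (\<Union>\<U>)" by (simp add: t_def)
      fix x assume "x \<in> \<Union>\<U>"
      then obtain V where V: "V \<in> \<U>" "x \<in> V" by blast
      have sx: "s V x \<in> carrier G" "\<exists>W. openin X W \<and> x \<in> W \<and> W \<subseteq> V \<and> (\<forall>y\<in>W. s V y = s V x)"
        using sV[OF V(1)] V(2) unfolding cc[OF op[OF V(1)]] by blast+
      show "t x \<in> carrier G" using sx(1) t[OF V] by simp
      from sx(2) obtain W where W: "openin X W" "x \<in> W" "W \<subseteq> V" "\<forall>y\<in>W. s V y = s V x" by blast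
      have "t y = t x" if y: "y \<in> W" for y
        using bspec[OF W(4) y] t[OF V] t[OF V(1) subsetD[OF W(3) y]] by simp
      then show "\<exists>W. openin X W \<and> x \<in> W \<and> W \<subseteq> \<Union>\<U> \<and> (\<forall>y\<in>W. t y = t x)"
        using W(1-3) V(1) by (intro exI[of _ W]) blast
    qed
    have ext: "s V \<in> extensional V" if "V \<in> \<U>" for V
      using sV[OF that] by simp
    show "\<exists>!t. t \<in> sections (underlying_presheaf ?A) (\<Union>\<U>) \<and>
               (\<forall>V\<in>\<U>. restr (underlying_presheaf ?A) (\<Union>\<U>) V t = s V)"
    proof (rule ex1I[of _ t])
      have "restrict t V = s V" if "V \<in> \<U>" for V
      proof
        fix x
        show "restrict t V x = s V x"
          using t[OF that, of x] extensional_arb[OF ext[OF that], of x] by (cases "x \<in> V") simp_all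
      qed
      then show "t \<in> sections (underlying_presheaf ?A) (\<Union>\<U>) \<and>
               (\<forall>V\<in>\<U>. restr (underlying_presheaf ?A) (\<Union>\<U>) V t = s V)"
        using tC by (simp add: underlying_presheaf_def)
    next
      fix u assume u: "u \<in> sections (underlying_presheaf ?A) (\<Union>\<U>) \<and>
               (\<forall>V\<in>\<U>. restr (underlying_presheaf ?A) (\<Union>\<U>) V u = s V)"
      show "u = t"
      proof (rule extensionalityI[of _ "\<Union>\<U>"])
        show "u \<in> extensional (\<Union>\<U>)" using u by (simp add: underlying_presheaf_def)
        show "t \<in> extensional (\<Union>\<U>)" by (simp add: t_def)
        fix x assume "x \<in> \<Union>\<U>"
        then obtain V where V: "V \<in> \<U>" "x \<in> V" by blast
        then have "restrict u V = s V" using u by (simp add: underlying_presheaf_def)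
        then show "u x = t x" using t[OF V] V by (metis restrict_apply')
      qed
    qed
  qed
  show ?thesis
    unfolding is_group_sheaf_def
  proof (intro conjI sh allI impI)
    fix U V assume UV: "openin X U \<and> openin X V \<and> V \<subseteq> U"
    show "grestr ?A U V \<in> hom (gsections ?A U) (gsections ?A V)"
    proof (rule homI)
      fix f g assume "f \<in> ?C U" "g \<in> ?C U"
      then show "grestr ?A U V f \<in> ?C V"
        using rst[of U V f] UV by (simp del: constant_sheaf_simps(1))
      show "grestr ?A U V (f \<otimes>\<^bsub>gsections ?A U\<^esub> g) =
            grestr ?A U V f \<otimes>\<^bsub>gsections ?A V\<^esub> grestr ?A U V g"
        using UV by (auto simp: fun_eq_iff restrict_def)
    qed
  qed (use gr in blast)
qed

lemma is_torsor_trivial_torsor: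
  assumes "is_group_sheaf X A"
  shows "is_torsor X A (trivial_torsor A)"
proof -
  have G: "group (gsections A U)" if "openin X U" for U
    using assms that by (simp add: is_group_sheaf_def)
  have h: "grestr A U V \<in> hom (gsections A U) (gsections A V)"
    if "openin X U" "openin X V" "V \<subseteq> U" for U V
    using assms that by (simp add: is_group_sheaf_def)
  have "is_sheaf X (underlying_presheaf A)"
    using assms unfolding is_group_sheaf_def by (rule conjunct1)
  then have "is_sheaf X (trivial_torsor A)"
    unfolding is_sheaf_def is_presheaf_def underlying_presheaf_def trivial_torsor_def
      presheaf.simps presheaf_with_action.simps .
  moreover have "\<exists>!g. g \<in> carrier (gsections A U) \<and> s \<otimes>\<^bsub>gsections A U\<^esub> g = t"
    if U: "openin X U" and st: "s \<in> carrier (gsections A U)" "t \<in> carrier (gsections A U)" for U s t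
  proof -
    interpret group "gsections A U" by (rule G[OF U])
    show ?thesis
      by (rule ex1I[of _ "inv\<^bsub>gsections A U\<^esub> s \<otimes>\<^bsub>gsections A U\<^esub> t"])
        (use st in \<open>auto simp: m_assoc[symmetric]\<close>)
  qed
  moreover have "\<exists>U. openin X U \<and> x \<in> U \<and> carrier (gsections A U) \<noteq> {}" if "x \<in> topspace X" for x
    using that G[OF openin_topspace] by (metis empty_iff group.is_monoid monoid.one_closed openin_topspace)
  ultimately show ?thesis
    unfolding is_torsor_def
    using group.is_monoid[OF G]
    by (auto simp: trivial_torsor_def monoid.m_closed monoid.r_one monoid.m_assoc hom_mult[OF h])
qed

lemma H1_const_point_in_H1_const:
  assumes "group G"
  shows "H1_const_point X G \<in> H1_const X G"
  unfolding H1_const_point_def H1_const_def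
  by (rule quotientI) (simp add: is_torsor_trivial_torsor is_group_sheaf_constant_sheaf assms)

theorem torsor_has_representative:
  fixes P :: "('x, 's, 'x \<Rightarrow> 'g) presheaf_with_action"
    and G :: "('g, 'm) monoid_scheme"
  assumes "group G" and P: "is_torsor X (constant_sheaf X G) P"
  shows "\<exists>Q :: ('x, 'x \<Rightarrow> 'g, 'x \<Rightarrow> 'g) presheaf_with_action.
           is_torsor X (constant_sheaf X G) Q \<and> torsors_isomorphic X (constant_sheaf X G) P Q"
proof -
  let ?A = "constant_sheaf X G"
  let ?C = "\<lambda>U. carrier (gsections ?A U)"
  have gA: "is_group_sheaf X ?A" by (rule is_group_sheaf_constant_sheaf) fact
  have sh: "is_sheaf X P" and pre: "is_presheaf X P"
    by (rule is_torsorD[OF P])+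
  have simply_trans: "\<exists>!g. g \<in> ?C U \<and> action P U s g = t"
    if "openin X U" "s \<in> sections P U" "t \<in> sections P U" for U s t
    using is_torsorD(8)[OF P that] .
  have res_act: "restr P U V (action P U s g) = action P V (restr P U V s) (restrict g V)"
    if "openin X U" "openin X V" "V \<subseteq> U" "s \<in> sections P U" "g \<in> ?C U" for U V s g
  proof -
    have "restr P U V (action P U s g) = action P V (restr P U V s) (grestr ?A U V g)"
      using is_torsorD(6)[OF P that] .
    then show ?thesis by simp
  qed
  have "\<forall>x\<in>topspace X. \<exists>U e. openin X U \<and> x \<in> U \<and> e \<in> sections P U"
    using is_torsorD(7)[OF P] by blast
  then obtain W e where We: "\<And>x. x \<in> topspace X \<Longrightarrow> openin X (W x) \<and> x \<in> W x \<and> e x \<in> sections P (W x)"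
    by metis
  define d where "d U s x = (THE g. g \<in> ?C (U \<inter> W x) \<and>
      action P (U \<inter> W x) (restr P (W x) (U \<inter> W x) (e x)) g = restr P U (U \<inter> W x) s)" for U s x
  have d: "d U s x \<in> ?C (U \<inter> W x) \<and>
      action P (U \<inter> W x) (restr P (W x) (U \<inter> W x) (e x)) (d U s x) = restr P U (U \<inter> W x) s"
    if U: "openin X U" and s: "s \<in> sections P U" and x: "x \<in> U" for U s x
  proof -
    have x': "x \<in> topspace X" using U x openin_subset by blast
    have op: "openin X (U \<inter> W x)" using U We[OF x'] by blast
    have "restr P (W x) (U \<inter> W x) (e x) \<in> sections P (U \<inter> W x)"
      by (rule is_presheafD(1)[OF pre]) (use op We[OF x'] in auto)
    moreover have "restr P U (U \<inter> W x) s \<in> sections P (U \<inter> W x)"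
      by (rule is_presheafD(1)[OF pre]) (use op U s in auto)
    ultimately show ?thesis unfolding d_def by (rule theI'[OF simply_trans[OF op]])
  qed
  have "inj_on (\<lambda>s x. d U s x x) (sections P U)" if U: "openin X U" for U
  proof (rule inj_onI)
    fix s t assume st: "s \<in> sections P U" "t \<in> sections P U" "(\<lambda>x. d U s x x) = (\<lambda>x. d U t x x)"
    have "\<exists>N. openin X N \<and> x \<in> N \<and> N \<subseteq> U \<and> restr P U N s = restr P U N t" if x: "x \<in> U" for x
    proof -
      have x': "x \<in> topspace X" using U x openin_subset by blast
      have W: "openin X (W x)" "x \<in> W x" "e x \<in> sections P (W x)" using We[OF x'] by auto
      have op: "openin X (U \<inter> W x)" using U W by blast
      have e: "restr P (W x) (U \<inter> W x) (e x) \<in> sections P (U \<inter> W x)"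
        by (rule is_presheafD(1)[OF pre]) (use op W in auto)
      note ds = d[OF U st(1) x] and dt = d[OF U st(2) x]
      obtain N1 where N1: "openin X N1" "x \<in> N1" "N1 \<subseteq> U \<inter> W x" "\<forall>y\<in>N1. d U s x y = d U s x x"
        using ds x W(2) unfolding constant_sheaf_carrier[OF op] by blast
      obtain N2 where N2: "openin X N2" "x \<in> N2" "N2 \<subseteq> U \<inter> W x" "\<forall>y\<in>N2. d U t x y = d U t x x"
        using dt x W(2) unfolding constant_sheaf_carrier[OF op] by blast
      define N where "N = N1 \<inter> N2"
      have N: "openin X N" "x \<in> N" "N \<subseteq> U \<inter> W x" "N \<subseteq> U" using N1 N2 by (auto simp: N_def)
      have "d U s x x = d U t x x" using st(3) by meson
      then have dd: "restrict (d U s x) N = restrict (d U t x) N"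
        using N1(4) N2(4) by (auto simp: N_def fun_eq_iff restrict_def)
      have "restr P U N u = action P N (restr P (U \<inter> W x) N (restr P (W x) (U \<inter> W x) (e x))) (restrict (d U u x) N)"
        if u: "u \<in> sections P U" for u
      proof -
        have "restr P U N u = restr P (U \<inter> W x) N (restr P U (U \<inter> W x) u)"
          using is_presheafD(3)[OF pre U op _ u N(1,3)] by simp
        also have "\<dots> = restr P (U \<inter> W x) N
            (action P (U \<inter> W x) (restr P (W x) (U \<inter> W x) (e x)) (d U u x))"
          using d[OF U u x] by simp
        also have "\<dots> = action P N (restr P (U \<inter> W x) N (restr P (W x) (U \<inter> W x) (e x))) (restrict (d U u x) N)"
          by (rule res_act[OF op N(1,3) e]) (use d[OF U u x] in blast)
        finally show ?thesis .
      qed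
      then show ?thesis using N dd st(1,2) by metis
    qed
    then obtain N where N: "\<And>x. x \<in> U \<Longrightarrow> openin X (N x) \<and> x \<in> N x \<and> N x \<subseteq> U \<and> restr P U (N x) s = restr P U (N x) t"
      by metis
    then have UN: "\<Union>(N ` U) = U" by blast
    show "s = t"
      by (rule is_sheafD_separated[OF sh, of "N ` U"]) (use N st UN in auto)
  qed
  then show ?thesis by (rule transport_torsor[OF P gA])
qed

end

theory Submission
  imports Defs
begin

text \<open>
  Both sides of the bijection classify the same objects, representations of the fundamental
  groupoid of \<open>X\<close> in \<open>G\<close>: functions \<open>\<tau>\<close> on paths that are invariant under homotopy
  and multiplicative under concatenation. Two of them are gauge equivalent if
  \<open>\<tau>' p = k (p 0) \<cdot> \<tau> p \<cdot> (k (p 1))\<^sup>-\<^sup>1\<close> for a function \<open>k\<close> from points to \<open>G\<close>.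

  From torsors to representations: choose a germ of the torsor at every point, with no continuity
  whatsoever (\<open>framing_exists\<close>). Sections then become functions with values in \<open>G\<close>, called
  flat functions, and any two of them differ locally by right multiplication with a constant. The
  pullback of the torsor to an interval or a square has a global section (\<open>lift_square\<close>), unique
  up to a constant (\<open>lift_unique\<close>). Comparing its two end values defines parallel transport, and the
  square makes transport invariant under homotopy (\<open>transport_holonomy\<close>). As every path is a
  concatenation of short ones, transport is the only representation that agrees with the flat
  functions (\<open>transport_unique\<close>). A change of frame changes transport by a gauge transformation.

  From representations to torsors: the sections over \<open>U\<close> are the functions on \<open>U\<close> that \<open>\<tau>\<close>
  declares flat (\<open>transport_torsor\<close>). They form a sheaf, again because paths can be subdivided, and
  locally constant functions act simply transitively because \<open>X\<close> is locally path connected. Local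
  sections exist because of relative 1-connectedness: if loops in a neighbourhood of \<open>x\<close> contract in
  \<open>X\<close>, transport from \<open>x\<close> inside the neighbourhood does not depend on the path
  (\<open>transport_torsor_locally_nonempty\<close>).

  Over a locally path connected space, flatness of a function can be read off from transport
  (\<open>flats_iff_transport\<close>), so that torsors are isomorphic if and only if their transports are
  gauge equivalent. Finally \<open>X\<close> is path connected, so that joining all points to the base point by
  paths extends each homomorphism from the fundamental group to the groupoid
  (\<open>groupoid_rep_of_Hom\<close>), and gauge equivalence becomes conjugation
  (\<open>conj_iff_gauge_equivalent\<close>).
\<close>


section \<open>Paths up to homotopy in an abstract topology\<close>

abbreviation path_reverse :: "(real \<Rightarrow> 'x) \<Rightarrow> real \<Rightarrow> 'x" where
  "path_reverse p \<equiv> \<lambda>t. p (1 - t)"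

lemma path_homotopicI:
  fixes h :: "real \<times> real \<Rightarrow> 'x"
  assumes "continuous_map (top_of_set ({0..1} \<times> {0..1})) X h"
    and "\<And>t. t \<in> {0..1} \<Longrightarrow> h (0, t) = p t" "\<And>t. t \<in> {0..1} \<Longrightarrow> h (1, t) = q t"
    and "\<And>s. s \<in> {0..1} \<Longrightarrow> h (s, 0) = p 0" "\<And>s. s \<in> {0..1} \<Longrightarrow> h (s, 1) = p 1"
  shows "path_homotopic X p q"
  unfolding path_homotopic_def
  by (subst homotopic_with) (use assms in \<open>auto intro!: exI[of _ h]\<close>)

lemma path_homotopicE:
  fixes X :: "'x topology"
  assumes "path_homotopic X p q"
  obtains h :: "real \<times> real \<Rightarrow> 'x" where "continuous_map (top_of_set ({0..1} \<times> {0..1})) X h"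
    and "\<And>t. h (0, t) = p t" "\<And>t. h (1, t) = q t"
    and "\<And>s. s \<in> {0..1} \<Longrightarrow> h (s, 0) = p 0" "\<And>s. s \<in> {0..1} \<Longrightarrow> h (s, 1) = p 1"
proof -
  obtain h :: "real \<times> real \<Rightarrow> 'x" where "continuous_map (top_of_set ({0..1} \<times> {0..1})) X h"
    "\<forall>t. h (0, t) = p t" "\<forall>t. h (1, t) = q t" "\<forall>s\<in>{0..1}. h (s, 0) = p 0 \<and> h (s, 1) = p 1"
    using assms unfolding path_homotopic_def homotopic_with_def by auto
  then show thesis using that[of h] by blast
qed

lemma path_homotopic_imp:
  assumes "path_homotopic X p q"
  shows "pathin X p" "pathin X q" "q 0 = p 0" "q 1 = p 1"
  using homotopic_with_imp_continuous_maps[OF assms[unfolded path_homotopic_def]]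
    homotopic_with_imp_property[OF assms[unfolded path_homotopic_def]]
  by (auto simp: pathin_def)

lemma path_homotopic_refl: "pathin X p \<Longrightarrow> path_homotopic X p p"
  by (simp add: path_homotopic_def pathin_def)

lemma path_homotopic_sym: "path_homotopic X p q \<Longrightarrow> path_homotopic X q p"
  using path_homotopic_imp[of X p q] unfolding path_homotopic_def
  by (auto dest: homotopic_with_symD)

lemma path_homotopic_trans [trans]:
  "path_homotopic X p q \<Longrightarrow> path_homotopic X q r \<Longrightarrow> path_homotopic X p r"
  using path_homotopic_imp[of X p q] unfolding path_homotopic_def
  by (auto intro: homotopic_with_trans)

lemma path_homotopic_subtopology:
  assumes "path_homotopic (subtopology X U) p q"
  shows "path_homotopic X p q"
  using assms unfolding path_homotopic_def homotopic_with_def continuous_map_in_subtopology by blast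

text \<open>All groupoid laws up to homotopy are instances of this: the two sides run through the same
  path at different speeds, and two speeds are joined by the straight line between them.\<close>

lemma path_homotopic_reparametrize:
  assumes f: "pathin X f"
    and u: "continuous_on {0..1} u" "u \<in> {0..1} \<rightarrow> {0..1}"
    and v: "continuous_on {0..1} v" "v \<in> {0..1} \<rightarrow> {0..1}"
    and ends: "u 0 = v 0" "u 1 = v 1"
  shows "path_homotopic X (f \<circ> u) (f \<circ> v)"
proof (rule path_homotopicI)
  let ?m = "\<lambda>z::real \<times> real. (1 - fst z) * u (snd z) + fst z * v (snd z)"
  have cm: "continuous_on ({0..1} \<times> {0..1}) ?m"
    by (intro continuous_intros continuous_on_compose2[OF u(1)] continuous_on_compose2[OF v(1)]) auto
  have "?m \<in> {0..1} \<times> {0..1} \<rightarrow> {0..1}"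
  proof
    fix z :: "real \<times> real" assume z: "z \<in> {0..1} \<times> {0..1}"
    then have "u (snd z) \<in> {0..1}" "v (snd z) \<in> {0..1}" using u(2) v(2) by auto
    then show "?m z \<in> {0..1}"
      using convexD_alt[OF convex_real_interval(5)[of 0 1], of "u (snd z)" "v (snd z)" "fst z"] z by auto
  qed
  then have "continuous_map (top_of_set ({0..1} \<times> {0..1})) (top_of_set {0..1}) ?m"
    using cm by (auto simp: continuous_map_in_subtopology)
  then show "continuous_map (top_of_set ({0..1} \<times> {0..1})) X (f \<circ> ?m)"
    using f continuous_map_compose unfolding pathin_def by blast
qed (use ends in \<open>auto simp: algebra_simps\<close>)

lemma pathin_reparametrize:
  assumes "pathin X f" "continuous_on {0..1} u" "u \<in> {0..1} \<rightarrow> {0..1}"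
  shows "pathin X (f \<circ> u)"
  using path_homotopic_reparametrize[OF assms assms(2,3)] path_homotopic_imp by blast

lemma path_homotopic_join:
  fixes X :: "'x topology"
  assumes "path_homotopic X p p'" "path_homotopic X q q'" and pq: "p 1 = q 0"
  shows "path_homotopic X (path_join p q) (path_join p' q')"
proof -
  obtain h :: "real \<times> real \<Rightarrow> 'x" where h: "continuous_map (top_of_set ({0..1} \<times> {0..1})) X h"
    "\<And>t. h (0, t) = p t" "\<And>t. h (1, t) = p' t"
    "\<And>s. s \<in> {0..1} \<Longrightarrow> h (s, 0) = p 0" "\<And>s. s \<in> {0..1} \<Longrightarrow> h (s, 1) = p 1"
    by (rule path_homotopicE[OF assms(1)]) blast
  obtain k :: "real \<times> real \<Rightarrow> 'x" where k: "continuous_map (top_of_set ({0..1} \<times> {0..1})) X k"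
    "\<And>t. k (0, t) = q t" "\<And>t. k (1, t) = q' t"
    "\<And>s. s \<in> {0..1} \<Longrightarrow> k (s, 0) = q 0" "\<And>s. s \<in> {0..1} \<Longrightarrow> k (s, 1) = q 1"
    by (rule path_homotopicE[OF assms(2)]) blast
  let ?S = "{0..1::real} \<times> {0..1::real}"
  let ?l = "\<lambda>z. if snd z \<le> 1/2 then (h \<circ> (\<lambda>z. (fst z, 2 * snd z))) z
                else (k \<circ> (\<lambda>z. (fst z, 2 * snd z - 1))) z"
  show ?thesis
  proof (rule path_homotopicI)
    show "continuous_map (top_of_set ?S) X ?l"
    proof (rule continuous_map_cases_le)
      show "continuous_map (subtopology (top_of_set ?S) {z \<in> topspace (top_of_set ?S). snd z \<le> 1/2}) X
              (h \<circ> (\<lambda>z. (fst z, 2 * snd z)))"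
        by (rule continuous_map_compose[OF _ h(1)])
          (auto simp: continuous_map_in_subtopology subtopology_subtopology intro!: continuous_intros)
      show "continuous_map (subtopology (top_of_set ?S) {z \<in> topspace (top_of_set ?S). 1/2 \<le> snd z}) X
              (k \<circ> (\<lambda>z. (fst z, 2 * snd z - 1)))"
        by (rule continuous_map_compose[OF _ k(1)])
          (auto simp: continuous_map_in_subtopology subtopology_subtopology intro!: continuous_intros)
    next
      fix z assume z: "z \<in> topspace (top_of_set ?S)" "snd z = 1/2"
      then obtain a where a: "z = (a, 1/2)" "a \<in> {0..1}" by (cases z) auto
      then show "(h \<circ> (\<lambda>z. (fst z, 2 * snd z))) z = (k \<circ> (\<lambda>z. (fst z, 2 * snd z - 1))) z"
        using h(5)[of a] k(4)[of a] pq a by simp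
    qed (auto intro!: continuous_intros)
  qed (use h k pq in \<open>auto simp: path_join_def\<close>)
qed

lemma pathin_join:
  assumes "pathin X p" "pathin X q" "p 1 = q 0"
  shows "pathin X (path_join p q)"
  using path_homotopic_join[OF assms(1,2)[THEN path_homotopic_refl] assms(3)] path_homotopic_imp
  by blast

lemma path_join_ends [simp]: "path_join p q 0 = p 0" "path_join p q 1 = q 1"
  by (simp_all add: path_join_def)

lemma path_join_const: "path_join (\<lambda>t. x) (\<lambda>t. x) = (\<lambda>t. x)"
  by (simp add: path_join_def)

lemma pathin_reverse: "pathin X p \<Longrightarrow> pathin X (path_reverse p)"
  using pathin_reparametrize[of X p "\<lambda>t. 1 - t", OF _ continuous_on_diff] by (auto simp: o_def)

lemma path_homotopic_assoc:
  assumes "pathin X p" "pathin X q" "pathin X r" "p 1 = q 0" "q 1 = r 0"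
  shows "path_homotopic X (path_join (path_join p q) r) (path_join p (path_join q r))"
proof -
  let ?f = "path_join p (path_join q r)"
  \<comment> \<open>The speed change has slopes \<open>2\<close>, \<open>1\<close>, \<open>1/2\<close>: a concave piecewise linear map is a minimum of affine maps.\<close>
  let ?u = "\<lambda>t::real. min (2 * t) (min (t + 1/4) ((t + 1) / 2))"
  have "path_join (path_join p q) r = ?f \<circ> ?u"
  proof
    fix t :: real
    consider "t \<le> 1/4" | "1/4 < t" "t \<le> 1/2" | "1/2 < t" by linarith
    then show "path_join (path_join p q) r t = (?f \<circ> ?u) t"
    proof cases
      case 1
      then have "?u t = 2 * t" by (simp add: min_def)
      then show ?thesis using 1 by (simp add: path_join_def)
    next
      case 2
      then have "?u t = t + 1/4" by (simp add: min_def)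
      then show ?thesis using 2 by (simp add: path_join_def algebra_simps)
    next
      case 3
      then have "?u t = (t + 1) / 2" by (simp add: min_def)
      then show ?thesis
        using 3 by (auto simp: path_join_def field_simps intro!: arg_cong[where f = r])
    qed
  qed
  moreover have "path_homotopic X (?f \<circ> ?u) (?f \<circ> (\<lambda>t. t))"
    by (rule path_homotopic_reparametrize)
      (use assms in \<open>auto simp: min_le_iff_disj intro!: pathin_join continuous_intros\<close>)
  ultimately show ?thesis by (simp add: o_def)
qed

lemma path_homotopic_reverse:
  assumes "pathin X p"
  shows "path_homotopic X (path_join p (path_reverse p)) (\<lambda>t. p 0)"
    and "path_homotopic X (path_join (path_reverse p) p) (\<lambda>t. p 1)"
proof -
  have *: "path_homotopic X (path_join p (path_reverse p)) (\<lambda>t. p 0)" if "pathin X p" for p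
  proof -
    have "path_join p (path_reverse p) = p \<circ> (\<lambda>t. min (2 * t) (2 - 2 * t))"
      by (auto simp: path_join_def min_def)
    moreover have "path_homotopic X (p \<circ> (\<lambda>t. min (2 * t) (2 - 2 * t))) (p \<circ> (\<lambda>t. 0))"
      by (rule path_homotopic_reparametrize) (use that in \<open>auto intro!: continuous_intros\<close>)
    ultimately show ?thesis by (simp add: o_def)
  qed
  then show "path_homotopic X (path_join p (path_reverse p)) (\<lambda>t. p 0)" using assms .
  show "path_homotopic X (path_join (path_reverse p) p) (\<lambda>t. p 1)"
    using *[OF pathin_reverse[OF assms]] by simp
qed

lemma path_homotopic_const_join:
  assumes "pathin X p" "p 0 = x"
  shows "path_homotopic X (path_join (\<lambda>t. x) p) p"
proof -
  have "path_join (\<lambda>t. x) p = p \<circ> (\<lambda>t. max 0 (2 * t - 1))"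
  proof
    fix t :: real
    show "path_join (\<lambda>t. x) p t = (p \<circ> (\<lambda>t. max 0 (2 * t - 1))) t"
      using assms by (cases "t \<le> 1/2") (simp_all add: path_join_def)
  qed
  moreover have "path_homotopic X (p \<circ> (\<lambda>t. max 0 (2 * t - 1))) (p \<circ> (\<lambda>t. t))"
    by (rule path_homotopic_reparametrize) (use assms in \<open>auto intro!: continuous_intros\<close>)
  ultimately show ?thesis by (simp add: o_def)
qed

lemma path_homotopic_join_const:
  assumes "pathin X p" "p 1 = x"
  shows "path_homotopic X (path_join p (\<lambda>t. x)) p"
proof -
  have "path_join p (\<lambda>t. x) = p \<circ> (\<lambda>t. min (2 * t) 1)"
    using assms by (auto simp: path_join_def min_def)
  moreover have "path_homotopic X (p \<circ> (\<lambda>t. min (2 * t) 1)) (p \<circ> (\<lambda>t. t))"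
    by (rule path_homotopic_reparametrize) (use assms in \<open>auto intro!: continuous_intros\<close>)
  ultimately show ?thesis by (simp add: o_def)
qed

text \<open>A property of paths may be checked on short paths: \<open>[0, 1]\<close> is subdivided until
  every piece of the path lies in one of the given open sets.\<close>

lemma path_local_induct [consumes 1, case_names join homotopic locally]:
  assumes p: "pathin X p"
    and join: "\<And>p q. \<lbrakk>pathin X p; pathin X q; p 1 = q 0; Q p; Q q\<rbrakk> \<Longrightarrow> Q (path_join p q)"
    and homotopic: "\<And>p q. \<lbrakk>path_homotopic X p q; Q p\<rbrakk> \<Longrightarrow> Q q"
    and locally: "\<And>x. x \<in> topspace X \<Longrightarrow>
      \<exists>U. openin X U \<and> x \<in> U \<and> (\<forall>p. pathin (subtopology X U) p \<longrightarrow> Q p)"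
  shows "Q p"
proof -
  define sub where "sub u v = p \<circ> (\<lambda>t. u + (v - u) * t)" for u v :: real
  have range: "u + (v - u) * t \<in> {u..v}" if "u \<le> v" "t \<in> {0..1}" for u v t :: real
    using that mult_left_le[of t "v - u"] by auto
  have psub: "pathin X (sub u v)" if "0 \<le> u" "u \<le> v" "v \<le> 1" for u v
    unfolding sub_def
    by (rule pathin_reparametrize[OF p]) (use that range[of u v] in \<open>fastforce intro!: continuous_intros\<close>)+
  have "0 \<le> (0::real) \<longrightarrow> (0::real) \<le> 1 \<longrightarrow> (1::real) \<le> 1 \<longrightarrow> Q (sub 0 1)"
  proof (rule Bolzano[of 0 1 "\<lambda>u v. 0 \<le> u \<longrightarrow> u \<le> v \<longrightarrow> v \<le> 1 \<longrightarrow> Q (sub u v)"])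
    show "(0::real) \<le> 1" by simp
    fix u v w :: real
    assume Q: "0 \<le> u \<longrightarrow> u \<le> v \<longrightarrow> v \<le> 1 \<longrightarrow> Q (sub u v)" "0 \<le> v \<longrightarrow> v \<le> w \<longrightarrow> w \<le> 1 \<longrightarrow> Q (sub v w)"
      and uvw: "u \<le> v" "v \<le> w"
    show "0 \<le> u \<longrightarrow> u \<le> w \<longrightarrow> w \<le> 1 \<longrightarrow> Q (sub u w)"
    proof (intro impI)
      assume b: "0 \<le> u" "w \<le> 1"
      \<comment> \<open>The join of two adjacent pieces runs through both of them, at two constant speeds.\<close>
      let ?m = "\<lambda>t. u + (v - u) * min (2 * t) 1 + (w - v) * max 0 (2 * t - 1)"
      have eq: "path_join (sub u v) (sub v w) = p \<circ> ?m"
      proof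
        fix t :: real
        show "path_join (sub u v) (sub v w) t = (p \<circ> ?m) t"
          by (cases "t \<le> 1/2") (simp_all add: path_join_def sub_def)
      qed
      have m: "?m t \<in> {0..1}" if "t \<in> {0..1}" for t
      proof (cases "t \<le> 1/2")
        case True
        then have "?m t = u + (v - u) * (2 * t)" by simp
        then show ?thesis using range[of u v "2 * t"] uvw b that True by auto
      next
        case False
        then have "?m t = v + (w - v) * (2 * t - 1)" by simp
        then show ?thesis using range[of v w "2 * t - 1"] uvw b that False by auto
      qed
      have hom: "path_homotopic X (p \<circ> ?m) (sub u w)"
        unfolding sub_def
      proof (rule path_homotopic_reparametrize[OF p])
        show "?m \<in> {0..1} \<rightarrow> {0..1}" using m by blast
        show "(\<lambda>t. u + (w - u) * t) \<in> {0..1} \<rightarrow> {0..1}" using range[of u w] uvw b by fastforce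
      qed (auto intro!: continuous_intros)
      have "Q (path_join (sub u v) (sub v w))"
        by (rule join) (use psub Q uvw b in \<open>auto simp: sub_def\<close>)
      then show "Q (sub u w)" using homotopic[OF hom] eq by simp
    qed
  next
    fix x :: real assume x: "0 \<le> x" "x \<le> 1"
    then have "p x \<in> topspace X" using path_image_subset_topspace[OF p] by auto
    then obtain U where U: "openin X U" "p x \<in> U" "\<And>q. pathin (subtopology X U) q \<Longrightarrow> Q q"
      using locally by blast
    have "openin (top_of_set {0..1}) {t \<in> {0..1}. p t \<in> U}"
      using openin_continuous_map_preimage[OF p[unfolded pathin_def] U(1)] by simp
    then obtain d where d: "d > 0" "\<And>t. t \<in> {0..1} \<Longrightarrow> dist t x < d \<Longrightarrow> p t \<in> U"
      using x U(2) unfolding openin_euclidean_subtopology_iff by (auto 0 3)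
    show "\<exists>d>0. \<forall>u v. u \<le> x \<and> x \<le> v \<and> v - u < d \<longrightarrow> 0 \<le> u \<longrightarrow> u \<le> v \<longrightarrow> v \<le> 1 \<longrightarrow> Q (sub u v)"
    proof (intro exI[of _ d] conjI allI impI d(1) U(3))
      fix u v assume uv: "u \<le> x \<and> x \<le> v \<and> v - u < d" "0 \<le> u" "u \<le> v" "v \<le> 1"
      have "sub u v t \<in> U" if "t \<in> {0..1}" for t
        using d(2)[of "u + (v - u) * t"] range[OF uv(3) that] uv by (auto simp: sub_def dist_real_def)
      then show "pathin (subtopology X U) (sub u v)"
        using psub uv by (simp add: pathin_subtopology)
    qed
  qed
  then show ?thesis by (simp add: sub_def o_def)
qed


section \<open>Representations of the fundamental groupoid\<close>

text \<open>
  A functor from the fundamental groupoid to \<open>G\<close>, as a function of paths instead of homotopy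
  classes. Values on functions that are not paths are arbitrary.
\<close>

definition groupoid_rep ::
  "'x topology \<Rightarrow> ('g, 'm) monoid_scheme \<Rightarrow> ((real \<Rightarrow> 'x) \<Rightarrow> 'g) \<Rightarrow> bool" where
  "groupoid_rep X G \<tau> \<longleftrightarrow>
     (\<forall>p. pathin X p \<longrightarrow> \<tau> p \<in> carrier G) \<and>
     (\<forall>p q. pathin X p \<and> pathin X q \<and> p 1 = q 0 \<longrightarrow> \<tau> (path_join p q) = \<tau> p \<otimes>\<^bsub>G\<^esub> \<tau> q) \<and>
     (\<forall>p q. path_homotopic X p q \<longrightarrow> \<tau> p = \<tau> q)"

lemma groupoid_repD:
  assumes "groupoid_rep X G \<tau>"
  shows "pathin X p \<Longrightarrow> \<tau> p \<in> carrier G"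
    and "pathin X p \<Longrightarrow> pathin X q \<Longrightarrow> p 1 = q 0 \<Longrightarrow> \<tau> (path_join p q) = \<tau> p \<otimes>\<^bsub>G\<^esub> \<tau> q"
    and "path_homotopic X p q \<Longrightarrow> \<tau> p = \<tau> q"
  using assms unfolding groupoid_rep_def by blast+

context group
begin

lemma inv_cancel_left: "\<lbrakk>x \<in> carrier G; y \<in> carrier G\<rbrakk> \<Longrightarrow> inv x \<otimes> (x \<otimes> y) = y"
  by (simp flip: m_assoc)

lemma inv_cancel_left': "\<lbrakk>x \<in> carrier G; y \<in> carrier G\<rbrakk> \<Longrightarrow> x \<otimes> (inv x \<otimes> y) = y"
  by (simp flip: m_assoc)

lemma groupoid_rep_const:
  assumes "groupoid_rep X G \<tau>" "x \<in> topspace X"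
  shows "\<tau> (\<lambda>t. x) = \<one>"
proof -
  have "\<tau> (\<lambda>t. x) = \<tau> (\<lambda>t. x) \<otimes> \<tau> (\<lambda>t. x)"
    using groupoid_repD(2)[OF assms(1), of "\<lambda>t. x" "\<lambda>t. x"] assms(2) by (simp add: path_join_const)
  then show ?thesis
    using groupoid_repD(1)[OF assms(1), of "\<lambda>t. x"] assms(2) by simp
qed

lemma groupoid_rep_reverse:
  assumes "groupoid_rep X G \<tau>" "pathin X p"
  shows "\<tau> (path_reverse p) = inv (\<tau> p)"
proof -
  have "\<tau> (path_join (path_reverse p) p) = \<one>"
    using groupoid_repD(3)[OF assms(1) path_homotopic_reverse(2)[OF assms(2)]]
      groupoid_rep_const[OF assms(1)] path_finish_in_topspace[OF assms(2)] by simp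
  then have "\<tau> (path_reverse p) \<otimes> \<tau> p = \<one>"
    using groupoid_repD(2)[OF assms(1) pathin_reverse assms(2)] assms(2) by simp
  then show ?thesis
    using inv_equality groupoid_repD(1)[OF assms(1)] assms(2) pathin_reverse[OF assms(2)] by simp
qed

lemma groupoid_rep_trivial: "groupoid_rep X G (\<lambda>p. \<one>)"
  by (simp add: groupoid_rep_def)

lemma groupoid_rep_gauge:
  assumes "groupoid_rep X G \<tau>" and k: "\<And>x. x \<in> topspace X \<Longrightarrow> k x \<in> carrier G"
  shows "groupoid_rep X G (\<lambda>p. k (p 0) \<otimes> \<tau> p \<otimes> inv (k (p 1)))"
  unfolding groupoid_rep_def
proof (intro conjI allI impI)
  note D = groupoid_repD[OF assms(1)]
  note ends = path_start_in_topspace path_finish_in_topspace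
  show "k (p 0) \<otimes> \<tau> p \<otimes> inv (k (p 1)) \<in> carrier G" if "pathin X p" for p
    using D(1)[OF that] k ends[OF that] by simp
  show "k (path_join p q 0) \<otimes> \<tau> (path_join p q) \<otimes> inv (k (path_join p q 1)) =
      k (p 0) \<otimes> \<tau> p \<otimes> inv (k (p 1)) \<otimes> (k (q 0) \<otimes> \<tau> q \<otimes> inv (k (q 1)))"
    if "pathin X p \<and> pathin X q \<and> p 1 = q 0" for p q
  proof -
    have "inv (k (q 0)) \<otimes> (k (q 0) \<otimes> (\<tau> q \<otimes> inv (k (q 1)))) = \<tau> q \<otimes> inv (k (q 1))"
      using that D(1)[of q] k[OF ends(1), of q] k[OF ends(2), of q] by (simp flip: m_assoc)
    then show ?thesis
      using that D(1)[of p] D(1)[of q] D(2)[of p q] k[OF ends(1), of p] k[OF ends(2), of p]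
        k[OF ends(1), of q] k[OF ends(2), of q] by (simp add: m_assoc)
  qed
  show "k (p 0) \<otimes> \<tau> p \<otimes> inv (k (p 1)) = k (q 0) \<otimes> \<tau> q \<otimes> inv (k (q 1))"
    if "path_homotopic X p q" for p q
    using D(3)[OF that] path_homotopic_imp[OF that] by simp
qed

end


section \<open>Flat functions and parallel transport\<close>

text \<open>
  The coordinate functions of the local sections of a \<open>G\<close>-torsor in a frame that picks one germ at
  every point, with no continuity required, have the following properties.
\<close>

locale flat_family = group G for G :: "('g, 'm) monoid_scheme" (structure) +
  fixes X :: "'x topology" and flat :: "'x set \<Rightarrow> ('x \<Rightarrow> 'g) \<Rightarrow> bool"
  assumes flat_open: "flat U f \<Longrightarrow> openin X U"
    and flat_closed: "flat U f \<Longrightarrow> x \<in> U \<Longrightarrow> f x \<in> carrier G"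
    and flat_ex: "x \<in> topspace X \<Longrightarrow> \<exists>U f. flat U f \<and> x \<in> U"
    and flat_mult: "flat U f \<Longrightarrow> g \<in> carrier G \<Longrightarrow> flat U (\<lambda>x. f x \<otimes> g)"
    and flat_quotient: "flat U f \<Longrightarrow> flat V f' \<Longrightarrow> x \<in> U \<Longrightarrow> x \<in> V \<Longrightarrow>
      \<exists>W g. openin X W \<and> x \<in> W \<and> W \<subseteq> U \<inter> V \<and> g \<in> carrier G \<and> (\<forall>y\<in>W. f' y = f y \<otimes> g)"
begin

text \<open>
  If \<open>e x\<close> is the chosen germ at \<open>x\<close>, a flat function \<open>f\<close> stands for the section with germs
  \<open>e x \<cdot> f x\<close>, so moving along \<open>p\<close> takes \<open>e (p 0)\<close> to \<open>e (p 1) \<cdot> (f (p 1) \<otimes> inv (f (p 0)))\<close>.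
  Moving commutes with the right action, which reverses the order of products; the inverse
  \<open>f (p 0) \<otimes> inv (f (p 1))\<close> is multiplicative in the order of concatenation.
\<close>

definition transport :: "((real \<Rightarrow> 'x) \<Rightarrow> 'g) \<Rightarrow> bool" where
  "transport \<tau> \<longleftrightarrow> groupoid_rep X G \<tau> \<and>
     (\<forall>U f p. flat U f \<longrightarrow> pathin (subtopology X U) p \<longrightarrow> \<tau> p = f (p 0) \<otimes> inv (f (p 1)))"

text \<open>A lift is a section over \<open>A\<close> of the pullback of the torsor along \<open>h\<close>, seen in coordinates.\<close>

definition lift :: "('z::topological_space \<Rightarrow> 'x) \<Rightarrow> 'z set \<Rightarrow> ('z \<Rightarrow> 'g) \<Rightarrow> bool" where
  "lift h A c \<longleftrightarrow>
     (\<forall>z\<in>A. \<exists>U f N. flat U f \<and> open N \<and> z \<in> N \<and> (\<forall>w\<in>N \<inter> A. h w \<in> U \<and> c w = f (h w)))"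

lemma liftE:
  assumes "lift h A c" "z \<in> A"
  obtains U f N where "flat U f" "open N" "z \<in> N" "\<And>w. w \<in> N \<Longrightarrow> w \<in> A \<Longrightarrow> h w \<in> U"
    "\<And>w. w \<in> N \<Longrightarrow> w \<in> A \<Longrightarrow> c w = f (h w)"
proof -
  from bspec[OF assms(1)[unfolded lift_def] assms(2)] obtain U f N where
    "flat U f" "open N" "z \<in> N" "\<forall>w\<in>N \<inter> A. h w \<in> U \<and> c w = f (h w)" by blast
  then show thesis by (intro that[of U f N]) auto
qed

lemma lift_closed: "lift h A c \<Longrightarrow> z \<in> A \<Longrightarrow> c z \<in> carrier G"
  unfolding lift_def using flat_closed by (metis IntI)

lemma lift_subset:
  assumes c: "lift h A c" and "B \<subseteq> A"
  shows "lift h B c"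
  unfolding lift_def
proof
  fix z assume "z \<in> B"
  then have "z \<in> A" using assms(2) by blast
  with c obtain U f N where "flat U f" "open N" "z \<in> N" "\<forall>w\<in>N \<inter> A. h w \<in> U \<and> c w = f (h w)"
    unfolding lift_def by blast
  then show "\<exists>U f N. flat U f \<and> open N \<and> z \<in> N \<and> (\<forall>w\<in>N \<inter> B. h w \<in> U \<and> c w = f (h w))"
    using assms(2) by (intro exI[of _ U] exI[of _ f] exI[of _ N]) auto
qed

lemma lift_cong:
  assumes "lift h A c" "\<And>z. z \<in> A \<Longrightarrow> h' z = h z" "\<And>z. z \<in> A \<Longrightarrow> c' z = c z"
  shows "lift h' A c'"
  unfolding lift_def
proof
  fix z assume z: "z \<in> A"
  obtain U f N where "flat U f" "open N" "z \<in> N"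
    "\<And>w. w \<in> N \<Longrightarrow> w \<in> A \<Longrightarrow> h w \<in> U" "\<And>w. w \<in> N \<Longrightarrow> w \<in> A \<Longrightarrow> c w = f (h w)"
    by (rule liftE[OF assms(1) z]) blast
  then show "\<exists>U f N. flat U f \<and> open N \<and> z \<in> N \<and> (\<forall>w\<in>N \<inter> A. h' w \<in> U \<and> c' w = f (h' w))"
    using assms(2,3) by (intro exI[of _ U] exI[of _ f] exI[of _ N]) auto
qed

lemma lift_mult:
  assumes "lift h A c" "g \<in> carrier G"
  shows "lift h A (\<lambda>z. c z \<otimes> g)"
  unfolding lift_def
proof
  fix z assume z: "z \<in> A"
  obtain U f N where "flat U f" "open N" "z \<in> N"
    "\<And>w. w \<in> N \<Longrightarrow> w \<in> A \<Longrightarrow> h w \<in> U" "\<And>w. w \<in> N \<Longrightarrow> w \<in> A \<Longrightarrow> c w = f (h w)"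
    by (rule liftE[OF assms(1) z]) blast
  then show "\<exists>U f N. flat U f \<and> open N \<and> z \<in> N \<and> (\<forall>w\<in>N \<inter> A. h w \<in> U \<and> c w \<otimes> g = f (h w))"
    using flat_mult[OF _ assms(2)]
    by (intro exI[of _ U] exI[of _ "\<lambda>x. f x \<otimes> g"] exI[of _ N]) auto
qed

lemma lift_compose:
  assumes "lift h A c" "continuous_on B u" "u \<in> B \<rightarrow> A"
  shows "lift (h \<circ> u) B (c \<circ> u)"
  unfolding lift_def
proof
  fix z assume z: "z \<in> B"
  then have "u z \<in> A" using assms(3) by blast
  from assms(1) this obtain U f N where N: "flat U f" "open N" "u z \<in> N"
    "\<And>w. w \<in> N \<Longrightarrow> w \<in> A \<Longrightarrow> h w \<in> U" "\<And>w. w \<in> N \<Longrightarrow> w \<in> A \<Longrightarrow> c w = f (h w)"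
    by (rule liftE) blast
  obtain M where "open M" "M \<inter> B = u -` N \<inter> B"
    using assms(2) N(2) unfolding continuous_on_open_invariant by blast
  then show "\<exists>U f N. flat U f \<and> open N \<and> z \<in> N \<and>
      (\<forall>w\<in>N \<inter> B. (h \<circ> u) w \<in> U \<and> (c \<circ> u) w = f ((h \<circ> u) w))"
    using N z assms(3) by (intro exI[of _ U] exI[of _ f] exI[of _ M]) auto
qed

lemma lift_flat:
  assumes "flat U f" "h \<in> A \<rightarrow> U"
  shows "lift h A (f \<circ> h)"
  unfolding lift_def using assms by (intro ballI exI[of _ U] exI[of _ f] exI[of _ UNIV]) auto

lemma open_preimage:
  assumes "continuous_map (top_of_set A) X h" "openin X W" "z \<in> A" "h z \<in> W"
  obtains N where "open N" "z \<in> N" "\<And>w. w \<in> N \<Longrightarrow> w \<in> A \<Longrightarrow> h w \<in> W"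
proof -
  have "openin (top_of_set A) {w \<in> A. h w \<in> W}"
    using openin_continuous_map_preimage[OF assms(1,2)] by simp
  then obtain N where "open N" "{w \<in> A. h w \<in> W} = A \<inter> N" unfolding openin_open by blast
  then show thesis using assms(3,4) by (intro that[of N]) auto
qed

text \<open>Sections of a torsor differ by a locally constant function, hence by a constant on a
  connected set.\<close>

lemma lift_unique:
  assumes h: "continuous_map (top_of_set A) X h" and A: "connected A"
    and c: "lift h A c" and c': "lift h A c'"
  shows "\<exists>g\<in>carrier G. \<forall>z\<in>A. c' z = c z \<otimes> g"
proof (cases "A = {}")
  case False
  then obtain a where a: "a \<in> A" by blast
  have loc: "\<forall>z\<in>A. eventually (\<lambda>w. inv (c z) \<otimes> c' z = inv (c w) \<otimes> c' w) (at z within A)"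
  proof
    fix z assume z: "z \<in> A"
    obtain U f N where N: "flat U f" "open N" "z \<in> N"
      "\<And>w. w \<in> N \<Longrightarrow> w \<in> A \<Longrightarrow> h w \<in> U" "\<And>w. w \<in> N \<Longrightarrow> w \<in> A \<Longrightarrow> c w = f (h w)"
      by (rule liftE[OF c z]) blast
    obtain U' f' N' where N': "flat U' f'" "open N'" "z \<in> N'"
      "\<And>w. w \<in> N' \<Longrightarrow> w \<in> A \<Longrightarrow> h w \<in> U'" "\<And>w. w \<in> N' \<Longrightarrow> w \<in> A \<Longrightarrow> c' w = f' (h w)"
      by (rule liftE[OF c' z]) blast
    obtain W g where W: "openin X W" "h z \<in> W" "W \<subseteq> U \<inter> U'" "g \<in> carrier G"
      "\<And>y. y \<in> W \<Longrightarrow> f' y = f y \<otimes> g"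
      using flat_quotient[OF N(1) N'(1), of "h z"] N(3,4) N'(3,4) z by blast
    obtain M where M: "open M" "z \<in> M" "\<And>w. w \<in> M \<Longrightarrow> w \<in> A \<Longrightarrow> h w \<in> W"
      using open_preimage[OF h W(1) z W(2)] by blast
    have "inv (c w) \<otimes> c' w = g" if "w \<in> N \<inter> N' \<inter> M" "w \<in> A" for w
    proof -
      have "c' w = c w \<otimes> g" using that N(5) N'(5) M(3) W(5) by auto
      then show ?thesis using lift_closed[OF c that(2)] W(4) by (simp flip: m_assoc)
    qed
    then show "eventually (\<lambda>w. inv (c z) \<otimes> c' z = inv (c w) \<otimes> c' w) (at z within A)"
      unfolding eventually_at_topological
      using N(2,3) N'(2,3) M(1,2) z by (intro exI[of _ "N \<inter> N' \<inter> M"]) auto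
  qed
  have "c' z = c z \<otimes> (inv (c a) \<otimes> c' a)" if "z \<in> A" for z
  proof -
    have "inv (c a) \<otimes> c' a = inv (c z) \<otimes> c' z"
      by (rule connected_local_const[OF A a that loc])
    then show ?thesis
      using lift_closed[OF c that] lift_closed[OF c' that] by (simp flip: m_assoc)
  qed
  then show ?thesis using lift_closed[OF c a] lift_closed[OF c' a] by blast
qed (use one_closed in blast)

text \<open>Multiplying one of the two sections by a constant makes them agree at the connected overlap;
  they then fit together, since near a common point both come from the same flat function.\<close>

lemma lift_paste:
  assumes h: "continuous_map (top_of_set (A \<union> B)) X h"
    and AB: "closed A" "closed B" "connected (A \<inter> B)" "A \<inter> B \<noteq> {}"
    and c: "lift h A c" and c': "lift h B c'"
  shows "\<exists>d. lift h (A \<union> B) d"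
proof -
  have "continuous_map (top_of_set (A \<inter> B)) X h"
    using h by (rule continuous_map_from_subtopology_mono) auto
  then obtain g where g: "g \<in> carrier G" "\<And>z. z \<in> A \<inter> B \<Longrightarrow> c z = c' z \<otimes> g"
    using lift_unique[OF _ AB(3) lift_subset[OF c'] lift_subset[OF c]] by blast
  define b where "b z = c' z \<otimes> g" for z
  have b: "lift h B b" unfolding b_def by (rule lift_mult[OF c' g(1)])
  have agree: "c z = b z" if "z \<in> A" "z \<in> B" for z using g(2) that by (simp add: b_def)
  define d where "d z = (if z \<in> A then c z else b z)" for z
  have dA: "d z = c z" if "z \<in> A" for z using that by (simp add: d_def)
  have dB: "d z = b z" if "z \<in> B" for z using that agree by (auto simp: d_def)
  have "lift h (A \<union> B) d"
    unfolding lift_def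
  proof
    fix z assume z: "z \<in> A \<union> B"
    consider "z \<in> A" "z \<notin> B" | "z \<in> B" "z \<notin> A" | "z \<in> A" "z \<in> B" using z by blast
    then show "\<exists>U f N. flat U f \<and> open N \<and> z \<in> N \<and> (\<forall>w\<in>N \<inter> (A \<union> B). h w \<in> U \<and> d w = f (h w))"
    proof cases
      case 1
      obtain U f N where "flat U f" "open N" "z \<in> N"
        "\<And>w. w \<in> N \<Longrightarrow> w \<in> A \<Longrightarrow> h w \<in> U" "\<And>w. w \<in> N \<Longrightarrow> w \<in> A \<Longrightarrow> c w = f (h w)"
        by (rule liftE[OF c 1(1)]) blast
      then show ?thesis
        using 1 AB(2) dA by (intro exI[of _ U] exI[of _ f] exI[of _ "N \<inter> - B"]) auto
    next
      case 2
      obtain U f N where "flat U f" "open N" "z \<in> N"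
        "\<And>w. w \<in> N \<Longrightarrow> w \<in> B \<Longrightarrow> h w \<in> U" "\<And>w. w \<in> N \<Longrightarrow> w \<in> B \<Longrightarrow> b w = f (h w)"
        by (rule liftE[OF b 2(1)]) blast
      then show ?thesis
        using 2 AB(1) dB by (intro exI[of _ U] exI[of _ f] exI[of _ "N \<inter> - A"]) auto
    next
      case 3
      obtain U f N where N: "flat U f" "open N" "z \<in> N"
        "\<And>w. w \<in> N \<Longrightarrow> w \<in> A \<Longrightarrow> h w \<in> U" "\<And>w. w \<in> N \<Longrightarrow> w \<in> A \<Longrightarrow> c w = f (h w)"
        by (rule liftE[OF c 3(1)]) blast
      obtain U' f' N' where N': "flat U' f'" "open N'" "z \<in> N'"
        "\<And>w. w \<in> N' \<Longrightarrow> w \<in> B \<Longrightarrow> h w \<in> U'" "\<And>w. w \<in> N' \<Longrightarrow> w \<in> B \<Longrightarrow> b w = f' (h w)"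
        by (rule liftE[OF b 3(2)]) blast
      obtain W k where W: "openin X W" "h z \<in> W" "W \<subseteq> U \<inter> U'" "k \<in> carrier G"
        "\<And>y. y \<in> W \<Longrightarrow> f' y = f y \<otimes> k"
        using flat_quotient[OF N(1) N'(1), of "h z"] N(3,4) N'(3,4) 3 by blast
      \<comment> \<open>The transition constant \<open>k\<close> is seen at \<open>z\<close> itself to be trivial.\<close>
      have "f (h z) = f (h z) \<otimes> k"
        using agree[OF 3] N(3,5) N'(3,5) W(2,5) 3 by metis
      then have "k = \<one>" using flat_closed[OF N(1)] W(2-4) by auto
      then have ff: "f' y = f y" if "y \<in> W" for y
        using W(3,5) that flat_closed[OF N(1)] by auto
      obtain M where M: "open M" "z \<in> M" "\<And>w. w \<in> M \<Longrightarrow> w \<in> A \<union> B \<Longrightarrow> h w \<in> W"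
        using open_preimage[OF h W(1) z W(2)] by blast
      have "h w \<in> U \<and> d w = f (h w)" if w: "w \<in> (N \<inter> N' \<inter> M) \<inter> (A \<union> B)" for w
      proof
        show "h w \<in> U" using w M(3) W(3) by blast
        show "d w = f (h w)"
        proof (cases "w \<in> A")
          case True
          then show ?thesis using N(5) w dA by auto
        next
          case False
          then have "w \<in> B" using w by blast
          then show ?thesis using N'(5)[of w] w dB ff M(3) by auto
        qed
      qed
      then show ?thesis
        using N(1-3) N'(2,3) M(1,2)
        by (intro exI[of _ U] exI[of _ f] exI[of _ "N \<inter> N' \<inter> M"]) auto
    qed
  qed
  then show ?thesis by (intro exI[of _ d])
qed

text \<open>The pullback of the torsor to a square is trivial: sections over small rectangles are pasted
  along edges, first into strips and then into the square.\<close>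

lemma lift_square:
  fixes h :: "real \<times> real \<Rightarrow> 'x"
  assumes h: "continuous_map (top_of_set ({0..1} \<times> {0..1})) X h"
  shows "\<exists>c. lift h ({0..1} \<times> {0..1}) c"
proof -
  have sub: "continuous_map (top_of_set A) X h" if "A \<subseteq> {0..1} \<times> {0..1}" for A
    using h that by (rule continuous_map_from_subtopology_mono)
  have small: "\<exists>e>0. \<exists>c. lift h (({s - e..s + e} \<times> {t - e..t + e}) \<inter> {0..1} \<times> {0..1}) c"
    if st: "s \<in> {0..1}" "t \<in> {0..1}" for s t
  proof -
    have "h (s, t) \<in> topspace X" using h st by (auto simp: continuous_map_def Pi_iff)
    then obtain U f where U: "flat U f" "h (s, t) \<in> U" using flat_ex by blast
    obtain N where N: "open N" "(s, t) \<in> N" "\<And>w. w \<in> N \<Longrightarrow> w \<in> {0..1} \<times> {0..1} \<Longrightarrow> h w \<in> U"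
      using open_preimage[OF h flat_open[OF U(1)] _ U(2)] st by blast
    obtain A B where AB: "open A" "open B" "(s, t) \<in> A \<times> B" "A \<times> B \<subseteq> N"
      by (rule open_prod_elim[OF N(1,2)])
    obtain e1 where e1: "e1 > 0" "cball s e1 \<subseteq> A"
      using AB(1,3) unfolding open_contains_cball by blast
    obtain e2 where e2: "e2 > 0" "cball t e2 \<subseteq> B"
      using AB(2,3) unfolding open_contains_cball by blast
    let ?e = "min e1 e2"
    have "{s - ?e..s + ?e} \<subseteq> A" "{t - ?e..t + ?e} \<subseteq> B"
      using e1(2) e2(2) unfolding cball_eq_atLeastAtMost by force+
    then have "lift h (({s - ?e..s + ?e} \<times> {t - ?e..t + ?e}) \<inter> {0..1} \<times> {0..1}) (f \<circ> h)"
      using AB(4) by (intro lift_flat[OF U(1)] Pi_I N(3)) auto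
    moreover have "?e > 0" using e1(1) e2(1) by simp
    ultimately show ?thesis by blast
  qed
  have strip: "\<exists>e>0. \<exists>c. lift h (({s - e..s + e} \<inter> {0..1}) \<times> {0..1}) c" if s: "s \<in> {0..1}" for s
  proof -
    let ?S = "\<lambda>e. {s - e..s + e} \<inter> {0..1}"
    have "0 \<le> (0::real) \<longrightarrow> (0::real) \<le> 1 \<longrightarrow> 1 \<le> (1::real) \<longrightarrow> (\<exists>e>0. \<exists>c. lift h (?S e \<times> {0..1}) c)"
    proof (rule Bolzano[of 0 1
          "\<lambda>u v. 0 \<le> u \<longrightarrow> u \<le> v \<longrightarrow> v \<le> 1 \<longrightarrow> (\<exists>e>0. \<exists>c. lift h (?S e \<times> {u..v}) c)"])
      show "(0::real) \<le> 1" by simp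
      fix u v w :: real
      assume P: "0 \<le> u \<longrightarrow> u \<le> v \<longrightarrow> v \<le> 1 \<longrightarrow> (\<exists>e>0. \<exists>c. lift h (?S e \<times> {u..v}) c)"
        "0 \<le> v \<longrightarrow> v \<le> w \<longrightarrow> w \<le> 1 \<longrightarrow> (\<exists>e>0. \<exists>c. lift h (?S e \<times> {v..w}) c)"
        and uvw: "u \<le> v" "v \<le> w"
      show "0 \<le> u \<longrightarrow> u \<le> w \<longrightarrow> w \<le> 1 \<longrightarrow> (\<exists>e>0. \<exists>c. lift h (?S e \<times> {u..w}) c)"
      proof (intro impI)
        assume b: "0 \<le> u" "w \<le> 1"
        obtain e1 c1 where 1: "e1 > 0" "lift h (?S e1 \<times> {u..v}) c1" using P(1) uvw b by auto
        obtain e2 c2 where 2: "e2 > 0" "lift h (?S e2 \<times> {v..w}) c2" using P(2) uvw b by auto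
        define e where "e = min e1 e2"
        have e: "e > 0" using 1 2 by (simp add: e_def)
        have un: "?S e \<times> {u..v} \<union> ?S e \<times> {v..w} = ?S e \<times> {u..w}"
          and int: "?S e \<times> {u..v} \<inter> ?S e \<times> {v..w} = ?S e \<times> {v}" using uvw by auto
        have "?S e = {max (s - e) 0..min (s + e) 1}" by auto
        then have conn: "connected (?S e \<times> {v})" by (simp only: connected_Times) simp
        have "\<exists>d. lift h (?S e \<times> {u..v} \<union> ?S e \<times> {v..w}) d"
        proof (rule lift_paste)
          show "continuous_map (top_of_set (?S e \<times> {u..v} \<union> ?S e \<times> {v..w})) X h"
            by (rule sub) (use uvw b in auto)
          show "lift h (?S e \<times> {u..v}) c1" by (rule lift_subset[OF 1(2)]) (auto simp: e_def)
          show "lift h (?S e \<times> {v..w}) c2" by (rule lift_subset[OF 2(2)]) (auto simp: e_def)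
          show "?S e \<times> {u..v} \<inter> ?S e \<times> {v..w} \<noteq> {}" unfolding int using s e by auto
        next
          show "connected (?S e \<times> {u..v} \<inter> ?S e \<times> {v..w})" unfolding int by (rule conn)
        qed (auto intro!: closed_Times closed_Int)
        then show "\<exists>e>0. \<exists>c. lift h (?S e \<times> {u..w}) c" unfolding un using e by blast
      qed
    next
      fix t :: real assume t: "0 \<le> t" "t \<le> 1"
      then obtain e c where e: "e > 0"
        "lift h (({s - e..s + e} \<times> {t - e..t + e}) \<inter> {0..1} \<times> {0..1}) c"
        using small[OF s, of t] by auto
      show "\<exists>d>0. \<forall>u v. u \<le> t \<and> t \<le> v \<and> v - u < d \<longrightarrow> 0 \<le> u \<longrightarrow> u \<le> v \<longrightarrow> v \<le> 1 \<longrightarrow>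
              (\<exists>e>0. \<exists>c. lift h (?S e \<times> {u..v}) c)"
      proof (intro exI[of _ e] conjI allI impI e(1))
        fix u v assume uv: "u \<le> t \<and> t \<le> v \<and> v - u < e" "0 \<le> u" "u \<le> v" "v \<le> 1"
        have "lift h (?S e \<times> {u..v}) c" by (rule lift_subset[OF e(2)]) (use uv in auto)
        then show "\<exists>c. lift h (?S e \<times> {u..v}) c" by blast
      qed
    qed
    then show ?thesis by simp
  qed
  have "0 \<le> (0::real) \<longrightarrow> (0::real) \<le> 1 \<longrightarrow> 1 \<le> (1::real) \<longrightarrow> (\<exists>c. lift h ({0..1} \<times> {0..1}) c)"
  proof (rule Bolzano[of 0 1 "\<lambda>u v. 0 \<le> u \<longrightarrow> u \<le> v \<longrightarrow> v \<le> 1 \<longrightarrow> (\<exists>c. lift h ({u..v} \<times> {0..1}) c)"])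
    show "(0::real) \<le> 1" by simp
    fix u v w :: real
    assume P: "0 \<le> u \<longrightarrow> u \<le> v \<longrightarrow> v \<le> 1 \<longrightarrow> (\<exists>c. lift h ({u..v} \<times> {0..1}) c)"
      "0 \<le> v \<longrightarrow> v \<le> w \<longrightarrow> w \<le> 1 \<longrightarrow> (\<exists>c. lift h ({v..w} \<times> {0..1}) c)"
      and uvw: "u \<le> v" "v \<le> w"
    show "0 \<le> u \<longrightarrow> u \<le> w \<longrightarrow> w \<le> 1 \<longrightarrow> (\<exists>c. lift h ({u..w} \<times> {0..1}) c)"
    proof (intro impI)
      assume b: "0 \<le> u" "w \<le> 1"
      obtain c1 where 1: "lift h ({u..v} \<times> {0..1}) c1" using P(1) uvw b by auto
      obtain c2 where 2: "lift h ({v..w} \<times> {0..1}) c2" using P(2) uvw b by auto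
      have un: "{u..v} \<times> {0..1::real} \<union> {v..w} \<times> {0..1} = {u..w} \<times> {0..1}"
        and int: "{u..v} \<times> {0..1::real} \<inter> {v..w} \<times> {0..1} = {v} \<times> {0..1}" using uvw by auto
      have "\<exists>d. lift h ({u..v} \<times> {0..1} \<union> {v..w} \<times> {0..1}) d"
        by (rule lift_paste[OF sub _ _ _ _ 1 2])
          (use uvw b in \<open>auto simp: int connected_Times intro!: closed_Times\<close>)
      then show "\<exists>c. lift h ({u..w} \<times> {0..1}) c" unfolding un .
    qed
  next
    fix s :: real assume s: "0 \<le> s" "s \<le> 1"
    then obtain e c where e: "e > 0" "lift h (({s - e..s + e} \<inter> {0..1}) \<times> {0..1}) c"
      using strip[of s] by auto
    show "\<exists>d>0. \<forall>u v. u \<le> s \<and> s \<le> v \<and> v - u < d \<longrightarrow> 0 \<le> u \<longrightarrow> u \<le> v \<longrightarrow> v \<le> 1 \<longrightarrow>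
            (\<exists>c. lift h ({u..v} \<times> {0..1}) c)"
    proof (intro exI[of _ e] conjI allI impI e(1))
      fix u v assume uv: "u \<le> s \<and> s \<le> v \<and> v - u < e" "0 \<le> u" "u \<le> v" "v \<le> 1"
      have "lift h ({u..v} \<times> {0..1}) c" by (rule lift_subset[OF e(2)]) (use uv in auto)
      then show "\<exists>c. lift h ({u..v} \<times> {0..1}) c" by blast
    qed
  qed
  then show ?thesis by simp
qed

lemma lift_path:
  assumes "pathin X p"
  shows "\<exists>c. lift p {0..1} c"
proof -
  have snd: "continuous_map (top_of_set ({0..1::real} \<times> {0..1})) (top_of_set {0..1}) snd"
    unfolding continuous_map_in_subtopology by (auto simp: continuous_on_snd)
  obtain c where c: "lift (p \<circ> snd) ({0..1::real} \<times> {0..1}) c"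
    using lift_square[OF continuous_map_compose[OF snd assms[unfolded pathin_def]]] by (rule exE)
  have "lift ((p \<circ> snd) \<circ> Pair (0::real)) {0..1} (c \<circ> Pair 0)"
    by (rule lift_compose[OF c]) (simp_all add: continuous_on_Pair)
  moreover have "(p \<circ> snd) \<circ> Pair (0::real) = p" by (simp add: fun_eq_iff)
  ultimately have "lift p {0..1} (c \<circ> Pair 0)" by simp
  then show ?thesis by (intro exI[of _ "c \<circ> Pair 0"])
qed

definition holonomy :: "(real \<Rightarrow> 'x) \<Rightarrow> 'g" where
  "holonomy p = (let c = SOME c. lift p {0..1} c in c 0 \<otimes> inv (c 1))"

lemma holonomy_eq:
  assumes p: "pathin X p" and c: "lift p {0..1} c"
  shows "holonomy p = c 0 \<otimes> inv (c 1)"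
proof -
  define d where "d = (SOME c. lift p {0..1} c)"
  have d: "lift p {0..1} d" unfolding d_def by (rule someI[of _ c]) (rule c)
  obtain g where g: "g \<in> carrier G" "\<forall>z\<in>{0..1}. d z = c z \<otimes> g"
    using lift_unique[OF p[unfolded pathin_def] _ c d] by auto
  have "holonomy p = d 0 \<otimes> inv (d 1)" by (simp add: holonomy_def d_def Let_def)
  also have "\<dots> = (c 0 \<otimes> g) \<otimes> inv (c 1 \<otimes> g)" using g by simp
  also have "\<dots> = c 0 \<otimes> inv (c 1)"
    using g(1) lift_closed[OF c, of 0] lift_closed[OF c, of 1]
    by (simp add: inv_mult_group m_assoc inv_cancel_left')
  finally show ?thesis .
qed

text \<open>Concatenation is handled by restricting one lift to the two halves of the interval, homotopy
  invariance by a lift of the homotopy.\<close>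

lemma transport_holonomy: "transport holonomy"
  unfolding transport_def groupoid_rep_def
proof (intro conjI allI impI)
  fix p assume p: "pathin X p"
  then obtain c where c: "lift p {0..1} c" using lift_path by blast
  show "holonomy p \<in> carrier G"
    using holonomy_eq[OF p c] lift_closed[OF c, of 0] lift_closed[OF c, of 1] by simp
next
  fix p q assume pq: "pathin X p \<and> pathin X q \<and> p 1 = q 0"
  then have j: "pathin X (path_join p q)" by (simp add: pathin_join)
  then obtain c where c: "lift (path_join p q) {0..1} c" using lift_path by blast
  have "lift (path_join p q \<circ> (\<lambda>t. t / 2)) {0..1} (c \<circ> (\<lambda>t. t / 2))"
    by (rule lift_compose[OF c]) (auto intro!: continuous_intros)
  then have cp: "lift p {0..1} (c \<circ> (\<lambda>t. t / 2))"
    by (rule lift_cong) (auto simp: path_join_def)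
  have "lift (path_join p q \<circ> (\<lambda>t. (t + 1) / 2)) {0..1} (c \<circ> (\<lambda>t. (t + 1) / 2))"
    by (rule lift_compose[OF c]) (auto intro!: continuous_intros)
  then have cq: "lift q {0..1} (c \<circ> (\<lambda>t. (t + 1) / 2))"
    by (rule lift_cong) (use pq in \<open>auto simp: path_join_def add_divide_distrib\<close>)
  have cl: "c 0 \<in> carrier G" "c (1/2) \<in> carrier G" "c 1 \<in> carrier G"
    using lift_closed[OF c] by auto
  have "holonomy p \<otimes> holonomy q = c 0 \<otimes> inv (c (1/2)) \<otimes> (c (1/2) \<otimes> inv (c 1))"
    using holonomy_eq[OF _ cp] holonomy_eq[OF _ cq] pq by simp
  also have "\<dots> = holonomy (path_join p q)"
    using holonomy_eq[OF j c] cl by (simp add: m_assoc inv_cancel_left)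
  finally show "holonomy (path_join p q) = holonomy p \<otimes> holonomy q" ..
next
  fix p q assume hom: "path_homotopic X p q"
  note pq = path_homotopic_imp[OF hom]
  obtain h :: "real \<times> real \<Rightarrow> 'x" where h: "continuous_map (top_of_set ({0..1} \<times> {0..1})) X h"
    "\<And>t. h (0, t) = p t" "\<And>t. h (1, t) = q t"
    "\<And>s. s \<in> {0..1} \<Longrightarrow> h (s, 0) = p 0" "\<And>s. s \<in> {0..1} \<Longrightarrow> h (s, 1) = p 1"
    by (rule path_homotopicE[OF hom]) blast
  obtain c where c: "lift h ({0..1} \<times> {0..1}) c" using lift_square[OF h(1)] by blast
  have horizontal: "lift (\<lambda>t. h (s, t)) {0..1} (\<lambda>t. c (s, t))" if "s \<in> {0..1}" for s
  proof -
    have "lift (h \<circ> (\<lambda>t. (s, t))) {0..1} (c \<circ> (\<lambda>t. (s, t)))"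
      by (rule lift_compose[OF c]) (use that in \<open>auto intro!: continuous_on_Pair\<close>)
    then show ?thesis by (simp add: o_def)
  qed
  \<comment> \<open>Along the two edges where the homotopy is constant, so is the lift.\<close>
  have vertical: "c (0, t) = c (1, t)" if t: "t \<in> {0..1}" "\<And>s. s \<in> {0..1} \<Longrightarrow> h (s, t) = x" for t x
  proof -
    have "lift (h \<circ> (\<lambda>s. (s, t))) {0..1} (c \<circ> (\<lambda>s. (s, t)))"
      by (rule lift_compose[OF c]) (use t(1) in \<open>auto intro!: continuous_on_Pair\<close>)
    then have l: "lift (\<lambda>s. x) {0..1} (c \<circ> (\<lambda>s. (s, t)))"
      by (rule lift_cong) (use t in auto)
    have "h (0, t) \<in> topspace X" using h(1) t(1) by (auto simp: continuous_map_def Pi_iff)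
    then have x: "x \<in> topspace X" using t(2)[of 0] by simp
    then obtain U f where U: "flat U f" "x \<in> U" using flat_ex by blast
    have l': "lift (\<lambda>s. x) {0..1} (f \<circ> (\<lambda>s. x))" by (rule lift_flat) (use U in auto)
    obtain g where "\<forall>s\<in>{0..1}. (c \<circ> (\<lambda>s. (s, t))) s = (f \<circ> (\<lambda>s. x)) s \<otimes> g"
      using lift_unique[OF _ _ l' l] x by auto
    then show ?thesis by simp
  qed
  have "holonomy p = c (0, 0) \<otimes> inv (c (0, 1))"
    using horizontal[of 0] h(2) by (intro holonomy_eq[OF pq(1), of "\<lambda>t. c (0, t)"]) simp
  also have "\<dots> = c (1, 0) \<otimes> inv (c (1, 1))"
    using vertical[of 0 "p 0"] vertical[of 1 "p 1"] h by simp
  also have "\<dots> = holonomy q"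
    using horizontal[of 1] h(3) by (intro holonomy_eq[OF pq(2), of "\<lambda>t. c (1, t)", symmetric]) simp
  finally show "holonomy p = holonomy q" .
next
  fix U f p assume U: "flat U f" and p: "pathin (subtopology X U) p"
  have "lift p {0..1} (f \<circ> p)" by (rule lift_flat[OF U]) (use p in \<open>auto simp: pathin_subtopology\<close>)
  then show "holonomy p = f (p 0) \<otimes> inv (f (p 1))"
    using holonomy_eq[of p] p by (auto simp: pathin_subtopology)
qed

text \<open>On short paths the values are prescribed by flat functions, and short paths generate.\<close>

lemma transport_unique:
  assumes "transport \<tau>" "transport \<tau>'" "pathin X p"
  shows "\<tau> p = \<tau>' p"
  using assms(3)
proof (induction rule: path_local_induct)
  case (join p q)
  have "\<sigma> (path_join p q) = \<sigma> p \<otimes> \<sigma> q" if "transport \<sigma>" for \<sigma>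
    using groupoid_repD(2)[of X G \<sigma> p q] that join(1-3) by (simp add: transport_def)
  from this[OF assms(1)] this[OF assms(2)] show ?case using join(4,5) by simp
next
  case (homotopic p q)
  have "\<sigma> p = \<sigma> q" if "transport \<sigma>" for \<sigma>
    using groupoid_repD(3)[of X G \<sigma> p q] that homotopic(1) by (simp add: transport_def)
  from this[OF assms(1)] this[OF assms(2)] show ?case using homotopic(2) by simp
next
  case (locally x)
  then obtain U f where U: "flat U f" "x \<in> U" using flat_ex by blast
  then have "\<tau> p = \<tau>' p" if "pathin (subtopology X U) p" for p
  proof -
    have "\<sigma> p = f (p 0) \<otimes> inv (f (p 1))" if "transport \<sigma>" for \<sigma>
      using that \<open>pathin (subtopology X U) p\<close> U(1) unfolding transport_def by blast
    from this[OF assms(1)] this[OF assms(2)] show ?thesis by simp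
  qed
  then show ?case using U flat_open by blast
qed

end


section \<open>Framed torsors\<close>

text \<open>
  A framing describes sections of a torsor by \<open>G\<close>-valued functions; it amounts to the choice
  of a germ at every point, which need not vary continuously.
\<close>

definition framing ::
  "'x topology \<Rightarrow> ('g, 'm) monoid_scheme \<Rightarrow> ('x, 's, 'x \<Rightarrow> 'g) presheaf_with_action \<Rightarrow>
   ('x set \<Rightarrow> 's \<Rightarrow> 'x \<Rightarrow> 'g) \<Rightarrow> bool" where
  "framing X G P \<kappa> \<longleftrightarrow>
     (\<forall>U s x. openin X U \<and> s \<in> sections P U \<and> x \<in> U \<longrightarrow> \<kappa> U s x \<in> carrier G) \<and>
     (\<forall>U V s x. openin X U \<and> openin X V \<and> V \<subseteq> U \<and> s \<in> sections P U \<and> x \<in> V \<longrightarrow>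
        \<kappa> V (restr P U V s) x = \<kappa> U s x) \<and>
     (\<forall>U s g x. openin X U \<and> s \<in> sections P U \<and>
        g \<in> carrier (gsections (constant_sheaf X G) U) \<and> x \<in> U \<longrightarrow>
        \<kappa> U (action P U s g) x = \<kappa> U s x \<otimes>\<^bsub>G\<^esub> g x)"

lemma framingD:
  assumes "framing X G P \<kappa>" "openin X U" "s \<in> sections P U"
  shows "x \<in> U \<Longrightarrow> \<kappa> U s x \<in> carrier G"
    and "openin X V \<Longrightarrow> V \<subseteq> U \<Longrightarrow> x \<in> V \<Longrightarrow> \<kappa> V (restr P U V s) x = \<kappa> U s x"
    and "g \<in> carrier (gsections (constant_sheaf X G) U) \<Longrightarrow> x \<in> U \<Longrightarrow>
      \<kappa> U (action P U s g) x = \<kappa> U s x \<otimes>\<^bsub>G\<^esub> g x"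
proof -
  note F = assms(1)[unfolded framing_def]
  show "\<kappa> U s x \<in> carrier G" if "x \<in> U"
    by (rule F[THEN conjunct1, rule_format]) (intro conjI assms(2,3) that)
  show "\<kappa> V (restr P U V s) x = \<kappa> U s x" if "openin X V" "V \<subseteq> U" "x \<in> V"
    by (rule F[THEN conjunct2, THEN conjunct1, rule_format]) (intro conjI assms(2,3) that)
  show "\<kappa> U (action P U s g) x = \<kappa> U s x \<otimes>\<^bsub>G\<^esub> g x"
    if "g \<in> carrier (gsections (constant_sheaf X G) U)" "x \<in> U"
    by (rule F[THEN conjunct2, THEN conjunct2, rule_format]) (intro conjI assms(2,3) that)
qed

definition flats ::
  "'x topology \<Rightarrow> ('x, 's, 'x \<Rightarrow> 'g) presheaf_with_action \<Rightarrow> ('x set \<Rightarrow> 's \<Rightarrow> 'x \<Rightarrow> 'g) \<Rightarrow>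
   'x set \<Rightarrow> ('x \<Rightarrow> 'g) \<Rightarrow> bool" where
  "flats X P \<kappa> U f \<longleftrightarrow> openin X U \<and> (\<exists>s\<in>sections P U. \<forall>x\<in>U. \<kappa> U s x = f x)"

lemma constant_sheaf_const:
  assumes "openin X U" "g \<in> carrier G"
  shows "(\<lambda>x\<in>U. g) \<in> carrier (gsections (constant_sheaf X G) U)"
  unfolding constant_sheaf_carrier[OF assms(1)] using assms by auto

lemma constant_sheaf_restrict:
  assumes "group G" "openin X U" "openin X V" "V \<subseteq> U"
    and "g \<in> carrier (gsections (constant_sheaf X G) U)"
  shows "restrict g V \<in> carrier (gsections (constant_sheaf X G) V)"
proof -
  have "grestr (constant_sheaf X G) U V \<in>
      hom (gsections (constant_sheaf X G) U) (gsections (constant_sheaf X G) V)"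
    using is_group_sheaf_constant_sheaf[OF assms(1), of X] assms(2-4)
    unfolding is_group_sheaf_def by blast
  from hom_in_carrier[OF this assms(5)] show ?thesis unfolding constant_sheaf_simps(4) .
qed

locale constant_sheaf_torsor = group G for G :: "('g, 'm) monoid_scheme" (structure) +
  fixes X :: "'x topology" and P :: "('x, 's, 'x \<Rightarrow> 'g) presheaf_with_action"
  assumes torsor: "is_torsor X (constant_sheaf X G) P"
begin

abbreviation C :: "'x set \<Rightarrow> ('x \<Rightarrow> 'g) set" where
  "C U \<equiv> carrier (gsections (constant_sheaf X G) U)"

lemma restr_in: "\<lbrakk>openin X U; openin X V; V \<subseteq> U; s \<in> sections P U\<rbrakk> \<Longrightarrow> restr P U V s \<in> sections P V"
  by (rule is_presheafD(1)[OF is_torsorD(2)[OF torsor]])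

lemma restr_restr:
  "\<lbrakk>openin X U; openin X V; openin X W; V \<subseteq> U; W \<subseteq> V; s \<in> sections P U\<rbrakk> \<Longrightarrow>
   restr P V W (restr P U V s) = restr P U W s"
  using is_presheafD(3)[OF is_torsorD(2)[OF torsor]] by blast

lemma restr_action:
  assumes "openin X U" "openin X V" "V \<subseteq> U" "s \<in> sections P U" "g \<in> C U"
  shows "restr P U V (action P U s g) = action P V (restr P U V s) (restrict g V)"
  using is_torsorD(6)[OF torsor assms] unfolding constant_sheaf_simps(4) .

text \<open>The locally constant function by which two local sections differ does not depend on any
  framing.\<close>

lemma section_quotient:
  assumes U: "openin X U" "s \<in> sections P U" and V: "openin X V" "t \<in> sections P V"
  obtains g where "g \<in> C (U \<inter> V)"
    and "\<And>\<kappa> x. framing X G P \<kappa> \<Longrightarrow> x \<in> U \<inter> V \<Longrightarrow> \<kappa> V t x = \<kappa> U s x \<otimes> g x"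
proof -
  have op: "openin X (U \<inter> V)" using U V by blast
  have st: "restr P U (U \<inter> V) s \<in> sections P (U \<inter> V)" "restr P V (U \<inter> V) t \<in> sections P (U \<inter> V)"
    using restr_in op U V by simp_all
  obtain g where g: "g \<in> C (U \<inter> V)"
    "action P (U \<inter> V) (restr P U (U \<inter> V) s) g = restr P V (U \<inter> V) t"
    using is_torsorD(8)[OF torsor op st] by blast
  have "\<kappa> V t x = \<kappa> U s x \<otimes> g x" if \<kappa>: "framing X G P \<kappa>" and x: "x \<in> U \<inter> V" for \<kappa> x
  proof -
    have "\<kappa> V t x = \<kappa> (U \<inter> V) (restr P V (U \<inter> V) t) x"
      using framingD(2)[OF \<kappa> V op] x by simp
    also have "\<dots> = \<kappa> (U \<inter> V) (restr P U (U \<inter> V) s) x \<otimes> g x"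
      using framingD(3)[OF \<kappa> op st(1) g(1) x] g(2) by simp
    finally show ?thesis using framingD(2)[OF \<kappa> U op] x by simp
  qed
  with g(1) show thesis by (rule that)
qed

lemma framing_inject:
  assumes \<kappa>: "framing X G P \<kappa>" and U: "openin X U" and st: "s \<in> sections P U" "t \<in> sections P U"
    and eq: "\<And>x. x \<in> U \<Longrightarrow> \<kappa> U s x = \<kappa> U t x"
  shows "s = t"
proof -
  obtain g where g: "g \<in> C U" "action P U s g = t"
    using is_torsorD(8)[OF torsor U st] by blast
  have "g = \<one>\<^bsub>gsections (constant_sheaf X G) U\<^esub>"
    unfolding constant_sheaf_simps(3)
  proof (rule extensionalityI[of _ U])
    show "g \<in> extensional U" using g(1) by simp
    fix x assume x: "x \<in> U"
    have "g x \<in> carrier G" using g(1) x unfolding constant_sheaf_carrier[OF U] by blast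
    moreover have "\<kappa> U s x = \<kappa> U s x \<otimes> g x"
      using framingD(3)[OF \<kappa> U st(1) g(1) x] g(2) eq[OF x] by simp
    ultimately show "g x = (\<lambda>x\<in>U. \<one>) x"
      using framingD(1)[OF \<kappa> U st(1) x] x by simp
  qed simp
  then show ?thesis using is_torsorD(4)[OF torsor U st(1)] g(2) by simp
qed

text \<open>Sections are glued from local ones; the framing detects both existence and compatibility.\<close>

lemma framing_glue:
  assumes \<kappa>: "framing X G P \<kappa>" and U: "openin X U"
    and loc: "\<And>x. x \<in> U \<Longrightarrow> \<exists>V. x \<in> V \<and> V \<subseteq> U \<and> flats X P \<kappa> V f"
  shows "flats X P \<kappa> U f"
proof -
  define \<V> where "\<V> = {V. V \<subseteq> U \<and> flats X P \<kappa> V f}"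
  define s where "s V = (SOME s. s \<in> sections P V \<and> (\<forall>x\<in>V. \<kappa> V s x = f x))" for V
  have op: "openin X V" if "V \<in> \<V>" for V using that by (simp add: \<V>_def flats_def)
  have s: "s V \<in> sections P V \<and> (\<forall>x\<in>V. \<kappa> V (s V) x = f x)" if "V \<in> \<V>" for V
    unfolding s_def by (rule someI_ex) (use that in \<open>auto simp: \<V>_def flats_def\<close>)
  have "restr P V (V \<inter> W) (s V) = restr P W (V \<inter> W) (s W)" if VW: "V \<in> \<V>" "W \<in> \<V>" for V W
  proof (rule framing_inject[OF \<kappa>])
    show VW': "openin X (V \<inter> W)" using op VW by blast
    show "restr P V (V \<inter> W) (s V) \<in> sections P (V \<inter> W)" "restr P W (V \<inter> W) (s W) \<in> sections P (V \<inter> W)"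
      using restr_in op VW s VW' by simp_all
    fix x assume "x \<in> V \<inter> W"
    then show "\<kappa> (V \<inter> W) (restr P V (V \<inter> W) (s V)) x = \<kappa> (V \<inter> W) (restr P W (V \<inter> W) (s W)) x"
      using framingD(2)[OF \<kappa> op _ VW'] s VW by simp
  qed
  then obtain t where t: "t \<in> sections P (\<Union>\<V>)" "\<And>V. V \<in> \<V> \<Longrightarrow> restr P (\<Union>\<V>) V t = s V"
    using is_sheafD_glue[OF is_torsorD(1)[OF torsor], of \<V> s] op s by blast
  have un: "\<Union>\<V> = U" using loc unfolding \<V>_def by blast
  have "\<kappa> U t x = f x" if x: "x \<in> U" for x
  proof -
    obtain V where V: "V \<in> \<V>" "x \<in> V" using x un by blast
    then have "V \<subseteq> U" by (simp add: \<V>_def)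
    then have "\<kappa> U t x = \<kappa> V (restr P U V t) x"
      using framingD(2)[OF \<kappa> U _ op[OF V(1)]] t(1) V(2) un by simp
    then show ?thesis using t(2)[OF V(1)] s[OF V(1)] V(2) un by simp
  qed
  then show ?thesis using t(1) U un unfolding flats_def by blast
qed

text \<open>Fix a local section \<open>e x\<close> near every point \<open>x\<close>. The coordinate of a section \<open>s\<close> at \<open>x\<close> is the value at
  \<open>x\<close> of the locally constant function that takes \<open>e x\<close> to \<open>s\<close>.\<close>

lemma framing_exists: "\<exists>\<kappa>. framing X G P \<kappa>"
proof -
  have "\<forall>x\<in>topspace X. \<exists>U e. openin X U \<and> x \<in> U \<and> e \<in> sections P U"
    using is_torsorD(7)[OF torsor] by blast
  then obtain W e where We: "\<And>x. x \<in> topspace X \<Longrightarrow> openin X (W x) \<and> x \<in> W x \<and> e x \<in> sections P (W x)"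
    by metis
  define r where "r U x = restr P (W x) (U \<inter> W x) (e x)" for U x
  define d where "d U s x = (THE g. g \<in> C (U \<inter> W x) \<and>
      action P (U \<inter> W x) (r U x) g = restr P U (U \<inter> W x) s)" for U s x
  have op: "openin X (U \<inter> W x)" "x \<in> U \<inter> W x" and r: "r U x \<in> sections P (U \<inter> W x)"
    if "openin X U" "x \<in> U" for U x
  proof -
    have "x \<in> topspace X" using that openin_subset by blast
    then show "openin X (U \<inter> W x)" "x \<in> U \<inter> W x" "r U x \<in> sections P (U \<inter> W x)"
      using We that restr_in[of "W x" "U \<inter> W x"] unfolding r_def by blast+
  qed
  have ex1: "\<exists>!g. g \<in> C (U \<inter> W x) \<and> action P (U \<inter> W x) (r U x) g = restr P U (U \<inter> W x) s"
    if "openin X U" "s \<in> sections P U" "x \<in> U" for U s x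
    by (rule is_torsorD(8)[OF torsor]) (use that op r restr_in in simp_all)
  have d: "d U s x \<in> C (U \<inter> W x) \<and> action P (U \<inter> W x) (r U x) (d U s x) = restr P U (U \<inter> W x) s"
    if "openin X U" "s \<in> sections P U" "x \<in> U" for U s x
    unfolding d_def by (rule theI'[OF ex1[OF that]])
  have d_eq: "d U s x = g" if "openin X U" "s \<in> sections P U" "x \<in> U"
    "g \<in> C (U \<inter> W x)" "action P (U \<inter> W x) (r U x) g = restr P U (U \<inter> W x) s" for U s x g
    using ex1[OF that(1-3)] d[OF that(1-3)] that(4,5) by blast
  have "framing X G P (\<lambda>U s x. d U s x x)"
    unfolding framing_def
  proof (intro conjI allI impI)
    fix U s x assume H: "openin X U \<and> s \<in> sections P U \<and> x \<in> U"
    then show "d U s x x \<in> carrier G"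
      using d[of U s x] op[of U x] constant_sheaf_carrier[OF op(1), of U x] by blast
  next
    fix U V s x assume H: "openin X U \<and> openin X V \<and> V \<subseteq> U \<and> s \<in> sections P U \<and> x \<in> V"
    then have U: "openin X U" "x \<in> U" "s \<in> sections P U" and V: "openin X V" "x \<in> V" "V \<subseteq> U"
      by blast+
    have sub: "V \<inter> W x \<subseteq> U \<inter> W x" using V by blast
    have x: "x \<in> topspace X" using U openin_subset by blast
    have "d V (restr P U V s) x = restrict (d U s x) (V \<inter> W x)"
    proof (rule d_eq[OF V(1) _ V(2)])
      show "restr P U V s \<in> sections P V" using restr_in U V by simp
      show "restrict (d U s x) (V \<inter> W x) \<in> C (V \<inter> W x)"
        using constant_sheaf_restrict[OF is_group op(1)[OF U(1,2)] op(1)[OF V(1,2)] sub] d[OF U(1,3,2)]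
        by blast
      have "r V x = restr P (U \<inter> W x) (V \<inter> W x) (r U x)"
        unfolding r_def using restr_restr[of "W x" "U \<inter> W x" "V \<inter> W x"] We[OF x] op U V sub by simp
      then have "action P (V \<inter> W x) (r V x) (restrict (d U s x) (V \<inter> W x)) =
          restr P (U \<inter> W x) (V \<inter> W x) (action P (U \<inter> W x) (r U x) (d U s x))"
        using restr_action[OF op(1)[OF U(1,2)] op(1)[OF V(1,2)] sub r[OF U(1,2)]
            conjunct1[OF d[OF U(1,3,2)]]] by simp
      also have "\<dots> = restr P (U \<inter> W x) (V \<inter> W x) (restr P U (U \<inter> W x) s)"
        using d[OF U(1,3,2)] by simp
      also have "\<dots> = restr P V (V \<inter> W x) (restr P U V s)"
        using restr_restr[OF U(1) op(1)[OF U(1,2)] op(1)[OF V(1,2)] _ sub U(3)]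
          restr_restr[OF U(1) V(1) op(1)[OF V(1,2)] V(3) _ U(3)] by simp
      finally show "action P (V \<inter> W x) (r V x) (restrict (d U s x) (V \<inter> W x)) =
          restr P V (V \<inter> W x) (restr P U V s)" .
    qed
    then show "d V (restr P U V s) x x = d U s x x" using op[OF V(1,2)] by simp
  next
    fix U s g x assume H: "openin X U \<and> s \<in> sections P U \<and> g \<in> C U \<and> x \<in> U"
    then have U: "openin X U" "s \<in> sections P U" "x \<in> U" and g: "g \<in> C U" by blast+
    have g': "restrict g (U \<inter> W x) \<in> C (U \<inter> W x)"
      by (rule constant_sheaf_restrict[OF is_group U(1) op(1)[OF U(1,3)] _ g]) simp
    let ?A = "gsections (constant_sheaf X G) (U \<inter> W x)"
    interpret A: group ?A
      using is_group_sheaf_constant_sheaf[OF is_group, of X] op(1)[OF U(1,3)] unfolding is_group_sheaf_def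
      by blast
    have "d U (action P U s g) x = d U s x \<otimes>\<^bsub>?A\<^esub> restrict g (U \<inter> W x)"
    proof (rule d_eq[OF U(1) _ U(3)])
      show "action P U s g \<in> sections P U" using is_torsorD(3)[OF torsor U(1,2) g] .
      show "d U s x \<otimes>\<^bsub>?A\<^esub> restrict g (U \<inter> W x) \<in> C (U \<inter> W x)"
        by (rule A.m_closed[OF conjunct1[OF d[OF U]] g'])
      have "action P (U \<inter> W x) (r U x) (d U s x \<otimes>\<^bsub>?A\<^esub> restrict g (U \<inter> W x)) =
          action P (U \<inter> W x) (action P (U \<inter> W x) (r U x) (d U s x)) (restrict g (U \<inter> W x))"
        by (rule is_torsorD(5)[OF torsor op(1) r, symmetric]) (use U d[OF U] g' in blast)+
      also have "\<dots> = restr P U (U \<inter> W x) (action P U s g)"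
        using restr_action[OF U(1) op(1)[OF U(1,3)] Int_lower1 U(2) g] conjunct2[OF d[OF U]] by simp
      finally show "action P (U \<inter> W x) (r U x) (d U s x \<otimes>\<^bsub>?A\<^esub> restrict g (U \<inter> W x)) =
          restr P U (U \<inter> W x) (action P U s g)" .
    qed
    then show "d U (action P U s g) x x = d U s x x \<otimes> g x"
      using op[OF U(1,3)] unfolding constant_sheaf_simps(2) by simp
  qed
  then show ?thesis by blast
qed

lemma framing_flat_family:
  assumes \<kappa>: "framing X G P \<kappa>"
  shows "flat_family G X (flats X P \<kappa>)"
proof
  show "openin X U" if "flats X P \<kappa> U f" for U f using that by (simp add: flats_def)
  show "f x \<in> carrier G" if "flats X P \<kappa> U f" "x \<in> U" for U f x
    using that framingD(1)[OF \<kappa>] unfolding flats_def by metis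
  show "\<exists>U f. flats X P \<kappa> U f \<and> x \<in> U" if x: "x \<in> topspace X" for x
  proof -
    obtain U s where "openin X U" "x \<in> U" "s \<in> sections P U"
      using is_torsorD(7)[OF torsor x] by blast
    then show ?thesis by (intro exI[of _ U] exI[of _ "\<kappa> U s"]) (auto simp: flats_def)
  qed
  show "flats X P \<kappa> U (\<lambda>x. f x \<otimes> g)" if f: "flats X P \<kappa> U f" and g: "g \<in> carrier G" for U f g
  proof -
    obtain s where s: "openin X U" "s \<in> sections P U" "\<forall>x\<in>U. \<kappa> U s x = f x"
      using f by (auto simp: flats_def)
    note c = constant_sheaf_const[OF s(1) g]
    show ?thesis
      unfolding flats_def
      using is_torsorD(3)[OF torsor s(1,2) c] framingD(3)[OF \<kappa> s(1,2) c] s(1,3) by fastforce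
  qed
  show "\<exists>W g. openin X W \<and> x \<in> W \<and> W \<subseteq> U \<inter> V \<and> g \<in> carrier G \<and> (\<forall>y\<in>W. f' y = f y \<otimes> g)"
    if f: "flats X P \<kappa> U f" "flats X P \<kappa> V f'" and x: "x \<in> U" "x \<in> V" for U V f f' x
  proof -
    obtain s where s: "openin X U" "s \<in> sections P U" "\<And>x. x \<in> U \<Longrightarrow> \<kappa> U s x = f x"
      using f(1) by (auto simp: flats_def)
    obtain t where t: "openin X V" "t \<in> sections P V" "\<And>x. x \<in> V \<Longrightarrow> \<kappa> V t x = f' x"
      using f(2) by (auto simp: flats_def)
    obtain g where g: "g \<in> C (U \<inter> V)" "\<And>x. x \<in> U \<inter> V \<Longrightarrow> \<kappa> V t x = \<kappa> U s x \<otimes> g x"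
      using section_quotient[OF s(1,2) t(1,2)] \<kappa> by metis
    have op: "openin X (U \<inter> V)" using s t by blast
    obtain W where W: "openin X W" "x \<in> W" "W \<subseteq> U \<inter> V" "\<forall>y\<in>W. g y = g x" and gx: "g x \<in> carrier G"
      using g(1) x unfolding constant_sheaf_carrier[OF op] by blast
    have "f' y = f y \<otimes> g x" if "y \<in> W" for y
      using g(2)[of y] s(3)[of y] t(3)[of y] W(3,4) that by auto
    then show ?thesis using W gx by blast
  qed
qed

text \<open>The ratio of the coordinates of a section in two frames depends only on the point: another section
  multiplies both coordinates on the right by the same element, which cancels.\<close>

lemma framing_gauge:
  assumes \<kappa>: "framing X G P \<kappa>" and \<kappa>': "framing X G P \<kappa>'"
  obtains k where "\<And>x. x \<in> topspace X \<Longrightarrow> k x \<in> carrier G"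
    and "\<And>U s x. openin X U \<Longrightarrow> s \<in> sections P U \<Longrightarrow> x \<in> U \<Longrightarrow> \<kappa>' U s x = k x \<otimes> \<kappa> U s x"
proof -
  have "\<forall>x\<in>topspace X. \<exists>U e. openin X U \<and> x \<in> U \<and> e \<in> sections P U"
    using is_torsorD(7)[OF torsor] by blast
  then obtain W e where We: "\<And>x. x \<in> topspace X \<Longrightarrow> openin X (W x) \<and> x \<in> W x \<and> e x \<in> sections P (W x)"
    by metis
  define k where "k x = \<kappa>' (W x) (e x) x \<otimes> inv (\<kappa> (W x) (e x) x)" for x
  show thesis
  proof (rule that[of k])
    show "k x \<in> carrier G" if "x \<in> topspace X" for x
      unfolding k_def using We[OF that] framingD(1)[OF \<kappa>] framingD(1)[OF \<kappa>'] by simp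
    fix U s x assume U: "openin X U" "s \<in> sections P U" "x \<in> U"
    then have x: "x \<in> topspace X" using openin_subset by blast
    note W = We[OF x]
    obtain g where g: "g \<in> C (W x \<inter> U)"
      "\<And>\<kappa> y. framing X G P \<kappa> \<Longrightarrow> y \<in> W x \<inter> U \<Longrightarrow> \<kappa> U s y = \<kappa> (W x) (e x) y \<otimes> g y"
      using section_quotient[of "W x" "e x" U s] W U by blast
    have op: "openin X (W x \<inter> U)" using W U by blast
    have gx: "g x \<in> carrier G" using g(1) W U(3) unfolding constant_sheaf_carrier[OF op] by blast
    have "\<kappa> (W x) (e x) x \<in> carrier G" "\<kappa>' (W x) (e x) x \<in> carrier G"
      using W framingD(1)[OF \<kappa>] framingD(1)[OF \<kappa>'] by simp_all
    then show "\<kappa>' U s x = k x \<otimes> \<kappa> U s x"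
      using g(2)[OF \<kappa>, of x] g(2)[OF \<kappa>', of x] W U(3) gx
      by (simp add: k_def m_assoc inv_cancel_left)
  qed
qed

end


lemma locally_path_connectedE:
  assumes "locally_path_connected_space X" "openin X U" "x \<in> U"
  obtains V where "openin X V" "x \<in> V" "V \<subseteq> U"
    "\<And>y. y \<in> V \<Longrightarrow> \<exists>p. pathin (subtopology X V) p \<and> p 0 = x \<and> p 1 = y"
proof -
  obtain V where V: "openin X V" "path_connectedin X V" "x \<in> V" "V \<subseteq> U"
    using assms unfolding locally_path_connected_space_alt neighbourhood_base_of by blast
  then have "\<exists>p. pathin (subtopology X V) p \<and> p 0 = x \<and> p 1 = y" if "y \<in> V" for y
    using V that unfolding path_connectedin_def path_connected_space_def topspace_subtopology
    by blast
  then show thesis by (rule that[OF V(1,3,4)])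
qed

lemma (in group) quotient_swap:
  assumes "a \<otimes> inv b = c \<otimes> inv d"
    and "a \<in> carrier G" "b \<in> carrier G" "c \<in> carrier G" "d \<in> carrier G"
  shows "b \<otimes> (inv a \<otimes> c) = d"
proof -
  have "c = (a \<otimes> inv b) \<otimes> d" using assms by (simp add: m_assoc)
  then show ?thesis using assms(2-5) by (simp add: m_assoc inv_cancel_left inv_cancel_left')
qed

text \<open>In a locally path connected space the parallel transport determines the sections: a function
  whose end values on every path are related by transport differs from a flat one by a constant on
  each path connected set where the flat one is defined.\<close>

lemma (in constant_sheaf_torsor) flats_iff_transport:
  assumes \<kappa>: "framing X G P \<kappa>" and \<tau>: "flat_family.transport G X (flats X P \<kappa>) \<tau>"
    and X: "locally_path_connected_space X" and U: "openin X U"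
    and f: "\<And>x. x \<in> U \<Longrightarrow> f x \<in> carrier G"
  shows "flats X P \<kappa> U f \<longleftrightarrow> (\<forall>p. pathin (subtopology X U) p \<longrightarrow> \<tau> p = f (p 0) \<otimes> inv (f (p 1)))"
    (is "_ \<longleftrightarrow> ?R")
proof
  interpret F: flat_family G X "flats X P \<kappa>" by (rule framing_flat_family[OF \<kappa>])
  show ?R if "flats X P \<kappa> U f" using \<tau> that unfolding F.transport_def by blast
  assume R: ?R
  show "flats X P \<kappa> U f"
  proof (rule framing_glue[OF \<kappa> U])
    fix x assume x: "x \<in> U"
    then have "x \<in> topspace X" using U openin_subset by blast
    then obtain V e where V: "flats X P \<kappa> V e" "x \<in> V" using F.flat_ex by blast
    have "openin X (U \<inter> V)" using U F.flat_open[OF V(1)] by blast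
    then obtain N where N: "openin X N" "x \<in> N" "N \<subseteq> U \<inter> V"
      "\<And>y. y \<in> N \<Longrightarrow> \<exists>p. pathin (subtopology X N) p \<and> p 0 = x \<and> p 1 = y"
      using locally_path_connectedE[OF X, of "U \<inter> V" x] x V(2) by blast
    obtain s where s: "s \<in> sections P V" "\<And>y. y \<in> V \<Longrightarrow> \<kappa> V s y = e y"
      using V(1) by (auto simp: flats_def)
    have "flats X P \<kappa> N e"
      unfolding flats_def
      using N(1,3) restr_in[OF F.flat_open[OF V(1)] N(1) _ s(1)]
        framingD(2)[OF \<kappa> F.flat_open[OF V(1)] s(1) N(1)] s(2) by (metis Int_subset_iff subsetD)
    \<comment> \<open>The constant is chosen so that the new flat function takes the value \<open>f x\<close> at \<open>x\<close>.\<close>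
    then have "flats X P \<kappa> N (\<lambda>y. e y \<otimes> (inv (e x) \<otimes> f x))"
      by (rule F.flat_mult) (use F.flat_closed[OF V] f[OF x] in simp)
    moreover have "e y \<otimes> (inv (e x) \<otimes> f x) = f y" if y: "y \<in> N" for y
    proof (rule quotient_swap)
      obtain p where p: "pathin (subtopology X N) p" "p 0 = x" "p 1 = y" using N(4)[OF y] by blast
      then have "pathin (subtopology X U) p" "pathin (subtopology X V) p"
        using N(3) by (auto simp: pathin_subtopology)
      then show "e x \<otimes> inv (e y) = f x \<otimes> inv (f y)"
        using R \<tau> V(1) p(2,3) unfolding F.transport_def by metis
    qed (use x y N(3) f F.flat_closed[OF V(1)] V(2) in auto)
    ultimately have "flats X P \<kappa> N f" unfolding flats_def by metis
    then show "\<exists>V. x \<in> V \<and> V \<subseteq> U \<and> flats X P \<kappa> V f" using N(2,3) by blast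
  qed
qed


section \<open>The torsor of a representation\<close>

lemma constant_sheaf_path:
  assumes U: "openin X U" and g: "g \<in> carrier (gsections (constant_sheaf X G) U)"
    and p: "pathin (subtopology X U) p"
  shows "g (p 0) = g (p 1)"
  using p
proof (induction rule: path_local_induct)
  case (homotopic p q)
  then show ?case using path_homotopic_imp[OF homotopic(1)] by simp
next
  case (locally x)
  then have "x \<in> U" by simp
  then obtain W where W: "openin X W" "x \<in> W" "W \<subseteq> U" "\<forall>y\<in>W. g y = g x"
    using g unfolding constant_sheaf_carrier[OF U] by blast
  have "g (p 0) = g (p 1)" if "pathin (subtopology (subtopology X U) W) p" for p
  proof -
    have "p 0 \<in> W" "p 1 \<in> W" using that by (simp_all add: pathin_subtopology)
    then show ?thesis using W(4) by metis
  qed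
  moreover have "openin (subtopology X U) W" using W(1,3) by (rule subset_openin_subtopology)
  ultimately show ?case using W(2) by blast
qed simp

text \<open>The sections are the functions that are flat for \<open>\<tau>\<close>. They are functions on \<open>X\<close> already, so
  that the identity is a framing, and its transport is \<open>\<tau>\<close>.\<close>

definition transport_torsor ::
  "'x topology \<Rightarrow> ('g, 'm) monoid_scheme \<Rightarrow> ((real \<Rightarrow> 'x) \<Rightarrow> 'g) \<Rightarrow>
   ('x, 'x \<Rightarrow> 'g, 'x \<Rightarrow> 'g) presheaf_with_action" where
  "transport_torsor X G \<tau> =
     \<lparr>sections = (\<lambda>U. {f \<in> extensional U. (\<forall>x\<in>U. f x \<in> carrier G) \<and>
        (\<forall>p. pathin (subtopology X U) p \<longrightarrow> \<tau> p = f (p 0) \<otimes>\<^bsub>G\<^esub> inv\<^bsub>G\<^esub> (f (p 1)))}),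
      restr = (\<lambda>U V f. restrict f V),
      action = (\<lambda>U f g. \<lambda>x\<in>U. f x \<otimes>\<^bsub>G\<^esub> g x)\<rparr>"

lemma transport_torsor_simps:
  "f \<in> sections (transport_torsor X G \<tau>) U \<longleftrightarrow> f \<in> extensional U \<and> (\<forall>x\<in>U. f x \<in> carrier G) \<and>
     (\<forall>p. pathin (subtopology X U) p \<longrightarrow> \<tau> p = f (p 0) \<otimes>\<^bsub>G\<^esub> inv\<^bsub>G\<^esub> (f (p 1)))"
  "restr (transport_torsor X G \<tau>) U V f = restrict f V"
  "action (transport_torsor X G \<tau>) U f g = (\<lambda>x\<in>U. f x \<otimes>\<^bsub>G\<^esub> g x)"
  by (simp_all add: transport_torsor_def)

lemma path_ends_in: "pathin (subtopology X U) p \<Longrightarrow> p 0 \<in> U \<and> p 1 \<in> U"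
  by (simp add: pathin_subtopology)

context group
begin

lemma transport_torsor_presheaf: "is_presheaf X (transport_torsor X G \<tau>)"
  unfolding is_presheaf_def
proof (intro conjI allI impI ballI)
  fix U V assume UV: "openin X U \<and> openin X V \<and> V \<subseteq> U"
  show "restr (transport_torsor X G \<tau>) U V \<in>
      sections (transport_torsor X G \<tau>) U \<rightarrow> sections (transport_torsor X G \<tau>) V"
  proof
    fix f assume f: "f \<in> sections (transport_torsor X G \<tau>) U"
    have "\<tau> p = restrict f V (p 0) \<otimes> inv (restrict f V (p 1))" if p: "pathin (subtopology X V) p" for p
    proof -
      have "pathin (subtopology X U) p" using p UV by (auto simp: pathin_subtopology)
      then show ?thesis using f path_ends_in[OF p] unfolding transport_torsor_simps by simp
    qed
    then show "restr (transport_torsor X G \<tau>) U V f \<in> sections (transport_torsor X G \<tau>) V"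
      using f UV unfolding transport_torsor_simps by auto
  qed
qed (auto simp: transport_torsor_simps extensional_restrict Int_absorb1)

lemma transport_torsor_sheaf:
  assumes \<tau>: "groupoid_rep X G \<tau>"
  shows "is_sheaf X (transport_torsor X G \<tau>)"
  unfolding is_sheaf_def
proof (intro conjI transport_torsor_presheaf allI impI)
  let ?P = "transport_torsor X G \<tau>"
  fix \<U> s
  assume H: "(\<forall>V\<in>\<U>. openin X V) \<and> (\<forall>V\<in>\<U>. s V \<in> sections ?P V) \<and>
    (\<forall>V\<in>\<U>. \<forall>W\<in>\<U>. restr ?P V (V \<inter> W) (s V) = restr ?P W (V \<inter> W) (s W))"
  have op: "openin X V" and sV: "s V \<in> sections ?P V" if "V \<in> \<U>" for V using H that by auto
  have agree: "s V x = s W x" if "V \<in> \<U>" "W \<in> \<U>" "x \<in> V" "x \<in> W" for V W x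
  proof -
    have "restrict (s V) (V \<inter> W) = restrict (s W) (V \<inter> W)"
      using H[THEN conjunct2, THEN conjunct2, rule_format, OF that(1,2)]
      unfolding transport_torsor_simps .
    then show ?thesis using that(3,4) by (metis IntI restrict_apply')
  qed
  define t where "t = (\<lambda>x\<in>\<Union>\<U>. s (SOME V. V \<in> \<U> \<and> x \<in> V) x)"
  have t: "t x = s V x" if V: "V \<in> \<U>" "x \<in> V" for V x
  proof -
    define V' where "V' = (SOME V. V \<in> \<U> \<and> x \<in> V)"
    have V': "V' \<in> \<U> \<and> x \<in> V'" unfolding V'_def by (rule someI[of _ V]) (use V in blast)
    have "t x = s V' x" using V by (auto simp: t_def V'_def)
    also have "\<dots> = s V x" using agree[of V' V x] V' V by blast
    finally show ?thesis .
  qed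
  have tG: "t x \<in> carrier G" if "x \<in> \<Union>\<U>" for x
    using that sV t unfolding transport_torsor_simps by (metis Union_iff)
  have "\<tau> p = t (p 0) \<otimes> inv (t (p 1))" if "pathin (subtopology X (\<Union>\<U>)) p" for p
    using that
  proof (induction rule: path_local_induct)
    case (join p q)
    have "\<tau> (path_join p q) = \<tau> p \<otimes> \<tau> q"
      by (rule groupoid_repD(2)[OF \<tau>]) (use join(1-3) in \<open>simp_all add: pathin_subtopology\<close>)
    then show ?case
      using join(3-5) tG path_ends_in[OF join(1)] path_ends_in[OF join(2)]
      by (simp add: m_assoc inv_cancel_left)
  next
    case (homotopic p q)
    then show ?case
      using groupoid_repD(3)[OF \<tau> path_homotopic_subtopology[OF homotopic(1)]]
        path_homotopic_imp(3,4)[OF homotopic(1)] by simp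
  next
    case (locally x)
    then obtain V where V: "V \<in> \<U>" "x \<in> V" by auto
    have "\<tau> p = t (p 0) \<otimes> inv (t (p 1))" if "pathin (subtopology (subtopology X (\<Union>\<U>)) V) p" for p
    proof -
      have "pathin (subtopology X V) p" using that by (auto simp: pathin_subtopology)
      then show ?thesis
        using sV[OF V(1)] t[OF V(1)] path_ends_in[OF that] unfolding transport_torsor_simps by simp
    qed
    moreover have "openin (subtopology X (\<Union>\<U>)) V"
      using V(1) op by (intro subset_openin_subtopology) auto
    ultimately show ?case using V(2) by blast
  qed
  then have tS: "t \<in> sections ?P (\<Union>\<U>)"
    unfolding transport_torsor_simps using tG by (simp add: t_def)
  show "\<exists>!t. t \<in> sections ?P (\<Union>\<U>) \<and> (\<forall>V\<in>\<U>. restr ?P (\<Union>\<U>) V t = s V)"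
  proof (rule ex1I[of _ t])
    have "restrict t V = s V" if V: "V \<in> \<U>" for V
    proof (rule extensionalityI[of _ V])
      show "s V \<in> extensional V" using sV[OF V] unfolding transport_torsor_simps by blast
    qed (use t[OF V] in auto)
    then show "t \<in> sections ?P (\<Union>\<U>) \<and> (\<forall>V\<in>\<U>. restr ?P (\<Union>\<U>) V t = s V)"
      using tS unfolding transport_torsor_simps(2) by blast
  next
    fix u assume u: "u \<in> sections ?P (\<Union>\<U>) \<and> (\<forall>V\<in>\<U>. restr ?P (\<Union>\<U>) V u = s V)"
    show "u = t"
    proof (rule extensionalityI[of _ "\<Union>\<U>"])
      show "u \<in> extensional (\<Union>\<U>)" using u unfolding transport_torsor_simps by blast
      show "t \<in> extensional (\<Union>\<U>)" by (simp add: t_def)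
      fix x assume "x \<in> \<Union>\<U>"
      then obtain V where V: "V \<in> \<U>" "x \<in> V" by blast
      then have "restrict u V = s V" using u unfolding transport_torsor_simps(2) by blast
      then show "u x = t x" using t[OF V] V by (metis restrict_apply')
    qed
  qed
qed

text \<open>In a neighbourhood \<open>V\<close> of \<open>x\<close> whose loops contract in \<open>X\<close>, all paths in \<open>V\<close> from \<open>x\<close> to \<open>y\<close>
  have the same value under \<open>\<tau>\<close>; the inverse of this value is a flat function of \<open>y\<close>.\<close>

lemma transport_torsor_locally_nonempty:
  assumes X: "locally_relatively_1_connected X" and \<tau>: "groupoid_rep X G \<tau>"
    and x: "x \<in> topspace X"
  shows "\<exists>U. openin X U \<and> x \<in> U \<and> sections (transport_torsor X G \<tau>) U \<noteq> {}"
proof -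
  note D = groupoid_repD[OF \<tau>]
  obtain U V where UV: "openin X U" "x \<in> U" "U \<subseteq> V" "path_connectedin X V"
    and null: "\<And>\<gamma>. pathin (subtopology X V) \<gamma> \<Longrightarrow> \<gamma> 0 = \<gamma> 1 \<Longrightarrow> path_homotopic X \<gamma> (\<lambda>t. \<gamma> 0)"
  proof -
    let ?N = "\<lambda>V. path_connectedin X V \<and>
      (\<forall>\<gamma>. pathin (subtopology X V) \<gamma> \<and> \<gamma> 0 = \<gamma> 1 \<longrightarrow> path_homotopic X \<gamma> (\<lambda>t. \<gamma> 0))"
    have "\<exists>U V. openin X U \<and> ?N V \<and> x \<in> U \<and> U \<subseteq> V \<and> V \<subseteq> topspace X"
      by (rule X[unfolded locally_relatively_1_connected_def neighbourhood_base_of, rule_format])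
        (use x in simp)
    then obtain U V where "openin X U" "?N V" "x \<in> U" "U \<subseteq> V" by blast
    then show thesis by (intro that[of U V]) simp_all
  qed
  have "\<forall>y\<in>V. \<exists>p. pathin (subtopology X V) p \<and> p 0 = x \<and> p 1 = y"
    using UV unfolding path_connectedin_def path_connected_space_def topspace_subtopology by blast
  then obtain q where q: "\<And>y. y \<in> V \<Longrightarrow> pathin (subtopology X V) (q y) \<and> q y 0 = x \<and> q y 1 = y"
    by metis
  have qX: "pathin X (q y)" "\<tau> (q y) \<in> carrier G" if "y \<in> V" for y
    using q[OF that] D(1) by (auto simp: pathin_subtopology)
  have "\<tau> p = inv (\<tau> (q (p 0))) \<otimes> inv (inv (\<tau> (q (p 1))))" if "pathin (subtopology X U) p" for p
  proof -
    have p: "pathin (subtopology X V) p" "pathin X p" using that UV(3) by (auto simp: pathin_subtopology)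
    have e: "p 0 \<in> V" "p 1 \<in> V" using path_ends_in[OF p(1)] by auto
    let ?l = "path_join (path_join (q (p 0)) p) (path_reverse (q (p 1)))"
    have "pathin (subtopology X V) ?l"
      using q[OF e(1)] q[OF e(2)] p(1) by (intro pathin_join pathin_reverse) simp_all
    then have "path_homotopic X ?l (\<lambda>t. x)"
      using null[of ?l] q[OF e(1)] q[OF e(2)] by simp
    then have "\<tau> ?l = \<one>" using D(3) groupoid_rep_const[OF \<tau> x] by metis
    moreover have "\<tau> ?l = \<tau> (q (p 0)) \<otimes> \<tau> p \<otimes> inv (\<tau> (q (p 1)))"
      using q[OF e(1)] q[OF e(2)] qX(1)[OF e(1)] qX(1)[OF e(2)] p(2)
      by (simp add: D(2) pathin_join pathin_reverse groupoid_rep_reverse[OF \<tau>])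
    ultimately have "\<tau> (q (p 0)) \<otimes> \<tau> p \<otimes> inv (\<tau> (q (p 1))) = \<one>" by simp
    then have "\<tau> (q (p 0)) \<otimes> \<tau> p = \<tau> (q (p 1))"
      using qX(2)[OF e(1)] qX(2)[OF e(2)] D(1)[OF p(2)] by (metis inv_closed inv_equality inv_inv m_closed)
    then show ?thesis
      using qX(2)[OF e(1)] qX(2)[OF e(2)] D(1)[OF p(2)] inv_cancel_left by (metis inv_inv)
  qed
  then have "(\<lambda>y\<in>U. inv (\<tau> (q y))) \<in> sections (transport_torsor X G \<tau>) U"
    unfolding transport_torsor_simps using path_ends_in[of X U] qX(2) UV(3) by auto
  then show ?thesis using UV(1,2) by blast
qed

text \<open>Along a path \<open>p\<close>, two flat functions satisfy
  \<open>f (p 0) \<otimes> inv (f (p 1)) = f' (p 0) \<otimes> inv (f' (p 1))\<close>, hence \<open>inv (f y) \<otimes> f' y\<close> is constant on path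
  connected sets, that is, locally constant.\<close>

lemma is_torsor_transport_torsor:
  assumes X: "locally_relatively_1_connected X" and \<tau>: "groupoid_rep X G \<tau>"
  shows "is_torsor X (constant_sheaf X G) (transport_torsor X G \<tau>)"
proof -
  let ?P = "transport_torsor X G \<tau>"
  let ?C = "\<lambda>U. carrier (gsections (constant_sheaf X G) U)"
  have gG: "g x \<in> carrier G" if "openin X U" "g \<in> ?C U" "x \<in> U" for U g x
    using that constant_sheaf_carrier by blast
  have fG: "f x \<in> carrier G" if "f \<in> sections ?P U" "x \<in> U" for U f x
    using that unfolding transport_torsor_simps by blast
  have fext: "f \<in> extensional U" if "f \<in> sections ?P U" for U f
    using that unfolding transport_torsor_simps by blast
  have fp: "\<tau> p = f (p 0) \<otimes> inv (f (p 1))" if "f \<in> sections ?P U" "pathin (subtopology X U) p" for U f p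
    using that unfolding transport_torsor_simps by blast
  have closed: "action ?P U f g \<in> sections ?P U"
    if U: "openin X U" and f: "f \<in> sections ?P U" and g: "g \<in> ?C U" for U f g
    unfolding transport_torsor_simps
  proof (intro conjI allI impI ballI)
    show "(\<lambda>x\<in>U. f x \<otimes> g x) x \<in> carrier G" if "x \<in> U" for x
      using that fG[OF f] gG[OF U g] by simp
    fix p assume p: "pathin (subtopology X U) p"
    note e = path_ends_in[OF p]
    have "f (p 0) \<otimes> g (p 1) \<otimes> inv (f (p 1) \<otimes> g (p 1)) = f (p 0) \<otimes> inv (f (p 1))"
      using fG[OF f] gG[OF U g] e by (simp add: inv_mult_group m_assoc inv_cancel_left')
    then show "\<tau> p = (\<lambda>x\<in>U. f x \<otimes> g x) (p 0) \<otimes> inv ((\<lambda>x\<in>U. f x \<otimes> g x) (p 1))"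
      using e fp[OF f p] constant_sheaf_path[OF U g p] by simp
  qed simp
  have transitive: "\<exists>!g. g \<in> ?C U \<and> action ?P U f g = f'"
    if U: "openin X U" and f: "f \<in> sections ?P U" and f': "f' \<in> sections ?P U" for U f f'
  proof (rule ex1I[of _ "\<lambda>x\<in>U. inv (f x) \<otimes> f' x"])
    have "(\<lambda>x\<in>U. inv (f x) \<otimes> f' x) \<in> ?C U"
      unfolding constant_sheaf_carrier[OF U]
    proof (intro conjI ballI)
      fix x assume x: "x \<in> U"
      show "(\<lambda>x\<in>U. inv (f x) \<otimes> f' x) x \<in> carrier G" using x fG[OF f] fG[OF f'] by simp
      have "locally_path_connected_space X"
        using X unfolding locally_relatively_1_connected_def locally_path_connected_space_def
        by (rule neighbourhood_base_of_mono) blast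
      then obtain W where W: "openin X W" "x \<in> W" "W \<subseteq> U"
        "\<And>y. y \<in> W \<Longrightarrow> \<exists>p. pathin (subtopology X W) p \<and> p 0 = x \<and> p 1 = y"
        using U x by (rule locally_path_connectedE) blast
      have "inv (f y) \<otimes> f' y = inv (f x) \<otimes> f' x" if y: "y \<in> W" for y
      proof -
        obtain p where p: "pathin (subtopology X W) p" "p 0 = x" "p 1 = y" using W(4)[OF y] by blast
        then have "pathin (subtopology X U) p" using W(3) by (auto simp: pathin_subtopology)
        then have "f x \<otimes> inv (f y) = f' x \<otimes> inv (f' y)" using fp[OF f] fp[OF f'] p by metis
        moreover have yU: "y \<in> U" using y W(3) by blast
        ultimately have "f y \<otimes> (inv (f x) \<otimes> f' x) = f' y"
          using quotient_swap fG[OF f] fG[OF f'] x by simp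
        then show ?thesis
          using inv_cancel_left[of "f y" "inv (f x) \<otimes> f' x"] fG[OF f] fG[OF f'] x yU by simp
      qed
      then have "\<forall>y\<in>W. (\<lambda>x\<in>U. inv (f x) \<otimes> f' x) y = (\<lambda>x\<in>U. inv (f x) \<otimes> f' x) x"
        using W(3) x by auto
      then show "\<exists>W. openin X W \<and> x \<in> W \<and> W \<subseteq> U \<and>
          (\<forall>y\<in>W. (\<lambda>x\<in>U. inv (f x) \<otimes> f' x) y = (\<lambda>x\<in>U. inv (f x) \<otimes> f' x) x)"
        using W(1-3) by blast
    qed simp
    moreover have "action ?P U f (\<lambda>x\<in>U. inv (f x) \<otimes> f' x) = f'"
      unfolding transport_torsor_simps
      by (rule extensionalityI[of _ U])
        (use fG[OF f] fG[OF f'] fext[OF f'] inv_cancel_left' in simp_all)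
    ultimately show "(\<lambda>x\<in>U. inv (f x) \<otimes> f' x) \<in> ?C U \<and>
        action ?P U f (\<lambda>x\<in>U. inv (f x) \<otimes> f' x) = f'" ..
    fix g assume g: "g \<in> ?C U \<and> action ?P U f g = f'"
    show "g = (\<lambda>x\<in>U. inv (f x) \<otimes> f' x)"
    proof (rule extensionalityI[of _ U])
      show "g \<in> extensional U" using g by simp
      fix x assume x: "x \<in> U"
      have "f' x = f x \<otimes> g x" using g x unfolding transport_torsor_simps by auto
      then show "g x = (\<lambda>x\<in>U. inv (f x) \<otimes> f' x) x"
        using x fG[OF f x] gG[OF U conjunct1[OF g] x] inv_cancel_left by simp
    qed simp
  qed
  show ?thesis
    unfolding is_torsor_def
  proof (intro conjI allI impI ballI)
    show "is_sheaf X ?P" by (rule transport_torsor_sheaf[OF \<tau>])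
    show "\<exists>U. openin X U \<and> x \<in> U \<and> sections ?P U \<noteq> {}" if "x \<in> topspace X" for x
      by (rule transport_torsor_locally_nonempty[OF X \<tau> that])
    fix U f assume U: "openin X U" and f: "f \<in> sections ?P U"
    show "action ?P U f \<one>\<^bsub>gsections (constant_sheaf X G) U\<^esub> = f"
      unfolding transport_torsor_simps constant_sheaf_simps
      by (rule extensionalityI[of _ U]) (use fG[OF f] fext[OF f] in simp_all)
    fix g assume g: "g \<in> ?C U"
    show "action ?P U f g \<in> sections ?P U" by (rule closed[OF U f g])
    fix h assume h: "h \<in> ?C U"
    show "action ?P U (action ?P U f g) h =
        action ?P U f (g \<otimes>\<^bsub>gsections (constant_sheaf X G) U\<^esub> h)"
      unfolding transport_torsor_simps constant_sheaf_simps
      by (rule extensionalityI[of _ U]) (use fG[OF f] gG[OF U g] gG[OF U h] m_assoc in simp_all)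
  next
    fix U V f g assume "openin X U \<and> openin X V \<and> V \<subseteq> U"
    then show "restr ?P U V (action ?P U f g) =
        action ?P V (restr ?P U V f) (grestr (constant_sheaf X G) U V g)"
      unfolding transport_torsor_simps constant_sheaf_simps
      by (intro extensionalityI[of _ V]) auto
  qed (rule transitive)
qed

lemma framing_transport_torsor: "framing X G (transport_torsor X G \<tau>) (\<lambda>U f. f)"
  unfolding framing_def transport_torsor_simps by auto

lemma transport_transport_torsor:
  assumes "locally_relatively_1_connected X" "groupoid_rep X G \<tau>"
  shows "flat_family.transport G X (flats X (transport_torsor X G \<tau>) (\<lambda>U f. f)) \<tau>"
proof -
  interpret constant_sheaf_torsor G X "transport_torsor X G \<tau>"
    by unfold_locales (rule is_torsor_transport_torsor[OF assms])
  interpret F: flat_family G X "flats X (transport_torsor X G \<tau>) (\<lambda>U f. f)"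
    by (rule framing_flat_family[OF framing_transport_torsor])
  have "\<tau> p = f (p 0) \<otimes> inv (f (p 1))"
    if f: "flats X (transport_torsor X G \<tau>) (\<lambda>U f. f) U f" and p: "pathin (subtopology X U) p" for U f p
  proof -
    obtain s where "s \<in> sections (transport_torsor X G \<tau>) U" "\<forall>x\<in>U. s x = f x"
      using f by (auto simp: flats_def)
    then show ?thesis using p path_ends_in[OF p] unfolding transport_torsor_simps by simp
  qed
  then show ?thesis using assms(2) unfolding F.transport_def by blast
qed

lemma framing_trivial_torsor: "framing X G (trivial_torsor (constant_sheaf X G)) (\<lambda>U f. f)"
  unfolding framing_def trivial_torsor_def
  by (auto simp: constant_sheaf_carrier simp del: constant_sheaf_simps(1))

lemma transport_trivial_torsor:
  "flat_family.transport G X (flats X (trivial_torsor (constant_sheaf X G)) (\<lambda>U f. f)) (\<lambda>p. \<one>)"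
proof -
  let ?T = "trivial_torsor (constant_sheaf X G)"
  interpret constant_sheaf_torsor G X ?T
    by unfold_locales (intro is_torsor_trivial_torsor is_group_sheaf_constant_sheaf is_group)
  interpret F: flat_family G X "flats X ?T (\<lambda>U f. f)"
    by (rule framing_flat_family[OF framing_trivial_torsor])
  have "\<one> = f (p 0) \<otimes> inv (f (p 1))"
    if f: "flats X ?T (\<lambda>U f. f) U f" and p: "pathin (subtopology X U) p" for U f p
  proof -
    obtain s where s: "openin X U" "s \<in> carrier (gsections (constant_sheaf X G) U)" "\<forall>x\<in>U. s x = f x"
      using f unfolding flats_def trivial_torsor_def by auto
    note e = path_ends_in[OF p]
    have "f (p 0) = f (p 1)" using constant_sheaf_path[OF s(1,2) p] s(3) e by simp
    then show ?thesis using F.flat_closed[OF f, of "p 1"] e by simp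
  qed
  then show ?thesis using groupoid_rep_trivial unfolding F.transport_def by blast
qed

end


section \<open>Isomorphisms of torsors and gauge equivalence\<close>

definition gauge_equivalent ::
  "'x topology \<Rightarrow> ('g, 'm) monoid_scheme \<Rightarrow> ((real \<Rightarrow> 'x) \<Rightarrow> 'g) \<Rightarrow> ((real \<Rightarrow> 'x) \<Rightarrow> 'g) \<Rightarrow> bool" where
  "gauge_equivalent X G \<tau> \<tau>' \<longleftrightarrow> (\<exists>k. (\<forall>x\<in>topspace X. k x \<in> carrier G) \<and>
     (\<forall>p. pathin X p \<longrightarrow> \<tau>' p = k (p 0) \<otimes>\<^bsub>G\<^esub> \<tau> p \<otimes>\<^bsub>G\<^esub> inv\<^bsub>G\<^esub> (k (p 1))))"

context group
begin

lemma gauge_quotient: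
  assumes "k \<in> carrier G" "l \<in> carrier G" "u \<in> carrier G" "v \<in> carrier G"
  shows "(k \<otimes> u) \<otimes> inv (l \<otimes> v) = k \<otimes> (u \<otimes> inv v) \<otimes> inv l"
  using assms by (simp add: inv_mult_group m_assoc)

text \<open>An isomorphism carries the frame of \<open>Q\<close> to a second frame of \<open>P\<close> with the same flat functions.
  The two frames of \<open>P\<close> differ by some \<open>k\<close>, and uniqueness of transport identifies \<open>\<tau>'\<close> with the
  transform of \<open>\<tau>\<close> by \<open>k\<close>.\<close>

lemma isomorphic_imp_gauge_equivalent:
  assumes P: "is_torsor X (constant_sheaf X G) P" and Q: "is_torsor X (constant_sheaf X G) Q"
    and iso: "torsors_isomorphic X (constant_sheaf X G) P Q"
    and \<kappa>: "framing X G P \<kappa>" "flat_family.transport G X (flats X P \<kappa>) \<tau>"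
    and \<kappa>': "framing X G Q \<kappa>'" "flat_family.transport G X (flats X Q \<kappa>') \<tau>'"
  shows "gauge_equivalent X G \<tau> \<tau>'"
proof -
  interpret P: constant_sheaf_torsor G X P by unfold_locales (rule P)
  obtain \<phi> where bij: "\<And>U. openin X U \<Longrightarrow> bij_betw (\<phi> U) (sections P U) (sections Q U)"
    and nat: "\<And>U V s. openin X U \<Longrightarrow> openin X V \<Longrightarrow> V \<subseteq> U \<Longrightarrow> s \<in> sections P U \<Longrightarrow>
        \<phi> V (restr P U V s) = restr Q U V (\<phi> U s)"
    and equi: "\<And>U s g. openin X U \<Longrightarrow> s \<in> sections P U \<Longrightarrow> g \<in> P.C U \<Longrightarrow>
        \<phi> U (action P U s g) = action Q U (\<phi> U s) g"
    using iso unfolding torsors_isomorphic_def by (elim exE conjE) (metis (no_types, lifting))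
  have in_Q: "\<phi> U s \<in> sections Q U" if "openin X U" "s \<in> sections P U" for U s
    using bij[OF that(1)] that(2) by (rule bij_betwE[rule_format])
  define \<kappa>'' where "\<kappa>'' U s = \<kappa>' U (\<phi> U s)" for U s
  have fr: "framing X G P \<kappa>''"
    unfolding framing_def
  proof (intro conjI allI impI; elim conjE)
    show "\<kappa>'' U s x \<in> carrier G" if "openin X U" "s \<in> sections P U" "x \<in> U" for U s x
      unfolding \<kappa>''_def using framingD(1)[OF \<kappa>'(1)] in_Q that by blast
    show "\<kappa>'' V (restr P U V s) x = \<kappa>'' U s x"
      if "openin X U" "openin X V" "V \<subseteq> U" "s \<in> sections P U" "x \<in> V" for U V s x
      unfolding \<kappa>''_def using framingD(2)[OF \<kappa>'(1) _ in_Q] nat that by simp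
    show "\<kappa>'' U (action P U s g) x = \<kappa>'' U s x \<otimes> g x"
      if "openin X U" "s \<in> sections P U" "g \<in> P.C U" "x \<in> U" for U s g x
      unfolding \<kappa>''_def using framingD(3)[OF \<kappa>'(1) _ in_Q] equi that by metis
  qed
  have "flats X P \<kappa>'' = flats X Q \<kappa>'"
  proof (intro ext iffI)
    fix U f
    show "flats X Q \<kappa>' U f" if "flats X P \<kappa>'' U f"
      using that in_Q unfolding flats_def \<kappa>''_def by blast
    assume f: "flats X Q \<kappa>' U f"
    then obtain t where t: "openin X U" "t \<in> sections Q U" "\<forall>x\<in>U. \<kappa>' U t x = f x"
      by (auto simp: flats_def)
    then obtain s where "s \<in> sections P U" "t = \<phi> U s"
      using bij[OF t(1)] unfolding bij_betw_def by blast
    then show "flats X P \<kappa>'' U f" using t unfolding flats_def \<kappa>''_def by blast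
  qed
  then have \<tau>': "flat_family.transport G X (flats X P \<kappa>'') \<tau>'" using \<kappa>'(2) by simp
  interpret F: flat_family G X "flats X P \<kappa>" by (rule P.framing_flat_family[OF \<kappa>(1)])
  interpret F': flat_family G X "flats X P \<kappa>''" by (rule P.framing_flat_family[OF fr])
  obtain k where k: "\<And>x. x \<in> topspace X \<Longrightarrow> k x \<in> carrier G"
    "\<And>U s x. openin X U \<Longrightarrow> s \<in> sections P U \<Longrightarrow> x \<in> U \<Longrightarrow> \<kappa>'' U s x = k x \<otimes> \<kappa> U s x"
    by (rule P.framing_gauge[OF \<kappa>(1) fr]) blast
  have \<tau>: "groupoid_rep X G \<tau>" using \<kappa>(2) unfolding F.transport_def by blast
  have "F'.transport (\<lambda>p. k (p 0) \<otimes> \<tau> p \<otimes> inv (k (p 1)))"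
    unfolding F'.transport_def
  proof (intro conjI allI impI groupoid_rep_gauge[OF \<tau> k(1)])
    fix U f p assume f: "flats X P \<kappa>'' U f" and p: "pathin (subtopology X U) p"
    obtain s where s: "openin X U" "s \<in> sections P U" "\<And>x. x \<in> U \<Longrightarrow> \<kappa>'' U s x = f x"
      using f by (auto simp: flats_def)
    note e = path_ends_in[OF p]
    have eX: "p 0 \<in> topspace X" "p 1 \<in> topspace X" using e openin_subset[OF s(1)] by auto
    have fl: "flats X P \<kappa> U (\<kappa> U s)" using s(1,2) by (auto simp: flats_def)
    then have "\<tau> p = \<kappa> U s (p 0) \<otimes> inv (\<kappa> U s (p 1))"
      using \<kappa>(2) p unfolding F.transport_def by blast
    moreover have "f (p 0) = k (p 0) \<otimes> \<kappa> U s (p 0)" "f (p 1) = k (p 1) \<otimes> \<kappa> U s (p 1)"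
      using k(2)[OF s(1,2)] s(3) e by metis+
    ultimately show "k (p 0) \<otimes> \<tau> p \<otimes> inv (k (p 1)) = f (p 0) \<otimes> inv (f (p 1))"
      using gauge_quotient[OF k(1)[OF eX(1)] k(1)[OF eX(2)]] F.flat_closed[OF fl] e by simp
  qed
  from F'.transport_unique[OF \<tau>' this] show ?thesis
    unfolding gauge_equivalent_def using k(1) by (intro exI[of _ k]) blast
qed

lemma gauge_transform_flats:
  assumes P: "is_torsor X (constant_sheaf X G) P" and Q: "is_torsor X (constant_sheaf X G) Q"
    and X: "locally_path_connected_space X"
    and \<kappa>: "framing X G P \<kappa>" "flat_family.transport G X (flats X P \<kappa>) \<tau>"
    and \<kappa>': "framing X G Q \<kappa>'" "flat_family.transport G X (flats X Q \<kappa>') \<tau>'"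
    and k: "\<And>x. x \<in> topspace X \<Longrightarrow> k x \<in> carrier G"
      "\<And>p. pathin X p \<Longrightarrow> \<tau>' p = k (p 0) \<otimes> \<tau> p \<otimes> inv (k (p 1))"
    and f: "flats X P \<kappa> U f"
  shows "flats X Q \<kappa>' U (\<lambda>x. k x \<otimes> f x)"
proof -
  interpret P: constant_sheaf_torsor G X P by unfold_locales (rule P)
  interpret Q: constant_sheaf_torsor G X Q by unfold_locales (rule Q)
  interpret F: flat_family G X "flats X P \<kappa>" by (rule P.framing_flat_family[OF \<kappa>(1)])
  note U = F.flat_open[OF f]
  have UX: "x \<in> topspace X" if "x \<in> U" for x using that openin_subset[OF U] by blast
  note kG = k(1)[OF UX] and fG = F.flat_closed[OF f]
  show ?thesis
  proof (subst Q.flats_iff_transport[OF \<kappa>' X U])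
    show "\<forall>p. pathin (subtopology X U) p \<longrightarrow> \<tau>' p = k (p 0) \<otimes> f (p 0) \<otimes> inv (k (p 1) \<otimes> f (p 1))"
    proof (intro allI impI)
      fix p assume p: "pathin (subtopology X U) p"
      have "\<tau> p = f (p 0) \<otimes> inv (f (p 1))" using \<kappa>(2) f p unfolding F.transport_def by blast
      then show "\<tau>' p = k (p 0) \<otimes> f (p 0) \<otimes> inv (k (p 1) \<otimes> f (p 1))"
        using k(2)[of p] p path_ends_in[OF p] gauge_quotient kG fG by (simp add: pathin_subtopology)
    qed
  qed (use kG fG in simp)
qed

text \<open>Multiplication by \<open>k\<close> turns the flat functions of \<open>P\<close> into those of \<open>Q\<close>, and multiplication by
  the pointwise inverse goes back. Both framings being injective on sections, this determines a map of
  sections, and its compatibilities can be tested on coordinates.\<close>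

lemma gauge_equivalent_imp_isomorphic:
  assumes P: "is_torsor X (constant_sheaf X G) P" and Q: "is_torsor X (constant_sheaf X G) Q"
    and X: "locally_path_connected_space X"
    and \<kappa>: "framing X G P \<kappa>" "flat_family.transport G X (flats X P \<kappa>) \<tau>"
    and \<kappa>': "framing X G Q \<kappa>'" "flat_family.transport G X (flats X Q \<kappa>') \<tau>'"
    and gauge: "gauge_equivalent X G \<tau> \<tau>'"
  shows "torsors_isomorphic X (constant_sheaf X G) P Q"
proof -
  interpret P: constant_sheaf_torsor G X P by unfold_locales (rule P)
  interpret Q: constant_sheaf_torsor G X Q by unfold_locales (rule Q)
  interpret F: flat_family G X "flats X P \<kappa>" by (rule P.framing_flat_family[OF \<kappa>(1)])
  obtain k where k: "\<And>x. x \<in> topspace X \<Longrightarrow> k x \<in> carrier G"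
    "\<And>p. pathin X p \<Longrightarrow> \<tau>' p = k (p 0) \<otimes> \<tau> p \<otimes> inv (k (p 1))"
    using gauge unfolding gauge_equivalent_def by blast
  have kinv: "\<tau> p = inv (k (p 0)) \<otimes> \<tau>' p \<otimes> inv (inv (k (p 1)))" if p: "pathin X p" for p
  proof -
    have "\<tau> p \<in> carrier G"
      using \<kappa>(2) p groupoid_repD(1) unfolding F.transport_def by blast
    then show ?thesis
      using k(1)[OF path_start_in_topspace[OF p]] k(1)[OF path_finish_in_topspace[OF p]] k(2)[OF p]
      by (simp add: m_assoc inv_cancel_left)
  qed
  have UX: "x \<in> topspace X" if "openin X U" "x \<in> U" for U x using that openin_subset by blast
  define \<phi> where "\<phi> U s = (SOME t. t \<in> sections Q U \<and> (\<forall>x\<in>U. \<kappa>' U t x = k x \<otimes> \<kappa> U s x))" for U s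
  have \<phi>: "\<phi> U s \<in> sections Q U \<and> (\<forall>x\<in>U. \<kappa>' U (\<phi> U s) x = k x \<otimes> \<kappa> U s x)"
    if "openin X U" "s \<in> sections P U" for U s
    unfolding \<phi>_def
  proof (rule someI_ex)
    have "flats X P \<kappa> U (\<kappa> U s)" using that by (auto simp: flats_def)
    from gauge_transform_flats[OF P Q X \<kappa> \<kappa>' k this]
    show "\<exists>t. t \<in> sections Q U \<and> (\<forall>x\<in>U. \<kappa>' U t x = k x \<otimes> \<kappa> U s x)"
      by (auto simp: flats_def)
  qed
  have \<phi>_eq: "\<phi> U s = t" if "openin X U" "s \<in> sections P U" "t \<in> sections Q U"
    "\<And>x. x \<in> U \<Longrightarrow> \<kappa>' U t x = k x \<otimes> \<kappa> U s x" for U s t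
    by (rule Q.framing_inject[OF \<kappa>'(1) that(1)]) (use \<phi>[OF that(1,2)] that(3,4) in auto)
  show ?thesis
    unfolding torsors_isomorphic_def
  proof (intro exI[of _ \<phi>] conjI allI impI ballI)
    fix U assume U: "openin X U"
    show "bij_betw (\<phi> U) (sections P U) (sections Q U)"
      unfolding bij_betw_def
    proof
      show "inj_on (\<phi> U) (sections P U)"
      proof (rule inj_onI)
        fix s s' assume s: "s \<in> sections P U" "s' \<in> sections P U" "\<phi> U s = \<phi> U s'"
        show "s = s'"
        proof (rule P.framing_inject[OF \<kappa>(1) U s(1,2)])
          fix x assume x: "x \<in> U"
          have "k x \<otimes> \<kappa> U s x = k x \<otimes> \<kappa> U s' x" using \<phi>[OF U s(1)] \<phi>[OF U s(2)] s(3) x by metis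
          then show "\<kappa> U s x = \<kappa> U s' x"
            using k(1)[OF UX[OF U x]] framingD(1)[OF \<kappa>(1) U] s(1,2) x by simp
        qed
      qed
      show "\<phi> U ` sections P U = sections Q U"
      proof
        show "\<phi> U ` sections P U \<subseteq> sections Q U" using \<phi>[OF U] by blast
        show "sections Q U \<subseteq> \<phi> U ` sections P U"
        proof
          fix t assume t: "t \<in> sections Q U"
          then have "flats X Q \<kappa>' U (\<kappa>' U t)" using U by (auto simp: flats_def)
          then have "flats X P \<kappa> U (\<lambda>x. inv (k x) \<otimes> \<kappa>' U t x)"
            by (rule gauge_transform_flats[OF Q P X \<kappa>' \<kappa> _ kinv, rotated 2]) (use k(1) in simp_all)
          then obtain s where s: "s \<in> sections P U" "\<And>x. x \<in> U \<Longrightarrow> \<kappa> U s x = inv (k x) \<otimes> \<kappa>' U t x"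
            by (auto simp: flats_def)
          have "\<phi> U s = t"
            by (rule \<phi>_eq[OF U s(1) t])
              (use s(2) inv_cancel_left' k(1)[OF UX[OF U]] framingD(1)[OF \<kappa>'(1) U t] in simp)
          then show "t \<in> \<phi> U ` sections P U" using s(1) by blast
        qed
      qed
    qed
  next
    fix U V s assume UV: "openin X U \<and> openin X V \<and> V \<subseteq> U" and s: "s \<in> sections P U"
    then have U: "openin X U" and V: "openin X V" "V \<subseteq> U" by blast+
    show "\<phi> V (restr P U V s) = restr Q U V (\<phi> U s)"
    proof (rule \<phi>_eq[OF V(1)])
      show "restr P U V s \<in> sections P V" by (rule P.restr_in[OF U V s])
      show "restr Q U V (\<phi> U s) \<in> sections Q V" by (rule Q.restr_in[OF U V conjunct1[OF \<phi>[OF U s]]])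
      fix x assume x: "x \<in> V"
      then show "\<kappa>' V (restr Q U V (\<phi> U s)) x = k x \<otimes> \<kappa> V (restr P U V s) x"
        using framingD(2)[OF \<kappa>'(1) U conjunct1[OF \<phi>[OF U s]] V x] framingD(2)[OF \<kappa>(1) U s V x]
          \<phi>[OF U s] V(2) by auto
    qed
  next
    fix U s g assume U: "openin X U" and s: "s \<in> sections P U" and g: "g \<in> P.C U"
    show "\<phi> U (action P U s g) = action Q U (\<phi> U s) g"
    proof (rule \<phi>_eq[OF U])
      show "action P U s g \<in> sections P U" by (rule is_torsorD(3)[OF P U s g])
      show "action Q U (\<phi> U s) g \<in> sections Q U"
        by (rule is_torsorD(3)[OF Q U conjunct1[OF \<phi>[OF U s]] g])
      fix x assume x: "x \<in> U"
      have "g x \<in> carrier G" using g x unfolding constant_sheaf_carrier[OF U] by blast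
      then show "\<kappa>' U (action Q U (\<phi> U s) g) x = k x \<otimes> \<kappa> U (action P U s g) x"
        using framingD(3)[OF \<kappa>'(1) U conjunct1[OF \<phi>[OF U s]] g x] framingD(3)[OF \<kappa>(1) U s g x]
          \<phi>[OF U s] x k(1)[OF UX[OF U x]] framingD(1)[OF \<kappa>(1) U s x] by (simp add: m_assoc)
    qed
  qed
qed

end


section \<open>Representations of the fundamental group\<close>

abbreviation loop_class :: "'x topology \<Rightarrow> 'x \<Rightarrow> (real \<Rightarrow> 'x) \<Rightarrow> (real \<Rightarrow> 'x) set" where
  "loop_class X a p \<equiv> loop_homotopy X a `` {p}"

lemma loop_homotopyD: "(p, q) \<in> loop_homotopy X a \<Longrightarrow> path_homotopic X p q"
  by (simp add: loop_homotopy_def)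

lemma equiv_loop_homotopy: "equiv (loops_at X a) (loop_homotopy X a)"
proof (rule equivI)
  show "loop_homotopy X a \<subseteq> loops_at X a \<times> loops_at X a" by (auto simp: loop_homotopy_def)
  show "refl_on (loops_at X a) (loop_homotopy X a)"
    by (auto simp: refl_on_def loop_homotopy_def loops_at_def path_homotopic_refl)
  show "sym (loop_homotopy X a)"
    by (auto simp: sym_def loop_homotopy_def path_homotopic_sym)
  show "trans (loop_homotopy X a)"
    by (auto simp: trans_def loop_homotopy_def intro: path_homotopic_trans)
qed

lemma loop_class_eq:
  assumes "p \<in> loops_at X a" "path_homotopic X p q"
  shows "loop_class X a p = loop_class X a q"
  by (rule equiv_class_eq[OF equiv_loop_homotopy])
    (use assms path_homotopic_imp[OF assms(2)] in \<open>auto simp: loop_homotopy_def loops_at_def\<close>)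

lemma loop_class_in_pi1: "p \<in> loops_at X a \<Longrightarrow> loop_class X a p \<in> carrier (pi1 X a)"
  by (simp add: pi1_def quotientI)

lemma pi1_carrierE:
  assumes "c \<in> carrier (pi1 X a)"
  obtains p where "p \<in> loops_at X a" "c = loop_class X a p"
  using assms by (auto simp: pi1_def elim: quotientE)

lemma loops_at_join: "p \<in> loops_at X a \<Longrightarrow> q \<in> loops_at X a \<Longrightarrow> path_join p q \<in> loops_at X a"
  by (simp add: loops_at_def pathin_join)

lemma pi1_mult:
  assumes "p \<in> loops_at X a" "q \<in> loops_at X a"
  shows "loop_class X a p \<otimes>\<^bsub>pi1 X a\<^esub> loop_class X a q = loop_class X a (path_join p q)"
proof -
  have "loop_class X a (path_join p' q') = loop_class X a (path_join p q)"
    if "p' \<in> loop_class X a p" "q' \<in> loop_class X a q" for p' q'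
  proof (rule loop_class_eq[symmetric, OF loops_at_join[OF assms]])
    show "path_homotopic X (path_join p q) (path_join p' q')"
      using that assms by (intro path_homotopic_join) (auto simp: loop_homotopy_def loops_at_def)
  qed
  moreover have "p \<in> loop_class X a p" "q \<in> loop_class X a q"
    by (rule equiv_class_self[OF equiv_loop_homotopy], rule assms)+
  ultimately have "(\<Union>p'\<in>loop_class X a p. \<Union>q'\<in>loop_class X a q. loop_class X a (path_join p' q')) =
      loop_class X a (path_join p q)" by blast
  then show ?thesis by (simp add: pi1_def)
qed

context group
begin

lemma Hom_of_groupoid_rep:
  assumes \<tau>: "groupoid_rep X G \<tau>"
  shows "\<exists>\<psi>\<in>Hom (pi1 X a) G. \<forall>p\<in>loops_at X a. \<psi> (loop_class X a p) = \<tau> p"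
proof -
  define \<psi> where "\<psi> = (\<lambda>c\<in>carrier (pi1 X a). \<tau> (SOME p. p \<in> c))"
  have \<psi>: "\<psi> (loop_class X a p) = \<tau> p" if p: "p \<in> loops_at X a" for p
  proof -
    have "(SOME q. q \<in> loop_class X a p) \<in> loop_class X a p"
      by (rule someI[of _ p]) (rule equiv_class_self[OF equiv_loop_homotopy p])
    then have "path_homotopic X p (SOME q. q \<in> loop_class X a p)"
      using loop_homotopyD by (simp only: Image_singleton_iff)
    then have "\<tau> p = \<tau> (SOME q. q \<in> loop_class X a p)"
      by (rule groupoid_repD(3)[OF \<tau>])
    then show ?thesis using loop_class_in_pi1[OF p] by (simp add: \<psi>_def)
  qed
  have "\<psi> \<in> hom (pi1 X a) G"
  proof (rule homI)
    show "\<psi> c \<in> carrier G" if "c \<in> carrier (pi1 X a)" for c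
      using that groupoid_repD(1)[OF \<tau>] by (elim pi1_carrierE) (simp add: \<psi> loops_at_def)
    fix c d assume "c \<in> carrier (pi1 X a)" "d \<in> carrier (pi1 X a)"
    then obtain p q where pq: "p \<in> loops_at X a" "q \<in> loops_at X a"
      "c = loop_class X a p" "d = loop_class X a q" by (elim pi1_carrierE) blast
    have "\<tau> (path_join p q) = \<tau> p \<otimes> \<tau> q"
      by (rule groupoid_repD(2)[OF \<tau>]) (use pq(1,2) in \<open>simp_all add: loops_at_def\<close>)
    then show "\<psi> (c \<otimes>\<^bsub>pi1 X a\<^esub> d) = \<psi> c \<otimes> \<psi> d"
      using pq by (simp add: pi1_mult \<psi> loops_at_join)
  qed
  then have "\<psi> \<in> Hom (pi1 X a) G" by (simp add: Hom_def \<psi>_def)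
  then show ?thesis using \<psi> by blast
qed

text \<open>Conversely, a path becomes a loop at \<open>a\<close> when its ends are connected to \<open>a\<close> by chosen paths
  \<open>\<gamma> x\<close>. Taking \<open>\<gamma> a\<close> constant, a loop at \<open>a\<close> stays in its homotopy class.\<close>

lemma groupoid_rep_of_Hom:
  assumes X: "path_connected_space X" and a: "a \<in> topspace X" and \<psi>: "\<psi> \<in> Hom (pi1 X a) G"
  shows "\<exists>\<tau>. groupoid_rep X G \<tau> \<and> (\<forall>p\<in>loops_at X a. \<psi> (loop_class X a p) = \<tau> p)"
proof -
  have "\<forall>x\<in>topspace X. \<exists>p. pathin X p \<and> p 0 = a \<and> p 1 = x \<and> (x = a \<longrightarrow> p = (\<lambda>t. a))"
  proof
    fix x assume x: "x \<in> topspace X"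
    show "\<exists>p. pathin X p \<and> p 0 = a \<and> p 1 = x \<and> (x = a \<longrightarrow> p = (\<lambda>t. a))"
    proof (cases "x = a")
      case True
      then show ?thesis using a by (intro exI[of _ "\<lambda>t. a"]) simp
    next
      case False
      then show ?thesis using X a x unfolding path_connected_space_def by blast
    qed
  qed
  then obtain \<gamma> where \<gamma>: "\<And>x. x \<in> topspace X \<Longrightarrow> pathin X (\<gamma> x) \<and> \<gamma> x 0 = a \<and> \<gamma> x 1 = x"
    and \<gamma>a: "\<gamma> a = (\<lambda>t. a)" using a by metis
  define l where "l p = path_join (path_join (\<gamma> (p 0)) p) (path_reverse (\<gamma> (p 1)))" for p
  define \<tau> where "\<tau> p = \<psi> (loop_class X a (l p))" for p
  have hom: "\<psi> \<in> hom (pi1 X a) G" using \<psi> by (simp add: Hom_def)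
  have l: "l p \<in> loops_at X a" if p: "pathin X p" for p
    unfolding l_def loops_at_def
    using p \<gamma>[OF path_start_in_topspace[OF p]] \<gamma>[OF path_finish_in_topspace[OF p]]
    by (simp add: pathin_join pathin_reverse)
  have rep: "groupoid_rep X G \<tau>"
    unfolding groupoid_rep_def
  proof (intro conjI allI impI)
    show "\<tau> p \<in> carrier G" if "pathin X p" for p
      unfolding \<tau>_def by (rule hom_in_carrier[OF hom loop_class_in_pi1[OF l[OF that]]])
    show "\<tau> p = \<tau> q" if h: "path_homotopic X p q" for p q
    proof -
      note pq = path_homotopic_imp[OF h]
      note \<gamma>0 = \<gamma>[OF path_start_in_topspace[OF pq(1)]] and \<gamma>1 = \<gamma>[OF path_finish_in_topspace[OF pq(1)]]
      have "path_homotopic X (l p) (l q)"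
        unfolding l_def pq(3,4)
        by (intro path_homotopic_join h path_homotopic_refl pathin_reverse) (use \<gamma>0 \<gamma>1 in simp_all)
      then show ?thesis unfolding \<tau>_def using loop_class_eq[OF l[OF pq(1)]] by simp
    qed
    show "\<tau> (path_join p q) = \<tau> p \<otimes> \<tau> q" if "pathin X p \<and> pathin X q \<and> p 1 = q 0" for p q
    proof -
      have pq: "pathin X p" "pathin X q" "p 1 = q 0" using that by auto
      note \<gamma>x = \<gamma>[OF path_start_in_topspace[OF pq(1)]] and \<gamma>y = \<gamma>[OF path_start_in_topspace[OF pq(2)]]
        and \<gamma>z = \<gamma>[OF path_finish_in_topspace[OF pq(2)]]
      let ?x = "\<gamma> (p 0)" and ?y = "\<gamma> (q 0)" and ?z = "\<gamma> (q 1)"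
      note [simp] = pathin_join pathin_reverse path_homotopic_refl pq
      have xyz [simp]: "pathin X ?x" "pathin X ?y" "pathin X ?z" "?x 0 = a" "?y 0 = a" "?z 0 = a"
        "?x 1 = p 0" "?y 1 = q 0" "?z 1 = q 1" using \<gamma>x \<gamma>y \<gamma>z by simp_all
      let ?p = "path_join ?x p" and ?q = "path_join q (path_reverse ?z)"
      have "path_homotopic X (path_join (path_reverse ?y) (path_join ?y ?q)) ?q"
      proof -
        have "path_homotopic X (path_join (path_reverse ?y) (path_join ?y ?q))
            (path_join (path_join (path_reverse ?y) ?y) ?q)"
          by (rule path_homotopic_sym, rule path_homotopic_assoc) simp_all
        also have "path_homotopic X \<dots> (path_join (\<lambda>t. q 0) ?q)"
          using path_homotopic_reverse(2)[of X ?y] by (intro path_homotopic_join) simp_all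
        also have "path_homotopic X \<dots> ?q" by (rule path_homotopic_const_join) simp_all
        finally show ?thesis .
      qed
      note cancel = this
      have "path_homotopic X (path_join (l p) (l q))
          (path_join ?p (path_join (path_reverse ?y) (path_join (path_join ?y q) (path_reverse ?z))))"
        unfolding l_def pq(3) by (rule path_homotopic_assoc) simp_all
      also have "path_homotopic X \<dots> (path_join ?p (path_join (path_reverse ?y) (path_join ?y ?q)))"
        by (intro path_homotopic_join path_homotopic_assoc) simp_all
      also have "path_homotopic X \<dots> (path_join ?p ?q)"
        by (rule path_homotopic_join[OF path_homotopic_refl cancel]) simp_all
      also have "path_homotopic X \<dots> (path_join (path_join ?p q) (path_reverse ?z))"
        by (rule path_homotopic_sym, rule path_homotopic_assoc) simp_all
      also have "path_homotopic X \<dots> (l (path_join p q))"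
        unfolding l_def path_join_ends by (intro path_homotopic_join path_homotopic_assoc) simp_all
      finally have "loop_class X a (path_join (l p) (l q)) = loop_class X a (l (path_join p q))"
        by (rule loop_class_eq[OF loops_at_join[OF l[OF pq(1)] l[OF pq(2)]]])
      then show ?thesis
        unfolding \<tau>_def
        using hom_mult[OF hom loop_class_in_pi1[OF l[OF pq(1)]] loop_class_in_pi1[OF l[OF pq(2)]]]
          pi1_mult[OF l[OF pq(1)] l[OF pq(2)]] by simp
    qed
  qed
  moreover have "\<psi> (loop_class X a p) = \<tau> p" if p: "p \<in> loops_at X a" for p
  proof -
    have p': "pathin X p" "p 0 = a" "p 1 = a" using p by (auto simp: loops_at_def)
    have "path_homotopic X (l p) (path_join (\<lambda>t. a) p)"
      unfolding l_def p' \<gamma>a by (rule path_homotopic_join_const) (use p' a in \<open>simp_all add: pathin_join\<close>)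
    also have "path_homotopic X \<dots> p" by (rule path_homotopic_const_join[OF p'(1,2)])
    finally show ?thesis unfolding \<tau>_def using loop_class_eq[OF l[OF p'(1)]] by simp
  qed
  ultimately show ?thesis by blast
qed

text \<open>A gauge transformation \<open>k\<close> conjugates values on loops at \<open>a\<close> by \<open>k a\<close>. Conversely, \<open>k\<close> is
  recovered from \<open>k a = g\<close>: its value at \<open>x\<close> is forced by the required relation between \<open>\<tau>\<close> and
  \<open>\<tau>'\<close> along a path from \<open>a\<close> to \<open>x\<close>.\<close>

lemma conj_iff_gauge_equivalent:
  assumes X: "path_connected_space X" and a: "a \<in> topspace X"
    and \<tau>: "groupoid_rep X G \<tau>" and \<tau>': "groupoid_rep X G \<tau>'"
    and \<psi>: "\<psi> \<in> Hom (pi1 X a) G" "\<And>p. p \<in> loops_at X a \<Longrightarrow> \<psi> (loop_class X a p) = \<tau> p"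
    and \<psi>': "\<psi>' \<in> Hom (pi1 X a) G" "\<And>p. p \<in> loops_at X a \<Longrightarrow> \<psi>' (loop_class X a p) = \<tau>' p"
  shows "gauge_equivalent X G \<tau> \<tau>' \<longleftrightarrow> (\<exists>g\<in>carrier G. \<psi>' = conj_action (pi1 X a) G g \<psi>)"
proof
  assume "gauge_equivalent X G \<tau> \<tau>'"
  then obtain k where k: "\<And>x. x \<in> topspace X \<Longrightarrow> k x \<in> carrier G"
    "\<And>p. pathin X p \<Longrightarrow> \<tau>' p = k (p 0) \<otimes> \<tau> p \<otimes> inv (k (p 1))"
    unfolding gauge_equivalent_def by blast
  have "\<psi>' = conj_action (pi1 X a) G (k a) \<psi>"
  proof (rule extensionalityI[of _ "carrier (pi1 X a)"])
    show "\<psi>' \<in> extensional (carrier (pi1 X a))" using \<psi>'(1) by (simp add: Hom_def)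
    show "conj_action (pi1 X a) G (k a) \<psi> \<in> extensional (carrier (pi1 X a))"
      by (simp add: conj_action_def)
    fix c assume c: "c \<in> carrier (pi1 X a)"
    then obtain p where p: "p \<in> loops_at X a" "c = loop_class X a p" by (rule pi1_carrierE)
    have "pathin X p" "p 0 = a" "p 1 = a" using p(1) by (auto simp: loops_at_def)
    then show "\<psi>' c = conj_action (pi1 X a) G (k a) \<psi> c"
      using c \<psi>(2)[OF p(1)] \<psi>'(2)[OF p(1)] k(2)[of p] by (simp add: conj_action_def p(2))
  qed
  then show "\<exists>g\<in>carrier G. \<psi>' = conj_action (pi1 X a) G g \<psi>" using k(1)[OF a] by blast
next
  assume "\<exists>g\<in>carrier G. \<psi>' = conj_action (pi1 X a) G g \<psi>"
  then obtain g where g: "g \<in> carrier G" "\<psi>' = conj_action (pi1 X a) G g \<psi>" by blast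
  have "\<forall>x\<in>topspace X. \<exists>p. pathin X p \<and> p 0 = a \<and> p 1 = x"
    using X a unfolding path_connected_space_def by blast
  then obtain \<gamma> where \<gamma>: "\<And>x. x \<in> topspace X \<Longrightarrow> pathin X (\<gamma> x) \<and> \<gamma> x 0 = a \<and> \<gamma> x 1 = x" by metis
  define k where "k x = inv (\<tau>' (\<gamma> x)) \<otimes> g \<otimes> \<tau> (\<gamma> x)" for x
  have c: "\<tau> (\<gamma> x) \<in> carrier G" "\<tau>' (\<gamma> x) \<in> carrier G" if "x \<in> topspace X" for x
    using \<gamma>[OF that] groupoid_repD(1)[OF \<tau>] groupoid_repD(1)[OF \<tau>'] by auto
  have "\<tau>' p = k (p 0) \<otimes> \<tau> p \<otimes> inv (k (p 1))" if p: "pathin X p" for p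
  proof -
    note e = path_start_in_topspace[OF p] path_finish_in_topspace[OF p]
    note \<gamma>0 = \<gamma>[OF e(1)] and \<gamma>1 = \<gamma>[OF e(2)] and c0 = c[OF e(1)] and c1 = c[OF e(2)]
    let ?l = "path_join (path_join (\<gamma> (p 0)) p) (path_reverse (\<gamma> (p 1)))"
    have l: "?l \<in> loops_at X a"
      using p \<gamma>0 \<gamma>1 by (simp add: loops_at_def pathin_join pathin_reverse)
    have \<tau>l: "\<sigma> ?l = \<sigma> (\<gamma> (p 0)) \<otimes> \<sigma> p \<otimes> inv (\<sigma> (\<gamma> (p 1)))" if "groupoid_rep X G \<sigma>" for \<sigma>
      using p \<gamma>0 \<gamma>1
      by (simp add: groupoid_repD(2)[OF that] pathin_join pathin_reverse groupoid_rep_reverse[OF that])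
    have \<tau>p: "\<tau> p \<in> carrier G" "\<tau>' p \<in> carrier G"
      using p groupoid_repD(1)[OF \<tau>] groupoid_repD(1)[OF \<tau>'] by auto
    have "\<tau>' ?l = g \<otimes> \<tau> ?l \<otimes> inv g"
      using g(2) \<psi>(2)[OF l] \<psi>'(2)[OF l] loop_class_in_pi1[OF l] by (simp add: conj_action_def)
    then have eq: "\<tau>' (\<gamma> (p 0)) \<otimes> \<tau>' p \<otimes> inv (\<tau>' (\<gamma> (p 1))) =
        g \<otimes> (\<tau> (\<gamma> (p 0)) \<otimes> \<tau> p \<otimes> inv (\<tau> (\<gamma> (p 1)))) \<otimes> inv g"
      unfolding \<tau>l[OF \<tau>] \<tau>l[OF \<tau>'] .
    have "\<tau>' p = inv (\<tau>' (\<gamma> (p 0))) \<otimes>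
        (\<tau>' (\<gamma> (p 0)) \<otimes> \<tau>' p \<otimes> inv (\<tau>' (\<gamma> (p 1)))) \<otimes> \<tau>' (\<gamma> (p 1))"
      using c0 c1 \<tau>p by (simp add: m_assoc inv_cancel_left)
    also have "\<dots> = k (p 0) \<otimes> \<tau> p \<otimes> inv (k (p 1))"
      unfolding eq k_def using c0 c1 \<tau>p g(1) by (simp add: m_assoc inv_mult_group)
    finally show ?thesis .
  qed
  moreover have "k x \<in> carrier G" if "x \<in> topspace X" for x
    unfolding k_def using c[OF that] g(1) by simp
  ultimately show "gauge_equivalent X G \<tau> \<tau>'"
    unfolding gauge_equivalent_def by (intro exI[of _ k]) blast
qed

lemma orbit_conj_eq_iff:
  fixes K :: "('p, 'n) monoid_scheme"
  assumes \<psi>: "\<psi> \<in> Hom K G" and \<psi>': "\<psi>' \<in> Hom K G"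
  shows "orbit G (conj_action K G) \<psi> = orbit G (conj_action K G) \<psi>' \<longleftrightarrow>
    (\<exists>g\<in>carrier G. \<psi>' = conj_action K G g \<psi>)"
proof -
  have in_G: "\<phi> c \<in> carrier G" if "\<phi> \<in> Hom K G" "c \<in> carrier K" for \<phi> c
    using that unfolding Hom_def by (auto intro: hom_in_carrier)
  have mult: "conj_action K G g (conj_action K G h \<phi>) = conj_action K G (g \<otimes> h) \<phi>"
    if "g \<in> carrier G" "h \<in> carrier G" "\<phi> \<in> Hom K G" for g h \<phi>
    unfolding conj_action_def using that(1,2) in_G[OF that(3)]
    by (auto simp: fun_eq_iff m_assoc inv_mult_group)
  have one: "conj_action K G \<one> \<phi> = \<phi>" if "\<phi> \<in> Hom K G" for \<phi>
    using that in_G[OF that] unfolding conj_action_def Hom_def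
    by (intro extensionalityI[of _ "carrier K"]) auto
  show ?thesis
  proof
    assume eq: "orbit G (conj_action K G) \<psi> = orbit G (conj_action K G) \<psi>'"
    have "\<psi>' \<in> orbit G (conj_action K G) \<psi>'"
      unfolding orbit_def using one[OF \<psi>'] by (metis (mono_tags, lifting) mem_Collect_eq one_closed)
    then show "\<exists>g\<in>carrier G. \<psi>' = conj_action K G g \<psi>"
      unfolding eq[symmetric] by (auto simp: orbit_def)
  next
    assume "\<exists>g\<in>carrier G. \<psi>' = conj_action K G g \<psi>"
    then obtain g where g: "g \<in> carrier G" "\<psi>' = conj_action K G g \<psi>" by blast
    have "conj_action K G h \<psi> = conj_action K G (h \<otimes> inv g) \<psi>'" if "h \<in> carrier G" for h
      unfolding g(2) using mult[OF _ g(1) \<psi>, of "h \<otimes> inv g"] g(1) that by (simp add: m_assoc)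
    moreover have "conj_action K G h \<psi>' = conj_action K G (h \<otimes> g) \<psi>" if "h \<in> carrier G" for h
      unfolding g(2) using mult[OF that g(1) \<psi>] .
    ultimately show "orbit G (conj_action K G) \<psi> = orbit G (conj_action K G) \<psi>'"
      unfolding orbit_def using g(1) by (blast intro: m_closed inv_closed)
  qed
qed

end


section \<open>The classification\<close>

lemma quotient_by_kernel_bij:
  assumes r: "r = {(x, y). x \<in> A \<and> y \<in> A \<and> f x = f y}" and f: "f ` A = B"
  shows "\<exists>F. bij_betw F (A // r) B \<and> (\<forall>x\<in>A. F (r `` {x}) = f x)"
proof -
  define F where "F c = f (SOME x. x \<in> c)" for c
  have F: "F (r `` {x}) = f x" if "x \<in> A" for x
  proof -
    have "(SOME y. y \<in> r `` {x}) \<in> r `` {x}" by (rule someI[of _ x]) (use that r in auto)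
    then show ?thesis using r by (auto simp: F_def)
  qed
  have "inj_on F (A // r)"
  proof (rule inj_onI)
    fix c d assume cd: "c \<in> A // r" "d \<in> A // r" and eq: "F c = F d"
    from cd obtain x y where xy: "x \<in> A" "y \<in> A" "c = r `` {x}" "d = r `` {y}"
      by (elim quotientE) blast
    then have "f x = f y" using eq F by simp
    then show "c = d" unfolding xy(3,4) using xy(1,2) r by auto
  qed
  moreover have "F ` (A // r) = B"
  proof -
    have "A // r = (\<lambda>x. r `` {x}) ` A" by (simp add: quotient_def UNION_singleton_eq_range)
    then show ?thesis using f by (simp add: image_image F cong: image_cong)
  qed
  ultimately show ?thesis using F by (auto simp: bij_betw_def)
qed

theorem proposition1p3p1:
  fixes X :: "'x topology" and a :: 'x and G :: "('g, 'm) monoid_scheme"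
  assumes "connected_space X"
    and "locally_relatively_1_connected X"
    and "a \<in> topspace X"
    and "group G"
  shows "\<exists>F. bij_betw F (H1_const X G) (Hom_mod_conj (pi1 X a) G) \<and>
             F (H1_const_point X G) = Hom_mod_conj_point (pi1 X a) G"
proof -
  interpret group G by fact
  have lpc: "locally_path_connected_space X"
    using assms(2) unfolding locally_relatively_1_connected_def locally_path_connected_space_def
    by (rule neighbourhood_base_of_mono) blast
  have pc: "path_connected_space X" using path_connected_eq_connected_space[OF lpc] assms(1) by simp
  let ?A = "constant_sheaf X G" and ?K = "pi1 X a"
  let ?T = "{P :: ('x, 'x \<Rightarrow> 'g, 'x \<Rightarrow> 'g) presheaf_with_action. is_torsor X ?A P}"
  let ?orb = "orbit G (conj_action ?K G)"
  \<comment> \<open>\<open>M\<close> relates a torsor to its monodromy, which depends on the frame and is therefore a relation;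
    it becomes a function on the level of orbits.\<close>
  define M where "M P \<psi> \<longleftrightarrow> (\<exists>\<kappa> \<tau>. framing X G P \<kappa> \<and> flat_family.transport G X (flats X P \<kappa>) \<tau> \<and>
      groupoid_rep X G \<tau> \<and> \<psi> \<in> Hom ?K G \<and> (\<forall>p\<in>loops_at X a. \<psi> (loop_class X a p) = \<tau> p))"
    for P :: "('x, 'x \<Rightarrow> 'g, 'x \<Rightarrow> 'g) presheaf_with_action" and \<psi>
  have M_Hom: "\<psi> \<in> Hom ?K G" if "M P \<psi>" for P \<psi> using that unfolding M_def by blast
  have M_ex: "\<exists>\<psi>. M P \<psi>" if P: "P \<in> ?T" for P
  proof -
    interpret P: constant_sheaf_torsor G X P by unfold_locales (use P in simp)
    obtain \<kappa> where \<kappa>: "framing X G P \<kappa>" using P.framing_exists by blast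
    interpret F: flat_family G X "flats X P \<kappa>" by (rule P.framing_flat_family[OF \<kappa>])
    have rep: "groupoid_rep X G F.holonomy" using F.transport_holonomy unfolding F.transport_def by blast
    obtain \<psi> where "\<psi> \<in> Hom ?K G" "\<forall>p\<in>loops_at X a. \<psi> (loop_class X a p) = F.holonomy p"
      using Hom_of_groupoid_rep[OF rep] by blast
    then show ?thesis unfolding M_def using \<kappa> F.transport_holonomy rep by blast
  qed
  have M_surj: "\<exists>P\<in>?T. M P \<psi>" if \<psi>: "\<psi> \<in> Hom ?K G" for \<psi>
  proof -
    obtain \<tau> where \<tau>: "groupoid_rep X G \<tau>" "\<forall>p\<in>loops_at X a. \<psi> (loop_class X a p) = \<tau> p"
      using groupoid_rep_of_Hom[OF pc assms(3) \<psi>] by blast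
    have "M (transport_torsor X G \<tau>) \<psi>"
      unfolding M_def
      using framing_transport_torsor transport_transport_torsor[OF assms(2) \<tau>(1)] \<tau> \<psi> by blast
    then show ?thesis using is_torsor_transport_torsor[OF assms(2) \<tau>(1)] by blast
  qed
  have M_iso: "torsors_isomorphic X ?A P Q \<longleftrightarrow> ?orb \<psi> = ?orb \<psi>'"
    if PQ: "P \<in> ?T" "Q \<in> ?T" "M P \<psi>" "M Q \<psi>'" for P Q \<psi> \<psi>'
  proof -
    have T: "is_torsor X ?A P" "is_torsor X ?A Q" using PQ by simp_all
    obtain \<kappa> \<tau> where \<kappa>: "framing X G P \<kappa>" "flat_family.transport G X (flats X P \<kappa>) \<tau>"
      and \<tau>: "groupoid_rep X G \<tau>" "\<psi> \<in> Hom ?K G" "\<And>p. p \<in> loops_at X a \<Longrightarrow> \<psi> (loop_class X a p) = \<tau> p"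
      using PQ(3) unfolding M_def by blast
    obtain \<kappa>' \<tau>' where \<kappa>': "framing X G Q \<kappa>'" "flat_family.transport G X (flats X Q \<kappa>') \<tau>'"
      and \<tau>': "groupoid_rep X G \<tau>'" "\<psi>' \<in> Hom ?K G" "\<And>p. p \<in> loops_at X a \<Longrightarrow> \<psi>' (loop_class X a p) = \<tau>' p"
      using PQ(4) unfolding M_def by blast
    have "torsors_isomorphic X ?A P Q \<longleftrightarrow> gauge_equivalent X G \<tau> \<tau>'"
      using isomorphic_imp_gauge_equivalent[OF T _ \<kappa> \<kappa>']
        gauge_equivalent_imp_isomorphic[OF T lpc \<kappa> \<kappa>'] by blast
    also have "\<dots> \<longleftrightarrow> (\<exists>g\<in>carrier G. \<psi>' = conj_action ?K G g \<psi>)"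
      by (rule conj_iff_gauge_equivalent[OF pc assms(3) \<tau>(1) \<tau>'(1) \<tau>(2,3) \<tau>'(2,3)])
    also have "\<dots> \<longleftrightarrow> ?orb \<psi> = ?orb \<psi>'"
      by (rule orbit_conj_eq_iff[OF \<tau>(2) \<tau>'(2), symmetric])
    finally show ?thesis .
  qed
  define m where "m P = (SOME \<psi>. M P \<psi>)" for P
  have m: "M P (m P)" if "P \<in> ?T" for P unfolding m_def by (rule someI_ex[OF M_ex[OF that]])
  have rel: "torsor_isomorphism_rel X ?A =
      {(P, Q). P \<in> ?T \<and> Q \<in> ?T \<and> ?orb (m P) = ?orb (m Q)}"
    unfolding torsor_isomorphism_rel_def using M_iso[OF _ _ m m] by blast
  have "(\<lambda>P. ?orb (m P)) ` ?T = orbits G (Hom ?K G) (conj_action ?K G)"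
  proof
    show "(\<lambda>P. ?orb (m P)) ` ?T \<subseteq> orbits G (Hom ?K G) (conj_action ?K G)"
      unfolding orbits_def using m M_Hom by blast
    show "orbits G (Hom ?K G) (conj_action ?K G) \<subseteq> (\<lambda>P. ?orb (m P)) ` ?T"
    proof
      fix B assume "B \<in> orbits G (Hom ?K G) (conj_action ?K G)"
      then obtain \<psi> where \<psi>: "\<psi> \<in> Hom ?K G" "B = ?orb \<psi>" unfolding orbits_def by blast
      then obtain P where P: "P \<in> ?T" "M P \<psi>" using M_surj by blast
      then have "?orb (m P) = B" using M_iso[OF P(1) P(1) m P(2)] torsors_isomorphic_refl \<psi>(2) by blast
      then show "B \<in> (\<lambda>P. ?orb (m P)) ` ?T" using P(1) by blast
    qed
  qed
  from quotient_by_kernel_bij[OF rel this]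
  obtain F where F: "bij_betw F (H1_const X G) (Hom_mod_conj ?K G)"
    "\<And>P. P \<in> ?T \<Longrightarrow> F (torsor_isomorphism_rel X ?A `` {P}) = ?orb (m P)"
    unfolding H1_const_def Hom_mod_conj_def by blast
  have triv: "trivial_torsor ?A \<in> ?T"
    by (simp add: is_torsor_trivial_torsor is_group_sheaf_constant_sheaf is_group)
  have "M (trivial_torsor ?A) (\<lambda>c\<in>carrier ?K. \<one>\<^bsub>G\<^esub>)"
    unfolding M_def
  proof (intro exI conjI)
    show "framing X G (trivial_torsor ?A) (\<lambda>U f. f)" by (rule framing_trivial_torsor)
    show "flat_family.transport G X (flats X (trivial_torsor ?A) (\<lambda>U f. f)) (\<lambda>p. \<one>\<^bsub>G\<^esub>)"
      by (rule transport_trivial_torsor)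
    show "groupoid_rep X G (\<lambda>p. \<one>\<^bsub>G\<^esub>)" by (rule groupoid_rep_trivial)
    show "(\<lambda>c\<in>carrier ?K. \<one>\<^bsub>G\<^esub>) \<in> Hom ?K G"
      unfolding Hom_def hom_def
      by (auto simp: pi1_mult loops_at_join loop_class_in_pi1 elim!: pi1_carrierE)
    show "\<forall>p\<in>loops_at X a. (\<lambda>c\<in>carrier ?K. \<one>\<^bsub>G\<^esub>) (loop_class X a p) = \<one>\<^bsub>G\<^esub>"
      by (simp add: loop_class_in_pi1)
  qed
  then have "?orb (m (trivial_torsor ?A)) = ?orb (\<lambda>c\<in>carrier ?K. \<one>\<^bsub>G\<^esub>)"
    using M_iso[OF triv triv m[OF triv]] torsors_isomorphic_refl by blast
  then have "F (H1_const_point X G) = Hom_mod_conj_point ?K G"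
    unfolding H1_const_point_def Hom_mod_conj_point_def using F(2)[OF triv] by simp
  then show ?thesis using F(1) by blast
qed


end
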